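(* Let $1\le \ell\le n$ and $N=\binom n2-\binom\ell2$. Let $(A^\bullet,\mu^\bullet(\lambda))$ be the Orlik-Solomon algebra of the discriminantal arrangement $\mathcal A_{n,\ell}$, regarded as a complex with differential given by left multiplication by $\omega_\lambda$, and let $(\mathbf C^\bullet,\delta^\bullet(t))$, $t\in(\mathbb C^* )^N$, be the cochain complex described in the context, which arises from the group $P_{n,\ell}$. Then $(A^\bullet,\mu^\bullet(\lambda))$ is a linear approximation of $(\mathbf C^\bullet,\delta^\bullet(t))$, in the following sense. For each $\lambda\in\mathbb C^N$, the system of complex vector spaces and linear maps $(\mathbf C^\bullet,\delta^\bullet_*(\lambda))$ is a complex, where $\delta^q_*$ denotes the derivative of $\delta^q$ at $\mathbf 1=(1,\dots,1)$. Moreover, for each $q$ one has $A^q\cong\mathbf C^q$ (the basis element $a_{I,J}$ corresponding to the basis element $\varepsilon_{I,J}$), and under this identification $\mu^q(\lambda)=\delta^q_*(\lambda)$.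
   Context: **Orlik-Solomon algebra.** Let $\mathcal E$ be the exterior algebra over $\mathbb C$ on generators $e_{i,j}$, $\ell+1\le j\le n$, $1\le i<j$. Let $\mathcal I$ be the ideal generated by $e_{i,j}\wedge e_{i,k}-e_{i,j}\wedge e_{j,k}+e_{i,k}\wedge e_{j,k}$ for $1\le i<j<k\le n$ with $j\ge\ell+1$, and by $e_{i,k}\wedge e_{j,k}$ for $1\le i<j\le\ell<k\le n$. Put $A=\mathcal E/\mathcal I=\bigoplus_{q=0}^{n-\ell}A^q$, and let $a_{i,j}$ be the image of $e_{i,j}$. For $J=\{j_1<\dots<j_q\}\subseteq[\ell+1,n]=\{\ell+1,\dots,n\}$ and $I=(i_1,\dots,i_q)$ with $1\le i_p<j_p$, put $a_{I,J}=a_{i_1,j_1}\wedge\cdots\wedge a_{i_q,j_q}$ (equal to $1$ if $q=0$). It is known that the $a_{I,J}$ with $|J|=q$ form a basis of $A^q$. For $\lambda=(\lambda_{i,j})\in\mathbb C^N$ (same index set) let $\omega_\lambda=\sum\lambda_{i,j}a_{i,j}$ and $\mu^q(\lambda):A^q\to A^{q+1}$, $\eta\mapsto\omega_\lambda\wedge\eta$. **The group.** $P_{n,\ell}=\ker(P_n\to P_\ell)$ is the kernel of the map of pure braid groups forgetting the last $n-\ell$ strands. It is the fundamental group of $M_{n,\ell}$, the configuration space of $n-\ell$ ordered points in $\mathbb C\setminus\{\ell\text{ points}\}$, which is the complement of $\mathcal A_{n,\ell}$. It is the iterated semidirect product $G_n\rtimes\cdots\rtimes G_{\ell+1}$, where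 $G_j$ is free on $\gamma_{1,j},\dots,\gamma_{j-1,j}$. It is generated by $\gamma_{i,j}$ ($\ell<j\le n$, $1\le i<j$), with $\gamma_{r,s}$ (for $\ell<s<j$, $r<s$) acting on $G_j$ on the right by $\gamma_{r,s}(\gamma_{i,j})=\gamma_{r,s}^{-1}\gamma_{i,j}\gamma_{r,s}=z_i\gamma_{i,j}z_i^{-1}$. Here $z_i=\gamma_{r,j}\gamma_{s,j}$ if $i\in\{r,s\}$; $z_i=[\gamma_{r,j},\gamma_{s,j}]=\gamma_{r,j}\gamma_{s,j}\gamma_{r,j}^{-1}\gamma_{s,j}^{-1}$ if $r<i<s$; and $z_i=1$ otherwise. Let $R=\mathbb ZP_{n,\ell}$. **Conventions.** Elements of $R^k$ are row vectors, and linear maps are matrices acting on the right. $[F]^k$ denotes the direct sum of $k$ copies of $F$. For $\gamma\in P_{j-1,\ell}$ let $\mathcal J(\gamma)=\bigl(\partial\gamma(\gamma_{i,j})/\partial\gamma_{k,j}\bigr)_{i,k}$ be the $(j-1)\times(j-1)$ Jacobian of Fox derivatives of the automorphism $x\mapsto\gamma^{-1}x\gamma$ of $G_j$, and let $\rho_j(\gamma)=\gamma\cdot\mathcal J(\gamma)\in GL_{j-1}(R)$. This gives a representation, extended to all of $P_{n,\ell}$ by $\rho_j(\gamma_{p,q})=\mathrm{Id}_{j-1}$ for $q\ge j$. Denote by $\tilde\rho_j$ its extension to $R$, and also the operation on matrices over $R$ replacing each entry $x$ by the block $\tilde\rho_j(x)$. **The resolution.** For $J=\{j_1<\dots<j_q\}\subseteq[\ell+1,n]$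 let $C_q^J$ be the free $R$-module of rank $(j_1-1)\cdots(j_q-1)$ with basis $e_{I,J}$, $I=(i_1,\dots,i_q)$, $1\le i_p<j_p$, ordered lexicographically. Let $C_0=R$ and $C_q=\bigoplus_{|J|=q}C_q^J$. Write $J_p=\{j_1,\dots,j_p\}$, $J^p=J\setminus J_p$, $J^0=J$. Define $\Delta_{\{j\}}=(\gamma_{1,j}-1,\dots,\gamma_{j-1,j}-1)^\top:R^{j-1}\to R$ and, for $q\ge2$, $\Delta_J=-\tilde\rho_{j_q}(\Delta_{J_{q-1}}):C_q^J\to C_{q-1}^{J^1}$. Define $\Delta^J=(\Delta_J,[\Delta_{J^1}]^{d_1},\dots,[\Delta_{J^{q-1}}]^{d_{q-1}}):C_q^J\to\bigoplus_{p=1}^qC_{q-1}^{J\setminus\{j_p\}}$ with $d_p=(j_1-1)\cdots(j_p-1)$, and $\partial_q=\sum_{|J|=q}\Delta^J$. It is known that $(C_\bullet,\partial_\bullet)$ is a finite free $R$-resolution of $\mathbb Z$. **The complex $\mathbf C^\bullet$.** For $t=(t_{i,j})\in(\mathbb C^* )^N$ let $\nu_t:P_{n,\ell}\to\mathbb C^*$, $\gamma_{i,j}\mapsto t_{i,j}$. For a matrix $F$ over $R$, $F(t)$ is the complex matrix obtained by applying the linear extension of $\nu_t$ to each entry. Let $\mathbf C_q$ be the complex vector space with basis $e_{I,J}$, $|J|=q$, let $\partial_q(t):\mathbf C_q\to\mathbf C_{q-1}$ be the evaluated boundary map, let $\mathbf C^q=\mathrm{Hom}_{\mathbb C}(\mathbf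 C_q,\mathbb C)$ with dual basis $\varepsilon_{I,J}$, and define $\delta^q(t):\mathbf C^q\to\mathbf C^{q+1}$ by $\delta^q(t)(u)(x)=(-1)^qu(\partial_{q+1}(t)(x))$. (This is the complex $\mathrm{Hom}_{P_{n,\ell}}(C_\bullet,L_t)$, where $L_t=\mathbb C$ with action via $\nu_t$; its cohomology is $H^*(M_{n,\ell};\mathcal L_t)$, with $\mathcal L_t$ the rank one local system of $\nu_t$.) **Derivatives.** For a matrix-valued holomorphic function $F$ of $t\in(\mathbb C^* )^N$, its derivative at $\mathbf 1$ is $F_*(\lambda)=\frac{d}{dx}\big|_{x=0}F\bigl((e^{x\lambda_{i,j}})_{i,j}\bigr)$, $\lambda\in\mathbb C^N$. *)

theory Defs
  imports
    "HOL-Library.Poly_Mapping"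
    "HOL-Algebra.QuotRing"
    "HOL-Analysis.Derivative"
begin

section \<open>Free groups\<close>

text \<open>
  Groups are instances of \<^class>\<open>group_add\<close>, which is not assumed to be commutative: the group
  law is written \<open>+\<close>, the neutral element \<open>0\<close> and the inverse \<open>-\<close>.  This makes
  \<open>'g \<Rightarrow>\<^sub>0 int\<close> of \<^theory>\<open>HOL-Library.Poly_Mapping\<close>, with its convolution product, the integral group
  ring of \<open>'g\<close>, and \<open>frag_of g\<close> the group element \<open>g\<close> in it.
  A letter \<open>(x, True)\<close> stands for \<open>x\<close> and \<open>(x, False)\<close> for its inverse.
\<close>

inductive fg_eq :: "('a \<times> bool) list \<Rightarrow> ('a \<times> bool) list \<Rightarrow> bool" where
  fg_refl: "fg_eq u u"
| fg_sym: "fg_eq u v \<Longrightarrow> fg_eq v u"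
| fg_trans: "fg_eq u v \<Longrightarrow> fg_eq v w \<Longrightarrow> fg_eq u w"
| fg_cancel: "fg_eq (u @ [(x, b), (x, \<not> b)] @ v) (u @ v)"

quotient_type 'a free_group = "('a \<times> bool) list" / fg_eq
  by (rule equivpI) (auto intro: reflpI sympI transpI fg_eq.intros)

lemma fg_eq_append_ctx: "fg_eq u v \<Longrightarrow> fg_eq (a @ u @ c) (a @ v @ c)"
proof (induction rule: fg_eq.induct)
  case (fg_cancel u x b v)
  then show ?case using fg_eq.fg_cancel[of "a @ u" x b "v @ c"] by simp
qed (auto intro: fg_eq.intros)

lemma fg_eq_append: "fg_eq u u' \<Longrightarrow> fg_eq v v' \<Longrightarrow> fg_eq (u @ v) (u' @ v')"
  using fg_eq_append_ctx[of u u' "[]" v] fg_eq_append_ctx[of v v' u' "[]"] fg_trans by auto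

definition winv :: "('a \<times> bool) list \<Rightarrow> ('a \<times> bool) list" where
  "winv w = rev (map (\<lambda>(x, b). (x, \<not> b)) w)"

lemma fg_eq_winv: "fg_eq u v \<Longrightarrow> fg_eq (winv u) (winv v)"
proof (induction rule: fg_eq.induct)
  case (fg_cancel u x b v)
  then show ?case using fg_eq.fg_cancel[of "winv v" x b "winv u"] by (simp add: winv_def)
qed (auto intro: fg_eq.intros)

lemma fg_eq_winv_left: "fg_eq (winv w @ w) []"
proof (induction w)
  case (Cons a w)
  obtain x b where a: "a = (x, b)" by (cases a)
  have "fg_eq (winv w @ [(x, \<not> b), (x, \<not> \<not> b)] @ w) (winv w @ w)"
    by (rule fg_cancel)
  then show ?case using Cons fg_trans by (fastforce simp: winv_def a)
qed (auto simp: winv_def intro: fg_refl)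

instantiation free_group :: (type) group_add
begin

lift_definition zero_free_group :: "'a free_group" is "[]" .
lift_definition plus_free_group :: "'a free_group \<Rightarrow> 'a free_group \<Rightarrow> 'a free_group" is "(@)"
  by (rule fg_eq_append)
lift_definition uminus_free_group :: "'a free_group \<Rightarrow> 'a free_group" is winv
  by (rule fg_eq_winv)
definition minus_free_group :: "'a free_group \<Rightarrow> 'a free_group \<Rightarrow> 'a free_group" where
  "minus_free_group x y = x + (- y)"

instance
proof
  fix a b c :: "'a free_group"
  show "a + b + c = a + (b + c)" by transfer (simp add: fg_refl)
  show "0 + a = a" by transfer (simp add: fg_refl)
  show "a + 0 = a" by transfer (simp add: fg_refl)
  show "- a + a = 0" by transfer (rule fg_eq_winv_left)
  show "a + - b = a - b" by (simp add: minus_free_group_def)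
qed

end

lift_definition fgen :: "'a \<Rightarrow> 'a free_group" is "\<lambda>x. [(x, True)]" .

lemma free_group_induct [case_names zero gen inv]:
  assumes "P 0" "\<And>x w. P w \<Longrightarrow> P (fgen x + w)" "\<And>x w. P w \<Longrightarrow> P (- fgen x + w)"
  shows "P w"
proof -
  have *: "P (abs_free_group u)" for u
  proof (induction u)
    case Nil
    then show ?case using assms(1) by (simp add: zero_free_group_def)
  next
    case (Cons a u)
    obtain x b where a: "a = (x, b)" by (cases a)
    show ?case
      using assms(2,3)[OF Cons, of x]
      by (cases b) (simp_all add: a plus_free_group.abs_eq fgen.abs_eq uminus_free_group.abs_eq winv_def)
  qed
  show ?thesis using *[of "rep_free_group w"] by (metis Quotient3_abs_rep Quotient3_free_group)
qed

text \<open>Universal property: the homomorphism that extends a map on the generators.\<close>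

lift_definition flift :: "('a \<Rightarrow> 'g::group_add) \<Rightarrow> 'a free_group \<Rightarrow> 'g" is
  "\<lambda>f w. sum_list (map (\<lambda>(x, b). if b then f x else - f x) w)"
proof -
  fix f :: "'a \<Rightarrow> 'g" and u v :: "('a \<times> bool) list"
  assume "fg_eq u v"
  then show "sum_list (map (\<lambda>(x, b). if b then f x else - f x) u) =
             sum_list (map (\<lambda>(x, b). if b then f x else - f x) v)"
    by (induction rule: fg_eq.induct) (auto simp: add.assoc[symmetric])
qed

lemma flift_zero [simp]: "flift f 0 = 0" by transfer simp
lemma flift_add [simp]: "flift f (u + v) = flift f u + flift f v" by transfer simp
lemma flift_fgen [simp]: "flift f (fgen x) = f x" by transfer simp
lemma flift_uminus [simp]: "flift f (- u) = - flift f u"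
proof -
  have "flift f (- u) + flift f u = 0" by (simp only: flift_add[symmetric] left_minus flift_zero)
  then show ?thesis by (simp only: add_eq_0_iff2)
qed

definition exp_sum :: "'a \<Rightarrow> 'a free_group \<Rightarrow> int" where
  "exp_sum x = flift (\<lambda>y. if y = x then 1 else 0)"

text \<open>Fox derivative, determined by \<open>\<partial>(uv) = \<partial>u + u \<partial>v\<close>.\<close>

fun fox_word :: "'a \<Rightarrow> ('a \<times> bool) list \<Rightarrow> ('a free_group \<Rightarrow>\<^sub>0 int)" where
  "fox_word k [] = 0"
| "fox_word k ((x, True) # w) =
     (if x = k then 1 else 0) + frag_of (fgen x) * fox_word k w"
| "fox_word k ((x, False) # w) =
     - (if x = k then frag_of (- fgen x) else 0) + frag_of (- fgen x) * fox_word k w"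

lemma frag_of_add: "frag_of (g + h) = frag_of g * (frag_of h :: 'g::monoid_add \<Rightarrow>\<^sub>0 int)"
  by (simp add: mult_single)

lemma frag_of_zero: "(frag_of 0 :: 'g::monoid_add \<Rightarrow>\<^sub>0 int) = 1"
  by (simp add: single_one)

lemma fox_word_append:
  "fox_word k (u @ v) = fox_word k u + frag_of (abs_free_group u) * fox_word k v"
proof (induction u)
  case Nil
  then show ?case
    by (simp add: zero_free_group_def[symmetric] single_one)
next
  case (Cons a u)
  obtain x b where a: "a = (x, b)" by (cases a)
  have T: "abs_free_group ((x, True) # u) = fgen x + abs_free_group u"
    by (simp add: plus_free_group.abs_eq fgen.abs_eq)
  have F: "abs_free_group ((x, False) # u) = - fgen x + abs_free_group u"
    by (simp add: plus_free_group.abs_eq fgen.abs_eq uminus_free_group.abs_eq winv_def)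
  show ?case
    by (cases b) (simp_all add: a Cons T F frag_of_add distrib_left mult.assoc)
qed

lift_definition fox :: "'a \<Rightarrow> 'a free_group \<Rightarrow> ('a free_group \<Rightarrow>\<^sub>0 int)" is fox_word
proof -
  fix k :: 'a and u v :: "('a \<times> bool) list"
  assume "fg_eq u v"
  then show "fox_word k u = fox_word k v"
  proof (induction rule: fg_eq.induct)
    case (fg_cancel u x b v)
    have 0: "fox_word k [(x, b), (x, \<not> b)] = 0"
      by (cases b) (simp_all add: frag_of_add[symmetric] frag_of_zero del: mult_single)
    have "abs_free_group [(x, b), (x, \<not> b)] = 0"
      using fg_eq.fg_cancel[of "[]" x b "[]"]
      by (simp add: zero_free_group_def free_group.abs_eq_iff)
    then have "fox_word k ([(x, b), (x, \<not> b)] @ v) = fox_word k v"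
      by (simp only: fox_word_append 0 frag_of_zero) simp
    then show ?case by (simp only: fox_word_append)
  qed auto
qed

lemma fox_zero [simp]: "fox k 0 = 0" by transfer simp
lemma fox_fgen [simp]: "fox k (fgen x) = (if x = k then 1 else 0)" by transfer simp
lemma fox_add: "fox k (u + v) = fox k u + frag_of u * fox k v"
proof -
  obtain u' v' where "u = abs_free_group u'" "v = abs_free_group v'"
    by (metis Quotient3_abs_rep Quotient3_free_group)
  then show ?thesis
    by (simp add: plus_free_group.abs_eq fox.abs_eq fox_word_append)
qed

section \<open>Automorphisms of free groups\<close>

typedef 'a fg_aut =
  "{f :: 'a free_group \<Rightarrow> 'a free_group. bij f \<and> (\<forall>u v. f (u + v) = f u + f v)}"
  morphisms fg_app Abs_fg_aut
  by (rule exI[of _ id]) simp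

setup_lifting type_definition_fg_aut

text \<open>Automorphisms act on the right: \<open>f + g\<close> is \<open>f\<close> followed by \<open>g\<close>.\<close>

instantiation fg_aut :: (type) group_add
begin

lift_definition zero_fg_aut :: "'a fg_aut" is id by simp
lift_definition plus_fg_aut :: "'a fg_aut \<Rightarrow> 'a fg_aut \<Rightarrow> 'a fg_aut" is "\<lambda>f g. g \<circ> f"
  by (auto intro: bij_comp)
lift_definition uminus_fg_aut :: "'a fg_aut \<Rightarrow> 'a fg_aut" is "inv_into UNIV"
proof -
  fix f :: "'a free_group \<Rightarrow> 'a free_group"
  assume f: "bij f \<and> (\<forall>u v. f (u + v) = f u + f v)"
  have "inv_into UNIV f (u + v) = inv_into UNIV f u + inv_into UNIV f v" for u v
    by (rule inv_f_eq) (use f in \<open>auto simp: bij_def surj_f_inv_f\<close>)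
  then show "bij (inv_into UNIV f) \<and> (\<forall>u v. inv_into UNIV f (u + v) = inv_into UNIV f u + inv_into UNIV f v)"
    using f by (simp add: bij_imp_bij_inv)
qed
definition minus_fg_aut :: "'a fg_aut \<Rightarrow> 'a fg_aut \<Rightarrow> 'a fg_aut" where
  "minus_fg_aut x y = x + (- y)"

instance
proof
  fix a b c :: "'a fg_aut"
  show "a + b + c = a + (b + c)" by transfer (simp add: comp_assoc)
  show "0 + a = a" by transfer simp
  show "a + 0 = a" by transfer simp
  show "- a + a = 0" by transfer (auto simp: fun_eq_iff bij_def surj_f_inv_f)
  show "a + - b = a - b" by (simp add: minus_fg_aut_def)
qed

end

lemma fg_app_zero_aut [simp]: "fg_app 0 u = u" by transfer simp
lemma fg_app_plus_aut [simp]: "fg_app (f + g) u = fg_app g (fg_app f u)" by transfer simp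
lemma fg_app_add [simp]: "fg_app f (u + v) = fg_app f u + fg_app f v" by transfer simp
lemma fg_app_zero [simp]: "fg_app f 0 = 0"
proof -
  have "fg_app f 0 + fg_app f 0 = fg_app f 0 + 0" by (simp flip: fg_app_add)
  then show ?thesis by (simp only: add_left_cancel)
qed
lemma fg_app_minus [simp]: "fg_app f (- u) = - fg_app f u"
proof -
  have "fg_app f (- u) + fg_app f u = 0" by (simp only: fg_app_add[symmetric] left_minus fg_app_zero)
  then show ?thesis by (simp only: add_eq_0_iff2)
qed
lemma fg_app_uminus_left [simp]: "fg_app (- f) (fg_app f u) = u"
  by (simp only: fg_app_plus_aut[symmetric] right_minus fg_app_zero_aut)
lemma fg_app_uminus_right [simp]: "fg_app f (fg_app (- f) u) = u"
  by (simp only: fg_app_plus_aut[symmetric] left_minus fg_app_zero_aut)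

lemma fg_aut_eqI:
  assumes "\<And>i. fg_app f (fgen i) = fg_app g (fgen i)"
  shows "f = g"
proof -
  have "fg_app f u = fg_app g u" for u
    by (induction u rule: free_group_induct) (simp_all add: assms)
  then show ?thesis by (simp add: fg_app_inject[symmetric] fun_eq_iff)
qed

section \<open>The pure braid groups\<close>

text \<open>
  The letter \<open>i\<close> of \<^typ>\<open>nat free_group\<close> plays the role of \<open>\<gamma>\<^sub>i\<^sub>j\<close> in \<open>G\<^sub>j\<close>, for every \<open>j\<close>; the
  conjugation action of \<open>\<gamma>\<^sub>r\<^sub>s\<close> (\<open>r < s < j\<close>) on \<open>G\<^sub>j\<close> is then independent of \<open>j\<close>.
\<close>

definition braid_conj :: "nat \<Rightarrow> nat \<Rightarrow> nat \<Rightarrow> nat free_group" where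
  "braid_conj r s i =
     (if i = r \<or> i = s then fgen r + fgen s
      else if r < i \<and> i < s then fgen r + fgen s + - fgen r + - fgen s
      else 0)"

definition braid_hom :: "nat \<Rightarrow> nat \<Rightarrow> nat free_group \<Rightarrow> nat free_group" where
  "braid_hom r s = flift (\<lambda>i. braid_conj r s i + fgen i + - braid_conj r s i)"

definition braid_conj_inv :: "nat \<Rightarrow> nat \<Rightarrow> nat \<Rightarrow> nat free_group" where
  "braid_conj_inv r s i =
     (if i = r \<or> i = s then - fgen s + - fgen r
      else if r < i \<and> i < s then - fgen s + - fgen r + fgen s + fgen r
      else 0)"

definition braid_hom_inv :: "nat \<Rightarrow> nat \<Rightarrow> nat free_group \<Rightarrow> nat free_group" where
  "braid_hom_inv r s = flift (\<lambda>i. braid_conj_inv r s i + fgen i + - braid_conj_inv r s i)"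

lemmas group_normalize = add.assoc minus_add diff_conv_add_uminus

lemma braid_hom_inverse:
  "braid_hom_inv r s (braid_hom r s u) = u" "braid_hom r s (braid_hom_inv r s u) = u"
proof -
  have hom: "braid_hom r s 0 = 0" "braid_hom_inv r s 0 = 0"
    "\<And>u v. braid_hom r s (u + v) = braid_hom r s u + braid_hom r s v"
    "\<And>u v. braid_hom_inv r s (u + v) = braid_hom_inv r s u + braid_hom_inv r s v"
    "\<And>u. braid_hom r s (- u) = - braid_hom r s u"
    "\<And>u. braid_hom_inv r s (- u) = - braid_hom_inv r s u"
    by (simp_all add: braid_hom_def braid_hom_inv_def)
  have "braid_hom_inv r s (braid_hom r s (fgen i)) = fgen i" for i
    by (auto simp add: braid_hom_def braid_hom_inv_def braid_conj_def braid_conj_inv_def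
        group_normalize simp del: add_uminus_conv_diff)
  then show "braid_hom_inv r s (braid_hom r s u) = u"
    by (induction u rule: free_group_induct) (simp_all add: hom)
  have "braid_hom r s (braid_hom_inv r s (fgen i)) = fgen i" for i
    by (auto simp add: braid_hom_def braid_hom_inv_def braid_conj_def braid_conj_inv_def
        group_normalize simp del: add_uminus_conv_diff)
  then show "braid_hom r s (braid_hom_inv r s u) = u"
    by (induction u rule: free_group_induct) (simp_all add: hom)
qed

lift_definition braid_aut :: "nat \<Rightarrow> nat \<Rightarrow> nat fg_aut" is braid_hom
proof -
  fix r s
  have "bij (braid_hom r s)"
    by (rule o_bij[of "braid_hom_inv r s"]) (simp_all add: fun_eq_iff braid_hom_inverse)
  then show "bij (braid_hom r s) \<and> (\<forall>u v. braid_hom r s (u + v) = braid_hom r s u + braid_hom r s v)"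
    by (simp add: braid_hom_def)
qed

lemma braid_aut_fgen:
  "fg_app (braid_aut r s) (fgen i) = braid_conj r s i + fgen i + - braid_conj r s i"
  by transfer (simp add: braid_hom_def)

lemma braid_aut_inv_fgen:
  "fg_app (- braid_aut r s) (fgen i) = braid_conj_inv r s i + fgen i + - braid_conj_inv r s i"
proof -
  have "fg_app (braid_aut r s) (braid_hom_inv r s (fgen i)) = fgen i"
    by transfer (rule braid_hom_inverse)
  then have "fg_app (- braid_aut r s) (fgen i) = braid_hom_inv r s (fgen i)"
    by (metis fg_app_uminus_left)
  then show ?thesis by (simp add: braid_hom_inv_def)
qed

definition strand_act :: "nat \<Rightarrow> nat free_group \<Rightarrow> nat fg_aut" where
  "strand_act s = flift (\<lambda>r. braid_aut r s)"

lemma strand_act_simps [simp]: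
  "strand_act s 0 = 0" "strand_act s (u + v) = strand_act s u + strand_act s v"
  "strand_act s (- u) = - strand_act s u" "strand_act s (fgen r) = braid_aut r s"
  by (simp_all add: strand_act_def)

lemma braid_relation:
  assumes "p < q" "q < s" "r < s"
  shows "braid_aut p q + strand_act s (fg_app (braid_aut p q) (fgen r))
       = braid_aut r s + braid_aut p q"
proof (rule fg_aut_eqI)
  fix i
  note defs = braid_aut_fgen braid_aut_inv_fgen braid_conj_def braid_conj_inv_def
  note word_simps = fg_app_add fg_app_minus minus_add minus_minus add.assoc
    minus_add_cancel add_minus_cancel left_minus right_minus add_0_left add_0_right
  have outer: "fg_app (braid_aut a b) (fgen k) = fgen k" "fg_app (- braid_aut a b) (fgen k) = fgen k"
    if "k < a \<or> b < k" "a < b" for a b k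
    using that by (auto simp: defs)
  have ends: "fg_app (braid_aut a b) (fgen a) = fgen a + (fgen b + (fgen a + (- fgen b + - fgen a)))"
    "fg_app (- braid_aut a b) (fgen a) = - fgen b + (fgen a + fgen b)"
    "fg_app (braid_aut a b) (fgen b) = fgen a + (fgen b + - fgen a)"
    "fg_app (- braid_aut a b) (fgen b) = - fgen b + (- fgen a + (fgen b + (fgen a + fgen b)))" for a b
    by (simp_all add: defs group_normalize del: add_uminus_conv_diff)
  have inner: "fg_app (braid_aut a b) (fgen k) =
      fgen a + (fgen b + (- fgen a + (- fgen b + (fgen k + (fgen b + (fgen a + (- fgen b + - fgen a)))))))"
    "fg_app (- braid_aut a b) (fgen k) =
      - fgen b + (- fgen a + (fgen b + (fgen a + (fgen k + (- fgen a + (- fgen b + (fgen a + fgen b)))))))"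
    if "a < k" "k < b" for a b k
    using that by (simp_all add: defs group_normalize del: add_uminus_conv_diff)
  note eval = outer ends inner word_simps simp_thms
  have s: "p < s" using assms by simp
  \<comment> \<open>Products of automorphisms are expanded first, so that words are reduced after each step.\<close>
  consider "r < p" | "r = p" | "p < r" "r < q" | "r = q" | "q < r" by linarith
  then show "fg_app (braid_aut p q + strand_act s (fg_app (braid_aut p q) (fgen r))) (fgen i)
      = fg_app (braid_aut r s + braid_aut p q) (fgen i)"
  proof cases
    case 1
    have o: "r < p" "r < q" "r < s" "p < q" "p < s" "q < s" using assms 1 by linarith+
    have t: "strand_act s (fg_app (braid_aut p q) (fgen r)) = braid_aut r s"
      by (simp only: o eval strand_act_simps)
    consider "i < r" | "i = r" | "r < i" "i < p" | "i = p" | "p < i" "i < q" | "i = q"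
      | "q < i" "i < s" | "i = s" | "s < i"
      by linarith
    then show ?thesis
      unfolding t fg_app_plus_aut
      by cases (simp_all only: o o[THEN less_trans] o[THEN less_trans[rotated]] eval)
  next
    case 2
    have o: "p < q" "p < s" "q < s" using assms 2 by linarith+
    have t: "strand_act s (fg_app (braid_aut p q) (fgen r)) =
        braid_aut p s + (braid_aut q s + (braid_aut p s + (- braid_aut q s + - braid_aut p s)))"
      by (simp only: o 2 eval strand_act_simps)
    consider "i < p" | "i = p" | "p < i" "i < q" | "i = q" | "q < i" "i < s" | "i = s"
      | "s < i"
      by linarith
    then show ?thesis
      unfolding t fg_app_plus_aut unfolding 2
      by cases (simp_all only: o o[THEN less_trans] o[THEN less_trans[rotated]] eval)
  next
    case 3
    have o: "p < r" "p < q" "p < s" "r < q" "r < s" "q < s" using assms 3 by linarith+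
    have t: "strand_act s (fg_app (braid_aut p q) (fgen r)) =
        braid_aut p s + (braid_aut q s + (- braid_aut p s + (- braid_aut q s + (braid_aut r s +
        (braid_aut q s + (braid_aut p s + (- braid_aut q s + - braid_aut p s)))))))"
      by (simp only: o eval strand_act_simps)
    consider "i < p" | "i = p" | "p < i" "i < r" | "i = r" | "r < i" "i < q" | "i = q"
      | "q < i" "i < s" | "i = s" | "s < i"
      by linarith
    then show ?thesis
      unfolding t fg_app_plus_aut
      by cases (simp_all only: o o[THEN less_trans] o[THEN less_trans[rotated]] eval)
  next
    case 4
    have o: "p < q" "p < s" "q < s" using assms 4 by linarith+
    have t: "strand_act s (fg_app (braid_aut p q) (fgen r)) =
        braid_aut p s + (braid_aut q s + - braid_aut p s)"
      by (simp only: o 4 eval strand_act_simps)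
    consider "i < p" | "i = p" | "p < i" "i < q" | "i = q" | "q < i" "i < s" | "i = s"
      | "s < i"
      by linarith
    then show ?thesis
      unfolding t fg_app_plus_aut unfolding 4
      by cases (simp_all only: o o[THEN less_trans] o[THEN less_trans[rotated]] eval)
  next
    case 5
    have o: "p < q" "p < r" "p < s" "q < r" "q < s" "r < s" using assms 5 by linarith+
    have t: "strand_act s (fg_app (braid_aut p q) (fgen r)) = braid_aut r s"
      by (simp only: o eval strand_act_simps)
    consider "i < p" | "i = p" | "p < i" "i < q" | "i = q" | "q < i" "i < r" | "i = r"
      | "r < i" "i < s" | "i = s" | "s < i"
      by linarith
    then show ?thesis
      unfolding t fg_app_plus_aut
      by cases (simp_all only: o o[THEN less_trans] o[THEN less_trans[rotated]] eval)
  qed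
qed

text \<open>\<open>strand_group j\<close> is \<open>G\<^sub>j\<close>, the free group on the letters \<open>1, \<dots>, j - 1\<close>.\<close>

inductive_set strand_group :: "nat \<Rightarrow> nat free_group set" for j where
  sg_zero: "0 \<in> strand_group j"
| sg_gen: "1 \<le> i \<Longrightarrow> i < j \<Longrightarrow> w \<in> strand_group j \<Longrightarrow> fgen i + w \<in> strand_group j"
| sg_inv: "1 \<le> i \<Longrightarrow> i < j \<Longrightarrow> w \<in> strand_group j \<Longrightarrow> - fgen i + w \<in> strand_group j"

lemma sg_fgen: "1 \<le> i \<Longrightarrow> i < j \<Longrightarrow> fgen i \<in> strand_group j"
  using sg_gen[OF _ _ sg_zero] by simp

lemma sg_add: "u \<in> strand_group j \<Longrightarrow> v \<in> strand_group j \<Longrightarrow> u + v \<in> strand_group j"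
  by (induction u rule: strand_group.induct) (auto simp: add.assoc intro: strand_group.intros)

lemma sg_uminus: "u \<in> strand_group j \<Longrightarrow> - u \<in> strand_group j"
proof (induction u rule: strand_group.induct)
  case (sg_gen i w)
  then show ?case
    using sg_add[OF sg_gen.IH strand_group.sg_inv[OF sg_gen(1,2) sg_zero]] by (simp add: minus_add)
next
  case (sg_inv i w)
  then show ?case
    using sg_add[OF sg_inv.IH sg_fgen[OF sg_inv(1,2)]] by (simp add: minus_add)
qed (auto intro: sg_zero)

lemma sg_braid_aut:
  assumes "u \<in> strand_group j" "1 \<le> r" "1 \<le> s" "r < j" "s < j"
  shows "fg_app (braid_aut r s) u \<in> strand_group j" "fg_app (- braid_aut r s) u \<in> strand_group j"
proof -
  have g: "fg_app (braid_aut r s) (fgen i) \<in> strand_group j"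
       "fg_app (- braid_aut r s) (fgen i) \<in> strand_group j" if "1 \<le> i" "i < j" for i
    unfolding braid_aut_fgen braid_aut_inv_fgen braid_conj_def braid_conj_inv_def
    using assms(2-) that by (auto intro!: sg_add sg_uminus sg_fgen sg_zero simp del: add_uminus_conv_diff)
  show "fg_app (braid_aut r s) u \<in> strand_group j" "fg_app (- braid_aut r s) u \<in> strand_group j"
    using assms(1)
    by (induction u rule: strand_group.induct) (simp_all add: sg_zero sg_add sg_uminus g)
qed

lemma sg_strand_act:
  assumes "y \<in> strand_group s" "u \<in> strand_group j" "s < j"
  shows "fg_app (strand_act s y) u \<in> strand_group j \<and> fg_app (- strand_act s y) u \<in> strand_group j"
  using assms
proof (induction y arbitrary: u rule: strand_group.induct)
  case (sg_gen i w)
  then show ?case by (simp add: minus_add sg_braid_aut del: add_uminus_conv_diff)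
next
  case (sg_inv i w)
  then show ?case by (simp add: minus_add sg_braid_aut del: add_uminus_conv_diff)
qed simp

text \<open>
  An element of \<^typ>\<open>nat \<Rightarrow> nat free_group\<close> below stands for the product \<open>f\<^sub>2 f\<^sub>3 f\<^sub>4 \<cdots>\<close> with
  \<open>f\<^sub>j \<in> G\<^sub>j\<close>, and \<open>conj_act j f\<close> for the automorphism \<open>x \<mapsto> c\<^sup>-\<^sup>1 x c\<close> of \<open>G\<^sub>j\<close>, where
  \<open>c = f\<^sub>2 \<cdots> f\<^bsub>j-1\<^esub>\<close>.
\<close>

definition conj_act :: "nat \<Rightarrow> (nat \<Rightarrow> nat free_group) \<Rightarrow> nat fg_aut" where
  "conj_act j f = sum_list (map (\<lambda>s. strand_act s (f s)) [0..<j])"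

lemma conj_act_0 [simp]: "conj_act 0 f = 0" by (simp add: conj_act_def)
lemma conj_act_Suc [simp]: "conj_act (Suc j) f = conj_act j f + strand_act j (f j)"
  by (simp add: conj_act_def)

lemma sg_conj_act:
  assumes "\<And>s. s < k \<Longrightarrow> f s \<in> strand_group s" "u \<in> strand_group j" "k \<le> j"
  shows "fg_app (conj_act k f) u \<in> strand_group j \<and> fg_app (- conj_act k f) u \<in> strand_group j"
  using assms
proof (induction k arbitrary: u)
  case (Suc k)
  then show ?case
    by (simp add: minus_add sg_strand_act del: add_uminus_conv_diff)
qed simp

lemma intertwine_add1:
  "a + x = b + a \<Longrightarrow> a + y = c + a \<Longrightarrow> a + (x + y) = b + c + (a :: 'g::group_add)"
  by (metis add.assoc)

lemma intertwine_add2: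
  "w + y = x + w \<Longrightarrow> b + x = z + b \<Longrightarrow> b + w + y = z + (b + w :: 'g::group_add)"
  by (metis add.assoc)

lemma intertwine_minus1:
  assumes "a + x = b + (a :: 'g::group_add)"
  shows "a + - x = - b + a"
proof -
  have "- b + (a + x) + - x = - b + (b + a) + - x" by (simp only: assms)
  then show ?thesis by (simp add: add.assoc del: add_uminus_conv_diff)
qed

lemma intertwine_minus2:
  assumes "a + x = b + (a :: 'g::group_add)"
  shows "- a + b = x + - a"
proof -
  have "- a + (a + x) + - a = - a + (b + a) + - a" by (simp only: assms)
  then show ?thesis by (simp add: add.assoc del: add_uminus_conv_diff)
qed

lemma strand_act_strand_act:
  assumes "h \<in> strand_group s" "g \<in> strand_group j" "s < j"
  shows "strand_act s h + strand_act j (fg_app (strand_act s h) g) = strand_act j g + strand_act s h"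
proof -
  have gen: "braid_aut r s + strand_act j (fg_app (braid_aut r s) g) = strand_act j g + braid_aut r s"
    if r: "1 \<le> r" "r < s" and g: "g \<in> strand_group j" for r g
  proof -
    have gen: "braid_aut r s + strand_act j (fg_app (braid_aut r s) (fgen i)) = braid_aut i j + braid_aut r s"
      if "i < j" for i
      using that braid_relation[of r s j i] r assms(3) by simp
    from g show ?thesis
    proof (induction g rule: strand_group.induct)
      case (sg_gen i w)
      show ?case
        unfolding fg_app_add strand_act_simps
        by (rule intertwine_add1[OF gen[OF sg_gen(2)] sg_gen.IH])
    next
      case (sg_inv i w)
      show ?case
        unfolding fg_app_add fg_app_minus strand_act_simps
        by (rule intertwine_add1[OF intertwine_minus1[OF gen[OF sg_inv(2)]] sg_inv.IH])
    qed simp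
  qed
  show ?thesis
    using assms(1,2)
  proof (induction h arbitrary: g rule: strand_group.induct)
    case (sg_gen i w)
    have m: "fg_app (braid_aut i s) g \<in> strand_group j"
      using sg_gen assms(3) by (simp add: sg_braid_aut)
    show ?case
      unfolding fg_app_plus_aut strand_act_simps
      by (rule intertwine_add2[OF sg_gen.IH[OF m] gen[OF sg_gen(1,2) sg_gen.prems]])
  next
    case (sg_inv i w)
    have m: "fg_app (- braid_aut i s) g \<in> strand_group j"
      using sg_inv assms(3) by (simp add: sg_braid_aut)
    have "- braid_aut i s + strand_act j (fg_app (- braid_aut i s) g) = strand_act j g + - braid_aut i s"
      using intertwine_minus2[OF gen[OF sg_inv(1,2) m]] by simp
    then show ?case
      unfolding fg_app_plus_aut strand_act_simps
      by (rule intertwine_add2[OF sg_inv.IH[OF m]])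
  qed simp
qed

lemma conj_act_intertwine:
  assumes "\<And>s. g s \<in> strand_group s" "u \<in> strand_group j" "k \<le> j"
  shows "conj_act k g + strand_act j (fg_app (conj_act k g) u) = strand_act j u + conj_act k g"
  using assms(3)
proof (induction k)
  case (Suc k)
  have m: "fg_app (conj_act k g) u \<in> strand_group j"
    using sg_conj_act[of k g u j] assms Suc.prems by simp
  show ?case
    unfolding conj_act_Suc fg_app_plus_aut
    by (rule intertwine_add2[OF strand_act_strand_act[OF assms(1) m] Suc.IH]) (use Suc.prems in simp_all)
qed simp

lemma conj_act_mult:
  assumes "\<And>s. f s \<in> strand_group s" "\<And>s. g s \<in> strand_group s"
  shows "conj_act j (\<lambda>j. fg_app (conj_act j g) (f j) + g j) = conj_act j f + conj_act j g"
proof (induction j)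
  case (Suc j)
  have eq: "conj_act j g + strand_act j (fg_app (conj_act j g) (f j)) = strand_act j (f j) + conj_act j g"
    by (rule conj_act_intertwine) (simp_all add: assms)
  have "conj_act (Suc j) (\<lambda>j. fg_app (conj_act j g) (f j) + g j)
      = conj_act j f + (conj_act j g + strand_act j (fg_app (conj_act j g) (f j))) + strand_act j (g j)"
    by (simp only: conj_act_Suc Suc.IH strand_act_simps add.assoc)
  then show ?case
    by (simp only: eq conj_act_Suc add.assoc)
qed simp

text \<open>
  The union of the pure braid groups \<open>P\<^sub>m = G\<^sub>m \<rtimes> \<cdots> \<rtimes> G\<^sub>2\<close> along the inclusions \<open>P\<^sub>m \<subseteq> P\<^sub>m\<^sub>+\<^sub>1\<close>.
  An element is the family of its components in the groups \<open>G\<^sub>j\<close>.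
\<close>

typedef pure_braid =
  "{f :: nat \<Rightarrow> nat free_group. (\<forall>j. f j \<in> strand_group j) \<and> finite {j. f j \<noteq> 0}}"
  morphisms strand Abs_pure_braid
  by (rule exI[of _ "\<lambda>_. 0"]) (simp add: sg_zero)

setup_lifting type_definition_pure_braid

instantiation pure_braid :: group_add
begin

lift_definition zero_pure_braid :: pure_braid is "\<lambda>_. 0" by (simp add: sg_zero)

lift_definition plus_pure_braid :: "pure_braid \<Rightarrow> pure_braid \<Rightarrow> pure_braid" is
  "\<lambda>f g j. fg_app (conj_act j g) (f j) + g j"
proof -
  fix f g :: "nat \<Rightarrow> nat free_group"
  assume f: "(\<forall>j. f j \<in> strand_group j) \<and> finite {j. f j \<noteq> 0}"
     and g: "(\<forall>j. g j \<in> strand_group j) \<and> finite {j. g j \<noteq> 0}"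
  have "fg_app (conj_act j g) (f j) + g j \<in> strand_group j" for j
    using sg_conj_act[of j g "f j" j] f g by (simp add: sg_add)
  moreover have "finite {j. fg_app (conj_act j g) (f j) + g j \<noteq> 0}"
    by (rule finite_subset[of _ "{j. f j \<noteq> 0} \<union> {j. g j \<noteq> 0}"]) (use f g in auto)
  ultimately show "(\<forall>j. fg_app (conj_act j g) (f j) + g j \<in> strand_group j) \<and>
      finite {j. fg_app (conj_act j g) (f j) + g j \<noteq> 0}"
    by simp
qed

lift_definition uminus_pure_braid :: "pure_braid \<Rightarrow> pure_braid" is
  "\<lambda>f j. fg_app (- conj_act j f) (- f j)"
proof -
  fix f :: "nat \<Rightarrow> nat free_group"
  assume f: "(\<forall>j. f j \<in> strand_group j) \<and> finite {j. f j \<noteq> 0}"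
  have "fg_app (- conj_act j f) (- f j) \<in> strand_group j" for j
    using sg_conj_act[of j f "- f j" j] f by (simp add: sg_uminus)
  moreover have "finite {j. fg_app (- conj_act j f) (- f j) \<noteq> 0}"
    by (rule finite_subset[of _ "{j. f j \<noteq> 0}"]) (use f in auto)
  ultimately show "(\<forall>j. fg_app (- conj_act j f) (- f j) \<in> strand_group j) \<and>
      finite {j. fg_app (- conj_act j f) (- f j) \<noteq> 0}"
    by simp
qed

definition minus_pure_braid :: "pure_braid \<Rightarrow> pure_braid \<Rightarrow> pure_braid" where
  "minus_pure_braid x y = x + (- y)"

instance
proof
  fix a b c :: pure_braid
  show "a + b + c = a + (b + c)"
  proof transfer
    fix f g h :: "nat \<Rightarrow> nat free_group"
    assume f: "(\<forall>j. f j \<in> strand_group j) \<and> finite {j. f j \<noteq> 0}"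
       and g: "(\<forall>j. g j \<in> strand_group j) \<and> finite {j. g j \<noteq> 0}"
       and h: "(\<forall>j. h j \<in> strand_group j) \<and> finite {j. h j \<noteq> 0}"
    have "conj_act j (\<lambda>j. fg_app (conj_act j h) (g j) + h j) = conj_act j g + conj_act j h" for j
      by (rule conj_act_mult) (simp_all add: g h)
    then show "(\<lambda>j. fg_app (conj_act j h) (fg_app (conj_act j g) (f j) + g j) + h j) =
        (\<lambda>j. fg_app (conj_act j (\<lambda>j. fg_app (conj_act j h) (g j) + h j)) (f j) +
             (fg_app (conj_act j h) (g j) + h j))"
      by (simp only: fg_app_plus_aut fg_app_add add.assoc)
  qed
  show "0 + a = a" by transfer simp
  show "a + 0 = a"
  proof transfer
    fix f :: "nat \<Rightarrow> nat free_group"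
    have "conj_act j (\<lambda>_. 0) = 0" for j by (induction j) simp_all
    then show "(\<lambda>j. fg_app (conj_act j (\<lambda>_. 0)) (f j) + 0) = f" by simp
  qed
  show "- a + a = 0"
    by transfer (simp only: fg_app_uminus_right left_minus)
  show "a + - b = a - b" by (simp add: minus_pure_braid_def)
qed

end

text \<open>The generator \<open>\<gamma>\<^sub>i\<^sub>j\<close>; trivial unless \<open>1 \<le> i < j\<close>.\<close>

lift_definition pgen :: "nat \<Rightarrow> nat \<Rightarrow> pure_braid" is
  "\<lambda>i j k. if k = j \<and> 1 \<le> i \<and> i < j then fgen i else 0"
proof -
  fix i j :: nat
  have "finite {k. (if k = j \<and> 1 \<le> i \<and> i < j then fgen i else 0) \<noteq> 0}"
    by (rule finite_subset[of _ "{j}"]) auto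
  then show "(\<forall>k. (if k = j \<and> 1 \<le> i \<and> i < j then fgen i else 0) \<in> strand_group k) \<and>
      finite {k. (if k = j \<and> 1 \<le> i \<and> i < j then fgen i else 0) \<noteq> 0}"
    by (auto simp: sg_zero sg_fgen)
qed

text \<open>The inclusion of \<open>G\<^sub>j\<close>.\<close>

definition strand_incl :: "nat \<Rightarrow> nat free_group \<Rightarrow> pure_braid" where
  "strand_incl j = flift (\<lambda>i. pgen i j)"

text \<open>Forgetting all strands after the \<open>m\<close>-th.\<close>

lift_definition forget :: "nat \<Rightarrow> pure_braid \<Rightarrow> pure_braid" is
  "\<lambda>m f j. if j \<le> m then f j else 0"
proof -
  fix m and f :: "nat \<Rightarrow> nat free_group"
  assume f: "(\<forall>j. f j \<in> strand_group j) \<and> finite {j. f j \<noteq> 0}"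
  then have "finite {j. (if j \<le> m then f j else 0) \<noteq> 0}"
    by (auto elim: rev_finite_subset)
  then show "(\<forall>j. (if j \<le> m then f j else 0) \<in> strand_group j) \<and>
      finite {j. (if j \<le> m then f j else 0) \<noteq> 0}"
    using f by (simp add: sg_zero)
qed

definition pure_braid_group :: "nat \<Rightarrow> pure_braid set" where
  "pure_braid_group m = range (forget m)"

text \<open>\<open>P\<^sub>n\<^sub>,\<^sub>\<ell> = ker (P\<^sub>n \<rightarrow> P\<^sub>\<ell>)\<close>\<close>

definition P_ker :: "nat \<Rightarrow> nat \<Rightarrow> pure_braid set" where
  "P_ker l n = {g \<in> pure_braid_group n. forget l g = 0}"

lemma strand_add: "strand (g + h) j = fg_app (conj_act j (strand h)) (strand g j) + strand h j"
  by transfer simp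

lemma strand_uminus: "strand (- g) j = fg_app (- conj_act j (strand g)) (- strand g j)"
  by transfer (rule refl)

lemma strand_zero [simp]: "strand 0 j = 0" by transfer simp

lemma strand_pgen: "strand (pgen i j) k = (if k = j \<and> 1 \<le> i \<and> i < j then fgen i else 0)"
  by transfer simp

lemma strand_in_strand_group: "strand g j \<in> strand_group j"
  by transfer simp

lemma pure_braid_eqI: "(\<And>j. strand g j = strand h j) \<Longrightarrow> g = h"
  by (simp add: strand_inject[symmetric] fun_eq_iff)

lemma conj_act_cong: "(\<And>s. s < j \<Longrightarrow> f s = g s) \<Longrightarrow> conj_act j f = conj_act j g"
  by (induction j) simp_all

lemma conj_act_trivial: "(\<And>s. s < j \<Longrightarrow> f s = 0) \<Longrightarrow> conj_act j f = 0"
  by (induction j) simp_all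

lemma strand_forget: "strand (forget m g) j = (if j \<le> m then strand g j else 0)"
  by transfer simp

lemma forget_add [simp]: "forget m (g + h) = forget m g + forget m h"
proof (rule pure_braid_eqI)
  fix j
  have "j \<le> m \<Longrightarrow> conj_act j (strand (forget m h)) = conj_act j (strand h)"
    by (rule conj_act_cong) (simp add: strand_forget)
  then show "strand (forget m (g + h)) j = strand (forget m g + forget m h) j"
    by (simp add: strand_forget strand_add)
qed

lemma mem_P_ker_iff: "g \<in> P_ker l n \<longleftrightarrow> (\<forall>j. strand g j \<noteq> 0 \<longrightarrow> l < j \<and> j \<le> n)"
proof
  assume "g \<in> P_ker l n"
  then obtain h where "g = forget n h" and l: "forget l g = 0"
    by (auto simp: P_ker_def pure_braid_group_def)
  moreover have "strand g j = 0" if "j \<le> l" for j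
    using that strand_forget[of l g j] l by simp
  ultimately show "\<forall>j. strand g j \<noteq> 0 \<longrightarrow> l < j \<and> j \<le> n"
    by (metis strand_forget not_le)
next
  assume g: "\<forall>j. strand g j \<noteq> 0 \<longrightarrow> l < j \<and> j \<le> n"
  have "g = forget n g" "forget l g = 0"
    by (rule pure_braid_eqI; use g in \<open>force simp: strand_forget\<close>)+
  then show "g \<in> P_ker l n"
    unfolding P_ker_def pure_braid_group_def by blast
qed

lemma P_ker_add:
  assumes "g \<in> P_ker l n" "h \<in> P_ker l n"
  shows "g + h \<in> P_ker l n"
proof -
  have "strand (g + h) j = 0" if "\<not> (l < j \<and> j \<le> n)" for j
    using that assms unfolding mem_P_ker_iff by (metis strand_add fg_app_zero add_0_right)
  then show ?thesis unfolding mem_P_ker_iff by blast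
qed

lemma strand_strand_incl:
  assumes "u \<in> strand_group j"
  shows "strand (strand_incl j u) k = (if k = j then u else 0)"
  using assms
proof (induction u arbitrary: k rule: strand_group.induct)
  case sg_zero
  then show ?case by (simp add: strand_incl_def)
next
  case (sg_gen i w)
  have "k \<le> j \<Longrightarrow> conj_act k (strand (flift (\<lambda>i. pgen i j) w)) = 0"
    by (rule conj_act_trivial) (use sg_gen.IH in \<open>simp add: strand_incl_def\<close>)
  then show ?case
    using sg_gen by (auto simp: strand_incl_def strand_add strand_pgen)
next
  case (sg_inv i w)
  have u: "strand (- pgen i j) k = (if k = j then - fgen i else 0)" for k
  proof -
    have "k \<le> j \<Longrightarrow> conj_act k (strand (pgen i j)) = 0"
      by (rule conj_act_trivial) (simp add: strand_pgen)
    then show ?thesis using sg_inv(1,2)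
      by (cases "k = j") (simp_all add: strand_uminus strand_pgen)
  qed
  have "k \<le> j \<Longrightarrow> conj_act k (strand (flift (\<lambda>i. pgen i j) w)) = 0"
    by (rule conj_act_trivial) (use sg_inv.IH in \<open>simp add: strand_incl_def\<close>)
  then show ?case
    using sg_inv by (auto simp: strand_incl_def strand_add u)
qed

lemma pgen_conjugate:
  assumes "1 \<le> r" "r < s" "s < j" "1 \<le> i" "i < j"
  shows "- pgen r s + pgen i j + pgen r s =
    strand_incl j (braid_conj r s i + fgen i + - braid_conj r s i)"
proof -
  let ?w = "braid_conj r s i + fgen i + - braid_conj r s i"
  have w: "?w \<in> strand_group j"
    using sg_braid_aut(1)[of "fgen i" j r s] assms by (simp add: sg_fgen braid_aut_fgen)
  have "pgen i j + pgen r s = pgen r s + strand_incl j ?w"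
  proof (rule pure_braid_eqI)
    fix k
    have 1: "conj_act j (strand (pgen r s)) = braid_aut r s"
    proof -
      have "conj_act m (strand (pgen r s)) = (if s < m then braid_aut r s else 0)" for m
        using assms by (induction m) (auto simp: strand_pgen less_Suc_eq)
      then show ?thesis using assms by simp
    qed
    have 2: "conj_act s (strand (strand_incl j ?w)) = 0"
      by (rule conj_act_trivial) (use assms in \<open>simp only: strand_strand_incl[OF w], simp\<close>)
    show "strand (pgen i j + pgen r s) k = strand (pgen r s + strand_incl j ?w) k"
      using assms
      by (cases "k = j"; cases "k = s")
        (simp_all only: strand_add 1 2 strand_pgen strand_strand_incl[OF w], simp_all add: braid_aut_fgen)
  qed
  then show ?thesis by (simp add: add.assoc)
qed

section \<open>Group ring, evaluation and Fox calculus\<close>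

text \<open>The index set of the generators \<open>\<gamma>\<^sub>i\<^sub>j\<close> of \<open>P\<^sub>n\<^sub>,\<^sub>\<ell>\<close>, of the \<open>e\<^sub>i\<^sub>j\<close>, and of \<open>t, \<lambda> \<in> \<complex>\<^sup>N\<close>.\<close>

definition index_set :: "nat \<Rightarrow> nat \<Rightarrow> (nat \<times> nat) set" where
  "index_set l n = {(i, j). l < j \<and> j \<le> n \<and> 1 \<le> i \<and> i < j}"

lemma finite_index_set: "finite (index_set l n)"
  by (rule finite_subset[of _ "{..n} \<times> {..n}"]) (auto simp: index_set_def)

text \<open>
  The character \<open>\<nu>\<^sub>t\<close>.  Points of \<open>(\<complex>\<^sup>*)\<^sup>N\<close> and \<open>\<complex>\<^sup>N\<close> are functions \<open>nat \<times> nat \<Rightarrow> complex\<close>, whose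
  values outside \<^const>\<open>index_set\<close> are never used.
\<close>

definition nu :: "nat \<Rightarrow> nat \<Rightarrow> (nat \<times> nat \<Rightarrow> complex) \<Rightarrow> pure_braid \<Rightarrow> complex" where
  "nu l n t g = (\<Prod>(i, j)\<in>index_set l n. t (i, j) powi exp_sum i (strand g j))"

lemma exp_sum_simps [simp]:
  "exp_sum i 0 = 0" "exp_sum i (u + v) = exp_sum i u + exp_sum i v"
  "exp_sum i (- u) = - exp_sum i u" "exp_sum i (fgen k) = (if k = i then 1 else 0)"
  by (simp_all add: exp_sum_def)

lemma exp_sum_braid_aut: "exp_sum i (fg_app (braid_aut r s) u) = exp_sum i u"
proof -
  have "exp_sum i (fg_app (braid_aut r s) (fgen k)) = exp_sum i (fgen k)" for k
    by (simp only: braid_aut_fgen exp_sum_simps(2,3))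
  then show ?thesis
    by (induction u rule: free_group_induct) simp_all
qed

lemma exp_sum_strand_act: "exp_sum i (fg_app (strand_act s y) u) = exp_sum i u"
proof (induction y arbitrary: u rule: free_group_induct)
  case (inv x w)
  have "exp_sum i (fg_app (- braid_aut x s) u) = exp_sum i u"
    by (metis exp_sum_braid_aut fg_app_uminus_right)
  then show ?case by (simp add: inv)
qed (simp_all add: exp_sum_braid_aut)

lemma exp_sum_conj_act: "exp_sum i (fg_app (conj_act j f) u) = exp_sum i u"
  by (induction j arbitrary: u) (simp_all add: exp_sum_strand_act)

lemma nu_add:
  assumes "\<And>p. p \<in> index_set l n \<Longrightarrow> t p \<noteq> 0"
  shows "nu l n t (g + h) = nu l n t g * nu l n t h"
  unfolding nu_def prod.distrib[symmetric]
  by (rule prod.cong)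
    (use assms in \<open>auto simp: strand_add exp_sum_conj_act power_int_add\<close>)

lemma nu_pgen: "(i, j) \<in> index_set l n \<Longrightarrow> nu l n t (pgen i j) = t (i, j)"
proof -
  assume ij: "(i, j) \<in> index_set l n"
  have "nu l n t (pgen i j) = (\<Prod>p\<in>index_set l n. if p = (i, j) then t p else 1)"
    unfolding nu_def
    by (rule prod.cong) (use ij in \<open>auto simp: strand_pgen index_set_def split: if_splits\<close>)
  then show ?thesis using ij by (simp add: finite_index_set)
qed

text \<open>The value \<open>x(t)\<close> of an element \<open>x\<close> of the group ring.\<close>

definition ring_eval :: "nat \<Rightarrow> nat \<Rightarrow> (nat \<times> nat \<Rightarrow> complex) \<Rightarrow> (pure_braid \<Rightarrow>\<^sub>0 int) \<Rightarrow> complex" where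
  "ring_eval l n t x = (\<Sum>g\<in>Poly_Mapping.keys x. of_int (Poly_Mapping.lookup x g) * nu l n t g)"

text \<open>
  \<open>fox_jacobian j \<gamma> i k\<close> is the \<open>(i, k)\<close> entry of \<open>\<J>(\<gamma>)\<close> for \<open>\<gamma> \<in> P\<^bsub>j-1\<^esub>\<close>.  As
  \<open>\<gamma>\<^sup>-\<^sup>1 \<gamma>\<^sub>i\<^sub>j \<gamma> \<in> G\<^sub>j\<close>, its component in \<open>G\<^sub>j\<close> is the element itself.
\<close>

definition fox_jacobian :: "nat \<Rightarrow> pure_braid \<Rightarrow> nat \<Rightarrow> nat \<Rightarrow> (pure_braid \<Rightarrow>\<^sub>0 int)" where
  "fox_jacobian j g i k =
     frag_extend (\<lambda>w. frag_of (strand_incl j w)) (fox k (strand (- g + pgen i j + g) j))"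

text \<open>
  \<open>\<rho>\<^sub>j\<close> on \<open>P\<^bsub>j-1\<^esub>\<close> is \<open>\<gamma> \<sqdot> \<J>(\<gamma>)\<close>; since it is the identity on \<open>\<gamma>\<^sub>p\<^sub>q\<close> with \<open>q \<ge> j\<close>, in general it
  factors through \<^term>\<open>forget (j - 1)\<close>.  Rows and columns are indexed by \<open>1, \<dots>, j - 1\<close>.
\<close>

definition rho :: "nat \<Rightarrow> pure_braid \<Rightarrow> nat \<Rightarrow> nat \<Rightarrow> (pure_braid \<Rightarrow>\<^sub>0 int)" where
  "rho j g i k = frag_of (forget (j - 1) g) * fox_jacobian j (forget (j - 1) g) i k"

definition rho_ext :: "nat \<Rightarrow> (pure_braid \<Rightarrow>\<^sub>0 int) \<Rightarrow> nat \<Rightarrow> nat \<Rightarrow> (pure_braid \<Rightarrow>\<^sub>0 int)" where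
  "rho_ext j x i k = frag_extend (\<lambda>g. rho j g i k) x"

section \<open>The resolution\<close>

text \<open>
  A subset \<open>J\<close> is the increasing list of its elements, and \<open>e\<^sub>I\<^sub>,\<^sub>J\<close> is indexed by the pair of lists
  \<open>(I, J)\<close>.  Matrices are indexed by the lists \<open>I\<close> themselves.  In the lexicographic order
  the last entry of \<open>I\<close> varies fastest, so that replacing each entry by a block appends an
  entry to the row and column indices, whereas in \<open>[F]\<^sup>d\<close> the number of the copy is
  a prefix common to the row and column indices.
\<close>

definition basis :: "nat \<Rightarrow> nat \<Rightarrow> nat \<Rightarrow> (nat list \<times> nat list) set" where
  "basis l n q = {(I, J). length J = q \<and> sorted_wrt (<) J \<and> set J \<subseteq> {l + 1..n} \<and>
     length I = q \<and> (\<forall>p<q. 1 \<le> I ! p \<and> I ! p < J ! p)}"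

text \<open>The matrix of \<open>\<Delta>\<^sub>J\<close>; its columns are indexed by the \<open>I'\<close> that belong to \<^term>\<open>tl J\<close>.\<close>

function Delta :: "nat list \<Rightarrow> nat list \<Rightarrow> nat list \<Rightarrow> (pure_braid \<Rightarrow>\<^sub>0 int)" where
  "Delta J I I' =
     (if length J \<le> 1 then frag_of (pgen (hd I) (hd J)) - 1
      else - rho_ext (last J) (Delta (butlast J) (butlast I) (butlast I')) (last I) (last I'))"
  by auto
termination by (relation "measure (\<lambda>(J, _, _). length J)") auto

declare Delta.simps [simp del]

text \<open>
  The coefficient of \<open>e\<^bsub>I',J'\<^esub>\<close> in \<open>\<partial>\<^sub>q(e\<^sub>I\<^sub>,\<^sub>J)\<close>.  The summand for \<open>p\<close> is the
  component \<open>[\<Delta>\<^bsub>J\<^sup>p\<^esub>]\<^bsup>d\<^esup>\<close> with \<open>d = d\<^sub>p\<close>, which maps into \<open>C\<^bsub>q-1\<^esub>\<close> of \<open>J\<close> without its element \<open>J ! p\<close>.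
\<close>

definition boundary_coeff :: "nat list \<times> nat list \<Rightarrow> nat list \<times> nat list \<Rightarrow> (pure_braid \<Rightarrow>\<^sub>0 int)" where
  "boundary_coeff = (\<lambda>(I, J) (I', J').
     \<Sum>p<length J. if J' = take p J @ drop (Suc p) J \<and> take p I' = take p I
       then Delta (drop p J) (drop p I) (drop p I') else 0)"

lemma keys_frag_mult:
  "Poly_Mapping.keys x \<subseteq> P_ker l n \<Longrightarrow> Poly_Mapping.keys y \<subseteq> P_ker l n \<Longrightarrow>
   Poly_Mapping.keys (x * y) \<subseteq> P_ker l n"
  using keys_mult[of x y] P_ker_add by blast

lemma pgen_P_ker: "l < j \<Longrightarrow> j \<le> n \<Longrightarrow> pgen i j \<in> P_ker l n"
  by (auto simp: mem_P_ker_iff strand_pgen)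

lemma zero_P_ker: "0 \<in> P_ker l n"
  by (simp add: mem_P_ker_iff)

lemma uminus_P_ker: "g \<in> P_ker l n \<Longrightarrow> - g \<in> P_ker l n"
  unfolding mem_P_ker_iff strand_uminus by (metis fg_app_zero minus_zero)

lemma flift_P_ker: "(\<And>i. f i \<in> P_ker l n) \<Longrightarrow> flift f w \<in> P_ker l n"
  by (induction w rule: free_group_induct) (simp_all add: zero_P_ker P_ker_add uminus_P_ker del: add_uminus_conv_diff)

lemma keys_rho:
  assumes "g \<in> P_ker l n" "l < j" "j \<le> n"
  shows "Poly_Mapping.keys (rho j g i k) \<subseteq> P_ker l n"
proof -
  have "strand_incl j w \<in> P_ker l n" for w
    unfolding strand_incl_def by (rule flift_P_ker) (simp add: pgen_P_ker assms)
  then have "Poly_Mapping.keys (fox_jacobian j h i k) \<subseteq> P_ker l n" for h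
    unfolding fox_jacobian_def
    by (intro order_trans[OF keys_frag_extend] UN_least) simp
  moreover have "forget (j - 1) g \<in> P_ker l n"
    using assms(1) unfolding mem_P_ker_iff strand_forget by presburger
  ultimately show ?thesis
    unfolding rho_def by (intro keys_frag_mult) simp_all
qed

text \<open>The matrices of the resolution have their entries in the group ring of \<open>P\<^sub>n\<^sub>,\<^sub>\<ell>\<close>.\<close>

lemma keys_Delta:
  assumes "J \<noteq> []" "set J \<subseteq> {l + 1..n}"
  shows "Poly_Mapping.keys (Delta J I I') \<subseteq> P_ker l n"
  using assms
proof (induction "length J" arbitrary: J I I')
  case (Suc m)
  show ?case
  proof (cases "length J \<le> 1")
    case True
    have "hd J \<in> {l + 1..n}" using Suc.prems hd_in_set by blast
    then have "Poly_Mapping.keys (frag_of (pgen (hd I) (hd J)) - 1) \<subseteq> P_ker l n"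
      using keys_diff[of "frag_of (pgen (hd I) (hd J))" 1]
      using zero_P_ker pgen_P_ker[of l "hd J" n "hd I"] by auto
    then show ?thesis using True by (simp add: Delta.simps[of J I I'])
  next
    case False
    have l: "last J \<in> {l + 1..n}" using Suc.prems last_in_set by blast
    have b: "set (butlast J) \<subseteq> {l + 1..n}" "butlast J \<noteq> []"
      using Suc.prems False in_set_butlastD[of _ J] by (auto simp flip: length_0_conv)
    have "Poly_Mapping.keys (Delta (butlast J) (butlast I) (butlast I')) \<subseteq> P_ker l n"
      by (rule Suc.hyps(1)) (use b Suc.hyps(2) in auto)
    then have "Poly_Mapping.keys (rho_ext (last J) (Delta (butlast J) (butlast I) (butlast I')) i k)
        \<subseteq> P_ker l n" for i k
      unfolding rho_ext_def
      by (intro order_trans[OF keys_frag_extend] UN_least keys_rho) (use l in auto)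
    then show ?thesis using False by (simp add: Delta.simps[of J I I'])
  qed
qed simp

section \<open>The cochain complex\<close>

type_synonym chain = "nat list \<times> nat list \<Rightarrow> complex"

definition chain_space :: "nat \<Rightarrow> nat \<Rightarrow> nat \<Rightarrow> chain set" where
  "chain_space l n q = {x. \<forall>b. b \<notin> basis l n q \<longrightarrow> x b = 0}"

text \<open>\<open>boundary l n q t\<close> is \<open>\<partial>\<^sub>q(t) : C\<^sub>q \<rightarrow> C\<^bsub>q-1\<^esub>\<close>; it is meaningful for \<open>q \<ge> 1\<close> only.\<close>

definition boundary :: "nat \<Rightarrow> nat \<Rightarrow> nat \<Rightarrow> (nat \<times> nat \<Rightarrow> complex) \<Rightarrow> chain \<Rightarrow> chain" where
  "boundary l n q t x = (\<lambda>b'. if b' \<in> basis l n (q - 1)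
     then \<Sum>b\<in>basis l n q. x b * ring_eval l n t (boundary_coeff b b') else 0)"

text \<open>Linear functionals on \<^const>\<open>chain_space\<close>, made total by the value \<open>0\<close>.\<close>

definition cochain_space :: "nat \<Rightarrow> nat \<Rightarrow> nat \<Rightarrow> (chain \<Rightarrow> complex) set" where
  "cochain_space l n q = {u.
     (\<forall>x\<in>chain_space l n q. \<forall>y\<in>chain_space l n q. u (\<lambda>b. x b + y b) = u x + u y) \<and>
     (\<forall>c. \<forall>x\<in>chain_space l n q. u (\<lambda>b. c * x b) = c * u x) \<and>
     (\<forall>x. x \<notin> chain_space l n q \<longrightarrow> u x = 0)}"

definition dual_basis :: "nat \<Rightarrow> nat \<Rightarrow> nat \<Rightarrow> nat list \<times> nat list \<Rightarrow> (chain \<Rightarrow> complex)" where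
  "dual_basis l n q b = (\<lambda>x. if x \<in> chain_space l n q then x b else 0)"

definition coboundary :: "nat \<Rightarrow> nat \<Rightarrow> nat \<Rightarrow> (nat \<times> nat \<Rightarrow> complex) \<Rightarrow> (chain \<Rightarrow> complex) \<Rightarrow> (chain \<Rightarrow> complex)" where
  "coboundary l n q t u =
     (\<lambda>x. if x \<in> chain_space l n (Suc q) then (-1) ^ q * u (boundary l n (Suc q) t x) else 0)"

text \<open>
  The derivative of \<open>\<delta>\<^sup>q\<close> at \<open>\<one>\<close> in direction \<open>\<lambda>\<close>; as all spaces are finite-dimensional,
  it can be taken pointwise.
\<close>

definition coboundary_deriv :: "nat \<Rightarrow> nat \<Rightarrow> nat \<Rightarrow> (nat \<times> nat \<Rightarrow> complex) \<Rightarrow> (chain \<Rightarrow> complex) \<Rightarrow> (chain \<Rightarrow> complex)" where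
  "coboundary_deriv l n q lam u =
     (\<lambda>x. deriv (\<lambda>s. coboundary l n q (\<lambda>p. exp (s * lam p)) u x) 0)"

text \<open>The functions differentiated above are holomorphic, hence the total function \<^const>\<open>deriv\<close> has its proper meaning.\<close>

lemma finite_basis: "finite (basis l n q)"
proof (rule finite_subset)
  let ?L = "{xs. set xs \<subseteq> {..n} \<and> length xs = q}"
  show "basis l n q \<subseteq> ?L \<times> ?L"
  proof
    fix b assume "b \<in> basis l n q"
    then obtain I J where b: "b = (I, J)" and J: "length J = q" "set J \<subseteq> {l + 1..n}"
      and I: "length I = q" "\<And>p. p < q \<Longrightarrow> I ! p < J ! p"
      by (auto simp: basis_def)
    have "I ! p \<le> n" if "p < q" for p
    proof -
      have "J ! p \<in> set J" using that J(1) by simp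
      then have "J ! p \<le> n" using J(2) by auto
      then show ?thesis using I(2)[OF that] by linarith
    qed
    then have "set I \<subseteq> {..n}" using I(1) by (auto simp: in_set_conv_nth)
    moreover have "set J \<subseteq> {..n}" using J(2) by auto
    ultimately show "b \<in> ?L \<times> ?L" using b I(1) J(1) by simp
  qed
  show "finite (?L \<times> ?L)" using finite_lists_length_eq[of "{..n}" q] by simp
qed

lemma ring_eval_differentiable:
  "(\<lambda>s. ring_eval l n (\<lambda>p. exp (s * lam p)) x) field_differentiable (at z)"
proof -
  have d: "(\<lambda>s. exp (s * c) powi k) field_differentiable (at z)" for c :: complex and k
  proof -
    have "(\<lambda>s. exp (of_int k * (s * c))) field_differentiable (at z)"
      unfolding field_differentiable_def by (rule exI) (rule derivative_eq_intros refl)+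
    then show ?thesis by (simp add: exp_power_int)
  qed
  have "(\<lambda>s. \<Prod>p\<in>S. exp (s * f p) powi k p) field_differentiable (at z)"
    if "finite S" for S :: "(nat \<times> nat) set" and f k
    using that by (induction S rule: finite_induct) (auto intro: field_differentiable_mult d)
  from this[OF finite_index_set]
  have "(\<lambda>s. nu l n (\<lambda>p. exp (s * lam p)) g) field_differentiable (at z)" for g
    unfolding nu_def by (simp add: case_prod_unfold)
  then show ?thesis
    unfolding ring_eval_def
    by (intro field_differentiable_sum field_differentiable_mult field_differentiable_const)
qed

lemma cochain_add:
  "u \<in> cochain_space l n q \<Longrightarrow> x \<in> chain_space l n q \<Longrightarrow> y \<in> chain_space l n q \<Longrightarrow>
   u (\<lambda>b. x b + y b) = u x + u y"
  unfolding cochain_space_def by blast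

lemma cochain_scale:
  "u \<in> cochain_space l n q \<Longrightarrow> x \<in> chain_space l n q \<Longrightarrow> u (\<lambda>b. c * x b) = c * u x"
  unfolding cochain_space_def by blast

lemma cochain_sum:
  assumes u: "u \<in> cochain_space l n q" and "finite S" "\<And>b. b \<in> S \<Longrightarrow> f b \<in> chain_space l n q"
  shows "u (\<lambda>b'. \<Sum>b\<in>S. c b * f b b') = (\<Sum>b\<in>S. c b * u (f b))"
  using assms(2,3)
proof (induction S rule: finite_induct)
  case empty
  have "(\<lambda>_. 0) \<in> chain_space l n q" by (simp add: chain_space_def)
  from cochain_scale[OF u this, of 0] show ?case by simp
next
  case (insert b S)
  have 1: "(\<lambda>b'. c b * f b b') \<in> chain_space l n q"
    using insert.prems[of b] by (auto simp: chain_space_def)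
  have 2: "(\<lambda>b'. \<Sum>b\<in>S. c b * f b b') \<in> chain_space l n q"
    using insert.prems by (auto simp: chain_space_def intro!: sum.neutral)
  have "u (\<lambda>b'. \<Sum>b\<in>insert b S. c b * f b b') = u (\<lambda>b'. c b * f b b' + (\<Sum>b\<in>S. c b * f b b'))"
    using insert.hyps by simp
  also have "\<dots> = u (\<lambda>b'. c b * f b b') + u (\<lambda>b'. \<Sum>b\<in>S. c b * f b b')"
    by (rule cochain_add[OF u 1 2])
  also have "u (\<lambda>b'. c b * f b b') = c b * u (f b)"
    by (rule cochain_scale[OF u]) (use insert.prems in auto)
  also have "u (\<lambda>b'. \<Sum>b\<in>S. c b * f b b') = (\<Sum>b\<in>S. c b * u (f b))"
    by (rule insert.IH) (use insert.prems in auto)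
  finally show ?case using insert.hyps by simp
qed

lemma coboundary_differentiable:
  assumes "u \<in> cochain_space l n q"
  shows "(\<lambda>s. coboundary l n q (\<lambda>p. exp (s * lam p)) u x) field_differentiable (at z)"
proof (cases "x \<in> chain_space l n (Suc q)")
  case True
  let ?e = "\<lambda>b b'. if b' = b then 1 else 0 :: complex"
  have u: "u (boundary l n (Suc q) t x) =
      (\<Sum>b'\<in>basis l n q. (\<Sum>b\<in>basis l n (Suc q). x b * ring_eval l n t (boundary_coeff b b')) * u (?e b'))" for t
  proof -
    have "boundary l n (Suc q) t x b' = (\<Sum>b\<in>basis l n q. boundary l n (Suc q) t x b * ?e b b')" for b'
    proof -
      have "(\<Sum>b\<in>basis l n q. boundary l n (Suc q) t x b * ?e b b') =
          (\<Sum>b\<in>basis l n q. if b' = b then boundary l n (Suc q) t x b else 0)"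
        by (rule sum.cong) auto
      then show ?thesis by (simp add: finite_basis) (simp add: boundary_def)
    qed
    then have "boundary l n (Suc q) t x =
        (\<lambda>b'. \<Sum>b\<in>basis l n q. boundary l n (Suc q) t x b * ?e b b')"
      by (rule ext)
    then have "u (boundary l n (Suc q) t x) =
        u (\<lambda>b'. \<Sum>b\<in>basis l n q. boundary l n (Suc q) t x b * ?e b b')"
      by (rule arg_cong)
    also have "\<dots> = (\<Sum>b\<in>basis l n q. boundary l n (Suc q) t x b * u (?e b))"
      by (rule cochain_sum[OF assms finite_basis]) (auto simp: chain_space_def)
    finally show ?thesis by (simp add: boundary_def)
  qed
  have "(\<lambda>s. (-1) ^ q * (\<Sum>b'\<in>basis l n q. (\<Sum>b\<in>basis l n (Suc q).
      x b * ring_eval l n (\<lambda>p. exp (s * lam p)) (boundary_coeff b b')) * u (?e b')))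
      field_differentiable (at z)"
    by (intro field_differentiable_mult field_differentiable_const field_differentiable_sum
        ring_eval_differentiable)
  then show ?thesis
    unfolding coboundary_def u using True by (simp only: if_True)
qed (simp add: coboundary_def)

section \<open>Exterior algebra and Orlik-Solomon algebra\<close>

text \<open>
  The exterior algebra on a finite set of generators \<open>e\<^sub>p\<close>, in coordinates: \<open>x K\<close> is the
  coefficient of the product of the \<open>e\<^sub>p\<close>, \<open>p \<in> K\<close>, in the increasing order given by
  \<open>gen_less\<close>; the sign counts the inversions that occur in sorting.
\<close>

definition gen_less :: "nat \<times> nat \<Rightarrow> nat \<times> nat \<Rightarrow> bool" where
  "gen_less = (\<lambda>(i, j) (i', j'). j < j' \<or> j = j' \<and> i < i')"

definition shuffle_sign :: "(nat \<times> nat) set \<Rightarrow> (nat \<times> nat) set \<Rightarrow> complex" where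
  "shuffle_sign L M = (-1) ^ card {(a, b). a \<in> L \<and> b \<in> M \<and> gen_less b a}"

definition wedge :: "((nat \<times> nat) set \<Rightarrow> complex) \<Rightarrow> ((nat \<times> nat) set \<Rightarrow> complex) \<Rightarrow>
    ((nat \<times> nat) set \<Rightarrow> complex)" where
  "wedge x y K = (\<Sum>L\<in>Pow K. shuffle_sign L (K - L) * x L * y (K - L))"

definition ext_monom :: "(nat \<times> nat) set \<Rightarrow> ((nat \<times> nat) set \<Rightarrow> complex)" where
  "ext_monom K = (\<lambda>K'. if K' = K then 1 else 0)"

definition ext_gen :: "nat \<times> nat \<Rightarrow> ((nat \<times> nat) set \<Rightarrow> complex)" where
  "ext_gen p = ext_monom {p}"

definition exterior_algebra :: "(nat \<times> nat) set \<Rightarrow> ((nat \<times> nat) set \<Rightarrow> complex) ring" where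
  "exterior_algebra S =
     \<lparr>carrier = {x. \<forall>K. x K \<noteq> 0 \<longrightarrow> K \<subseteq> S}, monoid.mult = wedge, one = ext_monom {},
      ring.zero = (\<lambda>_. 0), add = (\<lambda>x y K. x K + y K)\<rparr>"

lemma finite_inversions:
  "finite L \<Longrightarrow> finite M \<Longrightarrow> finite {(a, b). a \<in> L \<and> b \<in> M \<and> gen_less b a}"
  by (rule finite_subset[of _ "L \<times> M"]) auto

lemma shuffle_sign_union_left:
  assumes "finite L" "finite M" "finite Q" "L \<inter> M = {}"
  shows "shuffle_sign (L \<union> M) Q = shuffle_sign L Q * shuffle_sign M Q"
proof -
  have eq: "{(a, b). a \<in> L \<union> M \<and> b \<in> Q \<and> gen_less b a} =
      {(a, b). a \<in> L \<and> b \<in> Q \<and> gen_less b a} \<union> {(a, b). a \<in> M \<and> b \<in> Q \<and> gen_less b a}"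
    by auto
  show ?thesis
    unfolding shuffle_sign_def eq power_add[symmetric]
    by (subst card_Un_disjoint) (use assms in \<open>auto intro: finite_inversions\<close>)
qed

lemma shuffle_sign_union_right:
  assumes "finite L" "finite M" "finite Q" "M \<inter> Q = {}"
  shows "shuffle_sign L (M \<union> Q) = shuffle_sign L M * shuffle_sign L Q"
proof -
  have eq: "{(a, b). a \<in> L \<and> b \<in> M \<union> Q \<and> gen_less b a} =
      {(a, b). a \<in> L \<and> b \<in> M \<and> gen_less b a} \<union> {(a, b). a \<in> L \<and> b \<in> Q \<and> gen_less b a}"
    by auto
  show ?thesis
    unfolding shuffle_sign_def eq power_add[symmetric]
    by (subst card_Un_disjoint) (use assms in \<open>auto intro: finite_inversions\<close>)
qed

lemma shuffle_sign_empty [simp]: "shuffle_sign {} M = 1" "shuffle_sign L {} = 1"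
  by (simp_all add: shuffle_sign_def)

lemma wedge_assoc:
  assumes "finite K"
  shows "wedge (wedge x y) z K = wedge x (wedge y z) K"
proof -
  have fin: "finite L" if "L \<subseteq> K" for L using that assms finite_subset by blast
  have "wedge (wedge x y) z K = (\<Sum>L\<in>Pow K. \<Sum>M\<in>Pow L.
      shuffle_sign L (K - L) * shuffle_sign M (L - M) * x M * y (L - M) * z (K - L))"
    unfolding wedge_def by (simp add: sum_distrib_left sum_distrib_right mult_ac)
  also have "\<dots> = (\<Sum>(L, M)\<in>Sigma (Pow K) Pow.
      shuffle_sign L (K - L) * shuffle_sign M (L - M) * x M * y (L - M) * z (K - L))"
    by (rule sum.Sigma) (use assms fin in auto)
  also have "\<dots> = (\<Sum>(M, N)\<in>Sigma (Pow K) (\<lambda>M. Pow (K - M)).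
      shuffle_sign M (K - M) * shuffle_sign N (K - M - N) * x M * y N * z (K - M - N))"
  proof (rule sum.reindex_bij_witness[where i = "\<lambda>(M, N). (M \<union> N, M)" and j = "\<lambda>(L, M). (M, L - M)"])
    fix p assume "p \<in> Sigma (Pow K) Pow"
    then obtain L M where p: "p = (L, M)" and L: "L \<subseteq> K" and M: "M \<subseteq> L" by auto
    define N Q where "N = L - M" and "Q = K - L"
    have e: "K - M = N \<union> Q" "K - M - N = Q" "L = M \<union> N" "M \<inter> N = {}" "N \<inter> Q = {}"
      using L M by (auto simp: N_def Q_def)
    have f: "finite M" "finite N" "finite Q"
      using L M fin by (auto simp: N_def Q_def assms)
    have "shuffle_sign L Q * shuffle_sign M N = shuffle_sign M (N \<union> Q) * shuffle_sign N Q"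
      unfolding e(3) by (simp add: shuffle_sign_union_left shuffle_sign_union_right f e)
    then show "(case (case p of (L, M) \<Rightarrow> (M, L - M)) of (M, N) \<Rightarrow>
          shuffle_sign M (K - M) * shuffle_sign N (K - M - N) * x M * y N * z (K - M - N)) =
        (case p of (L, M) \<Rightarrow>
          shuffle_sign L (K - L) * shuffle_sign M (L - M) * x M * y (L - M) * z (K - L))"
      unfolding p prod.case N_def[symmetric] Q_def[symmetric] e(2) unfolding e(1) by simp
  qed (auto simp: Un_Diff)
  also have "\<dots> = (\<Sum>M\<in>Pow K. \<Sum>N\<in>Pow (K - M).
      shuffle_sign M (K - M) * shuffle_sign N (K - M - N) * x M * y N * z (K - M - N))"
    by (rule sum.Sigma[symmetric]) (use assms in auto)
  also have "\<dots> = wedge x (wedge y z) K"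
    unfolding wedge_def by (simp add: sum_distrib_left mult_ac)
  finally show ?thesis .
qed

lemma wedge_one:
  assumes "finite K"
  shows "wedge (ext_monom {}) x K = x K" "wedge x (ext_monom {}) K = x K"
proof -
  have "wedge (ext_monom {}) x K = (\<Sum>L\<in>Pow K. if L = {} then x K else 0)"
    unfolding wedge_def by (rule sum.cong) (auto simp: ext_monom_def)
  then show "wedge (ext_monom {}) x K = x K" using assms by simp
  have "wedge x (ext_monom {}) K = (\<Sum>L\<in>Pow K. if L = K then x K else 0)"
    unfolding wedge_def by (rule sum.cong) (auto simp: ext_monom_def)
  then show "wedge x (ext_monom {}) K = x K" using assms by simp
qed

lemma ring_exterior_algebra:
  assumes "finite S"
  shows "Ring.ring (exterior_algebra S)"
proof -
  let ?E = "exterior_algebra S"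
  have c: "x \<in> carrier ?E \<longleftrightarrow> (\<forall>K. \<not> K \<subseteq> S \<longrightarrow> x K = 0)" for x
    by (auto simp: exterior_algebra_def)
  have w: "wedge x y \<in> carrier ?E" if "x \<in> carrier ?E" "y \<in> carrier ?E" for x y
    unfolding c
  proof (intro allI impI)
    fix K assume K: "\<not> K \<subseteq> S"
    have "x L = 0 \<or> y (K - L) = 0" if "L \<subseteq> K" for L
    proof (cases "L \<subseteq> S")
      case True
      then have "\<not> K - L \<subseteq> S" using K that by blast
      then show ?thesis using \<open>y \<in> carrier ?E\<close> c by blast
    qed (use \<open>x \<in> carrier ?E\<close> c in blast)
    then show "wedge x y K = 0"
      unfolding wedge_def by (intro sum.neutral) auto
  qed
  have eqI: "x = y" if "x \<in> carrier ?E" "y \<in> carrier ?E" "\<And>K. finite K \<Longrightarrow> x K = y K" for x y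
  proof
    fix K
    show "x K = y K"
    proof (cases "K \<subseteq> S")
      case True
      then show ?thesis using that(3) assms finite_subset by blast
    next
      case False
      then show ?thesis using that(1,2) c by metis
    qed
  qed
  have one: "ext_monom {} \<in> carrier ?E" by (simp add: c ext_monom_def)
  have p: "(\<lambda>K. x K + y K) \<in> carrier ?E" if "x \<in> carrier ?E" "y \<in> carrier ?E" for x y
    using that by (simp add: c)
  have ops: "x \<otimes>\<^bsub>?E\<^esub> y = wedge x y" "x \<oplus>\<^bsub>?E\<^esub> y = (\<lambda>K. x K + y K)" "\<one>\<^bsub>?E\<^esub> = ext_monom {}"
     "\<zero>\<^bsub>?E\<^esub> = (\<lambda>_. 0)" for x y
    by (simp_all add: exterior_algebra_def)
  have distl: "wedge (\<lambda>K. x K + y K) z = (\<lambda>K. wedge x z K + wedge y z K)"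
    and distr: "wedge z (\<lambda>K. x K + y K) = (\<lambda>K. wedge z x K + wedge z y K)" for x y z
    by (simp_all add: wedge_def fun_eq_iff sum.distrib[symmetric] algebra_simps)
  show ?thesis
  proof (rule ringI)
    show "abelian_group ?E"
    proof (rule abelian_groupI)
      fix x assume x: "x \<in> carrier ?E"
      show "\<exists>y\<in>carrier ?E. y \<oplus>\<^bsub>?E\<^esub> x = \<zero>\<^bsub>?E\<^esub>"
        by (rule bexI[of _ "\<lambda>K. - x K"]) (use x in \<open>simp_all add: ops c\<close>)
    qed (simp_all add: ops p c add_ac)
    show "monoid ?E"
    proof (rule monoidI)
      fix x y z assume "x \<in> carrier ?E" "y \<in> carrier ?E" "z \<in> carrier ?E"
      then show "x \<otimes>\<^bsub>?E\<^esub> y \<otimes>\<^bsub>?E\<^esub> z = x \<otimes>\<^bsub>?E\<^esub> (y \<otimes>\<^bsub>?E\<^esub> z)"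
        unfolding ops by (intro eqI w) (simp_all add: wedge_assoc)
    qed (auto simp: ops w one intro!: eqI wedge_one)
  qed (simp_all add: ops distl distr)
qed

lemma wedge_ext_gen:
  "wedge (ext_gen p) (ext_gen p) = (\<lambda>_. 0)"
  "wedge (ext_gen p) (ext_gen q) = (\<lambda>K. - wedge (ext_gen q) (ext_gen p) K)"
proof -
  have eq: "wedge (ext_monom {p}) (ext_monom {q}) K =
      (if p \<noteq> q \<and> K = {p, q} then if gen_less q p then -1 else 1 else 0)" for p q K
  proof (cases "p \<noteq> q \<and> K = {p, q}")
    case True
    have "{(a, b). a \<in> {p} \<and> b \<in> {q} \<and> gen_less b a} = (if gen_less q p then {(p, q)} else {})"
      by auto
    then have s: "shuffle_sign {p} {q} = (if gen_less q p then -1 else 1)"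
      by (simp add: shuffle_sign_def)
    have "wedge (ext_monom {p}) (ext_monom {q}) K =
        (\<Sum>L\<in>Pow K. if L = {p} then shuffle_sign {p} {q} else 0)"
      unfolding wedge_def by (rule sum.cong) (use True in \<open>auto simp: ext_monom_def\<close>)
    then show ?thesis using True s by simp
  next
    case False
    then have "wedge (ext_monom {p}) (ext_monom {q}) K = 0"
      unfolding wedge_def by (intro sum.neutral) (auto simp: ext_monom_def)
    then show ?thesis using False by auto
  qed
  show "wedge (ext_gen p) (ext_gen p) = (\<lambda>_. 0)"
    by (simp add: ext_gen_def eq fun_eq_iff)
  show "wedge (ext_gen p) (ext_gen q) = (\<lambda>K. - wedge (ext_gen q) (ext_gen p) K)"
    by (auto simp: ext_gen_def eq fun_eq_iff gen_less_def insert_commute)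
qed

definition os_relations :: "nat \<Rightarrow> nat \<Rightarrow> ((nat \<times> nat) set \<Rightarrow> complex) set" where
  "os_relations l n =
     {\<lambda>K. wedge (ext_gen (i, j)) (ext_gen (i, k)) K - wedge (ext_gen (i, j)) (ext_gen (j, k)) K
          + wedge (ext_gen (i, k)) (ext_gen (j, k)) K |
       i j k. 1 \<le> i \<and> i < j \<and> j < k \<and> k \<le> n \<and> l + 1 \<le> j} \<union>
     {wedge (ext_gen (i, k)) (ext_gen (j, k)) | i j k. 1 \<le> i \<and> i < j \<and> j \<le> l \<and> l < k \<and> k \<le> n}"

definition os_ideal :: "nat \<Rightarrow> nat \<Rightarrow> ((nat \<times> nat) set \<Rightarrow> complex) set" where
  "os_ideal l n = genideal (exterior_algebra (index_set l n)) (os_relations l n)"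

definition os_algebra :: "nat \<Rightarrow> nat \<Rightarrow> ((nat \<times> nat) set \<Rightarrow> complex) set ring" where
  "os_algebra l n = exterior_algebra (index_set l n) Quot os_ideal l n"

definition os_class :: "nat \<Rightarrow> nat \<Rightarrow> ((nat \<times> nat) set \<Rightarrow> complex) \<Rightarrow> ((nat \<times> nat) set \<Rightarrow> complex) set" where
  "os_class l n x = os_ideal l n +>\<^bsub>exterior_algebra (index_set l n)\<^esub> x"

text \<open>Scalars act through their images in the ring.\<close>

definition os_scale :: "nat \<Rightarrow> nat \<Rightarrow> complex \<Rightarrow> ((nat \<times> nat) set \<Rightarrow> complex) set \<Rightarrow>
    ((nat \<times> nat) set \<Rightarrow> complex) set" where
  "os_scale l n c x = os_class l n (\<lambda>K. c * ext_monom {} K) \<otimes>\<^bsub>os_algebra l n\<^esub> x"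

text \<open>\<open>A\<^sup>q\<close> is the image of the part of degree \<open>q\<close> of the exterior algebra.\<close>

definition os_graded :: "nat \<Rightarrow> nat \<Rightarrow> nat \<Rightarrow> ((nat \<times> nat) set \<Rightarrow> complex) set set" where
  "os_graded l n q = os_class l n `
     {x \<in> carrier (exterior_algebra (index_set l n)). \<forall>K. x K \<noteq> 0 \<longrightarrow> card K = q}"

definition os_gen :: "nat \<Rightarrow> nat \<Rightarrow> nat \<times> nat \<Rightarrow> ((nat \<times> nat) set \<Rightarrow> complex) set" where
  "os_gen l n p = os_class l n (ext_gen p)"

definition os_monom :: "nat \<Rightarrow> nat \<Rightarrow> nat list \<times> nat list \<Rightarrow> ((nat \<times> nat) set \<Rightarrow> complex) set" where
  "os_monom l n = (\<lambda>(I, J).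
     foldr (\<lambda>p x. os_gen l n p \<otimes>\<^bsub>os_algebra l n\<^esub> x) (zip I J) \<one>\<^bsub>os_algebra l n\<^esub>)"

definition os_omega :: "nat \<Rightarrow> nat \<Rightarrow> (nat \<times> nat \<Rightarrow> complex) \<Rightarrow> ((nat \<times> nat) set \<Rightarrow> complex) set" where
  "os_omega l n lam =
     (\<Oplus>\<^bsub>os_algebra l n\<^esub>p\<in>index_set l n. os_scale l n (lam p) (os_gen l n p))"

definition os_mu :: "nat \<Rightarrow> nat \<Rightarrow> (nat \<times> nat \<Rightarrow> complex) \<Rightarrow> ((nat \<times> nat) set \<Rightarrow> complex) set \<Rightarrow>
    ((nat \<times> nat) set \<Rightarrow> complex) set" where
  "os_mu l n lam x = os_omega l n lam \<otimes>\<^bsub>os_algebra l n\<^esub> x"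

lemma ring_os_algebra: "Ring.ring (os_algebra l n)"
proof -
  let ?E = "exterior_algebra (index_set l n)"
  interpret E: ring ?E by (rule ring_exterior_algebra[OF finite_index_set])
  have g: "ext_gen p \<in> carrier ?E" if "p \<in> index_set l n" for p
    using that by (auto simp: exterior_algebra_def ext_gen_def ext_monom_def)
  have w: "wedge x y \<in> carrier ?E" if "x \<in> carrier ?E" "y \<in> carrier ?E" for x y
    using E.m_closed[OF that] by (simp add: exterior_algebra_def)
  have lin: "(\<lambda>K. x K - y K + z K) \<in> carrier ?E"
    if "x \<in> carrier ?E" "y \<in> carrier ?E" "z \<in> carrier ?E" for x y z
  proof -
    have "x K - y K + z K = 0" if K: "\<not> K \<subseteq> index_set l n" for K
      using K \<open>x \<in> carrier ?E\<close> \<open>y \<in> carrier ?E\<close> \<open>z \<in> carrier ?E\<close>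
      unfolding exterior_algebra_def partial_object.simps mem_Collect_eq by (metis add_0 diff_zero)
    then show ?thesis unfolding exterior_algebra_def partial_object.simps mem_Collect_eq by blast
  qed
  have "os_relations l n \<subseteq> carrier ?E"
  proof
    fix x assume "x \<in> os_relations l n"
    then show "x \<in> carrier ?E"
      unfolding os_relations_def by (auto intro!: lin w g) (simp_all add: index_set_def)
  qed
  then have "ideal (os_ideal l n) ?E"
    unfolding os_ideal_def by (rule E.genideal_ideal)
  then show ?thesis unfolding os_algebra_def by (rule ideal.quotient_is_ring)
qed

section \<open>Linear maps\<close>

definition cochain_linear :: "nat \<Rightarrow> nat \<Rightarrow> nat \<Rightarrow> nat \<Rightarrow> ((chain \<Rightarrow> complex) \<Rightarrow> (chain \<Rightarrow> complex)) \<Rightarrow> bool" where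
  "cochain_linear l n q q' F \<longleftrightarrow>
     (\<forall>u\<in>cochain_space l n q. F u \<in> cochain_space l n q') \<and>
     (\<forall>u\<in>cochain_space l n q. \<forall>v\<in>cochain_space l n q. F (\<lambda>x. u x + v x) = (\<lambda>x. F u x + F v x)) \<and>
     (\<forall>c. \<forall>u\<in>cochain_space l n q. F (\<lambda>x. c * u x) = (\<lambda>x. c * F u x))"

definition os_cochain_iso :: "nat \<Rightarrow> nat \<Rightarrow> nat \<Rightarrow> (((nat \<times> nat) set \<Rightarrow> complex) set \<Rightarrow> (chain \<Rightarrow> complex)) \<Rightarrow> bool" where
  "os_cochain_iso l n q \<Phi> \<longleftrightarrow>
     bij_betw \<Phi> (os_graded l n q) (cochain_space l n q) \<and>
     (\<forall>a\<in>os_graded l n q. \<forall>b\<in>os_graded l n q.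
        \<Phi> (a \<oplus>\<^bsub>os_algebra l n\<^esub> b) = (\<lambda>x. \<Phi> a x + \<Phi> b x)) \<and>
     (\<forall>c. \<forall>a\<in>os_graded l n q. \<Phi> (os_scale l n c a) = (\<lambda>x. c * \<Phi> a x))"

end

(*
  The Orlik-Solomon algebra A is given an explicit model on functions of words (i_q, j_q), ..., (i_1, j_1)
  with j_q > ... > j_1, i.e. on the span of the symbols a_{I,J}.  For s < m the generator e_{r,s} acts on
  b a_{k,m} through its action on b, while e_{i,m} sends b to (-1)^|b| b a_{i,m} and b a_{k,m} to
  (e_{i,k} b) (a_{k,m} - a_{i,m}).  Writing the relations symmetrically, as
  e_{x,y} e_{y,z} + e_{y,z} e_{z,x} + e_{z,x} e_{x,y} = 0, one checks by induction on words that this is an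
  action of the exterior algebra that kills the Orlik-Solomon ideal.  Acting on the empty word gives the
  linear independence of the a_{I,J}; that they span follows by rewriting a_{h,m} a_{k,m}.

  On the group side, the Jacobian of Fox derivatives of conjugation by g is unipotent modulo the
  augmentation ideal, so its derivative at 1 is additive in g and is determined by the generators.
  Hence differentiating an entry of rho_m(x) in the direction lambda amounts to differentiating x in a
  modified direction lambda', and the resulting recursion for the boundary maps is the recursion satisfied
  by left multiplication with omega_lambda in the model.
*)

theory Submission
  imports Defs
begin

section \<open>Operators on words\<close>

text \<open>The model works with coefficient functions on words, so every operator is the transpose
  of a rewriting rule: an output word is fixed and the input words that feed it are read. Both sides
  of the comparison peel off the same letter. \<open>Delta\<close> recurses on the last element of
  \<open>J\<close>, and a word carries its largest second index at its head, so each step of either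
  recursion removes a pair \<open>(k, m)\<close> with \<open>m\<close> maximal. The obstacle is that
  two generators \<open>e_{a,m}\<close>, \<open>e_{b,m}\<close> with the same top index anticommute
  on a word only through the cyclic relation on shorter words, while the cyclic relation in turn
  uses anticommutation. Both go through one induction. The recursions match because of one
  coefficient: for the output letter \<open>k\<close>, the pair of \<open>k\<close> and
  \<open>x\<close> contributes \<open>lam (x, m)\<close> to the input letter \<open>k\<close> and
  \<open>- lam (k, m)\<close> to the input letter \<open>x\<close>. This is the effect of
  \<open>e_{x,m}\<close> and \<open>e_{k,m}\<close> in the model, and it is also the derivative of
  the Fox Jacobian. That the derivatives form a complex is read off from the square of omega in the
  model.\<close>

type_synonym wfun = "(nat \<times> nat) list \<Rightarrow> complex"

definition os_word :: "nat \<Rightarrow> nat \<Rightarrow> (nat \<times> nat) list \<Rightarrow> bool" where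
  "os_word l n w \<longleftrightarrow> sorted_wrt (\<lambda>p q. snd q < snd p) w \<and> set w \<subseteq> index_set l n"

text \<open>
  Words list their letters \<open>(i, j)\<close> with the largest \<open>j\<close> first, and \<open>word_op w x y f\<close> is the
  coefficient of the word \<open>w\<close> in \<open>e\<^bsub>x,y\<^esub> f\<close>; it is made symmetric in \<open>x, y\<close> and vanishes for \<open>x = y\<close>,
  so that the cyclic relation below needs no side conditions.
\<close>

primrec word_op :: "(nat \<times> nat) list \<Rightarrow> nat \<Rightarrow> nat \<Rightarrow> wfun \<Rightarrow> complex" where
  "word_op [] = (\<lambda>x y f. 0)"
| "word_op (p # w) = (\<lambda>x y f.
     if x = y \<or> x = 0 \<or> y = 0 \<or> snd p < max x y then 0
     else if max x y < snd p then word_op w x y (\<lambda>v. f (p # v))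
     else word_op w (min x y) (fst p) (\<lambda>v. f (p # v)) +
       (if fst p = min x y
        then (-1) ^ length w * f w - (\<Sum>h = 1..<snd p. word_op w (min x y) h (\<lambda>v. f ((h, snd p) # v)))
        else 0))"

lemma word_op_commute: "word_op w x y f = word_op w y x f"
proof (induction w arbitrary: f)
  case (Cons p v)
  have "min y x = min x y" "max y x = max x y" "(y = x \<or> y = 0 \<or> x = 0 \<or> snd p < max x y) = (x = y \<or> x = 0 \<or> y = 0 \<or> snd p < max x y)"
    by auto
  then show ?case unfolding word_op.simps Cons[of "\<lambda>v. f (p # v)"] by (simp only:)
qed simp

lemma word_op_same [simp]: "word_op w x x f = 0"
  by (cases w) simp_all

lemma word_op_0 [simp]: "word_op w 0 x f = 0" "word_op w x 0 f = 0"
  by (cases w; simp)+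

lemma word_op_Cons_less:
  "x < m \<Longrightarrow> y < m \<Longrightarrow> word_op ((k, m) # w) x y f = word_op w x y (\<lambda>v. f ((k, m) # v))"
  by (cases "x = 0 \<or> y = 0 \<or> x = y") (auto simp: min_def)

text \<open>Transpose of \<open>e_{x,m} (b a_{h,m}) = (e_{x,h} b) (a_{h,m} - a_{x,m})\<close>: an
  output letter \<open>k\<close> receives the first term from \<open>h = k\<close>, and only the
  letter \<open>x\<close> receives the second term, from every \<open>h\<close>. The sign is that of
  moving \<open>a_{x,m}\<close> past the factors of \<open>w\<close>.\<close>

lemma word_op_Cons_eq:
  "1 \<le> x \<Longrightarrow> x < m \<Longrightarrow> word_op ((k, m) # w) x m f = word_op w x k (\<lambda>v. f ((k, m) # v)) +
     (if k = x then (-1) ^ length w * f w - (\<Sum>h = 1..<m. word_op w x h (\<lambda>v. f ((h, m) # v))) else 0)"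
  by (auto simp: min_def max_def)

lemma word_op_Cons_greater: "m < x \<or> m < y \<Longrightarrow> word_op ((k, m) # w) x y f = 0"
  by auto

lemma word_op_eq_0:
  "\<forall>p\<in>set w. snd p < max x y \<Longrightarrow> word_op w x y f = 0"
  by (cases w) auto

lemma word_op_add: "word_op w x y (\<lambda>v. f v + g v) = word_op w x y f + word_op w x y g"
  by (induction w arbitrary: x y f g) (auto simp: sum.distrib algebra_simps)

lemma word_op_scale: "word_op w x y (\<lambda>v. c * f v) = c * word_op w x y f"
  by (induction w arbitrary: x y f) (auto simp: sum_distrib_left algebra_simps)

lemma word_op_zero [simp]: "word_op w x y (\<lambda>v. 0) = 0"
  using word_op_scale[of w x y 0 "\<lambda>_. 0"] by simp

lemma word_op_uminus: "word_op w x y (\<lambda>v. - f v) = - word_op w x y f"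
  using word_op_scale[of w x y "-1" f] by simp

lemma word_op_diff: "word_op w x y (\<lambda>v. f v - g v) = word_op w x y f - word_op w x y g"
  using word_op_add[of w x y f "\<lambda>v. - g v"] by (simp add: word_op_uminus)

lemma word_op_sum: "word_op w x y (\<lambda>v. \<Sum>h\<in>H. f h v) = (\<Sum>h\<in>H. word_op w x y (f h))"
  by (induction H rule: infinite_finite_induct) (simp_all add: word_op_add)

lemma word_op_if: "word_op w x y (\<lambda>v. if P then f v else g v) = (if P then word_op w x y f else word_op w x y g)"
  by simp

lemmas word_op_linear = word_op_add word_op_scale word_op_uminus word_op_diff word_op_sum word_op_if

text \<open>\<open>word_op w\<close> reads \<open>f\<close> only at words with one letter less than
  \<open>w\<close>, which accounts for the extra sign.\<close>

lemma word_op_parity: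
  "word_op w x y (\<lambda>v. (-1) ^ length v * f v) = - ((-1) ^ length w * word_op w x y f)"
proof (induction w arbitrary: x y f)
  case (Cons p w)
  have s: "word_op w x y (\<lambda>v. (-1) ^ length (q # v) * g v) = (-1) ^ length w * word_op w x y g" for x y q g
    using Cons.IH[of x y g] word_op_uminus[of w x y "\<lambda>v. (-1) ^ length v * g v"] by simp
  show ?case
    unfolding word_op.simps s by (simp add: sum_distrib_left algebra_simps)
qed simp

text \<open>Admissible words are the only ones read from an admissible word, so operators can be
  composed on them alone. The condition on second indices keeps the head letter the largest when it
  is put back.\<close>

lemma word_op_cong:
  assumes "\<And>v. os_word l n v \<Longrightarrow> Suc (length v) = length w \<Longrightarrow> snd ` set v \<subseteq> snd ` set w \<Longrightarrow> f v = g v"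
    and "os_word l n w"
  shows "word_op w x y f = word_op w x y g"
  using assms
proof (induction w arbitrary: x y f g)
  case (Cons p w)
  have w: "os_word l n w" and p: "\<And>q. q \<in> set w \<Longrightarrow> snd q < snd p" "p \<in> index_set l n"
    using Cons.prems(2) by (auto simp: os_word_def)
  have s: "word_op w x y (\<lambda>v. f ((h, snd p) # v)) = word_op w x y (\<lambda>v. g ((h, snd p) # v))"
    if h: "1 \<le> h" "h < snd p" for x y h
  proof (rule Cons.IH[OF _ w])
    fix v assume v: "os_word l n v" "Suc (length v) = length w" "snd ` set v \<subseteq> snd ` set w"
    have "snd q < snd p" if "q \<in> set v" for q
      using v(3) that p(1) by fastforce
    then have "os_word l n ((h, snd p) # v)"
      using v(1) p(2) h by (auto simp: os_word_def index_set_def)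
    then show "f ((h, snd p) # v) = g ((h, snd p) # v)"
      by (rule Cons.prems(1)) (use v in auto)
  qed
  have "f w = g w" by (rule Cons.prems(1)) (use w in auto)
  moreover have "word_op w x y (\<lambda>v. f (p # v)) = word_op w x y (\<lambda>v. g (p # v))" for x y
    using s[of "fst p" x y] p(2) by (auto simp: index_set_def)
  moreover have "(\<Sum>h = 1..<snd p. word_op w z h (\<lambda>v. f ((h, snd p) # v))) =
      (\<Sum>h = 1..<snd p. word_op w z h (\<lambda>v. g ((h, snd p) # v)))" for z
    by (rule sum.cong) (auto simp: s)
  ultimately show ?case by (simp only: word_op.simps)
qed simp

declare word_op.simps(2) [simp del]

section \<open>Anticommutation and the cyclic relation on words\<close>

definition word_anticomm :: "(nat \<times> nat) list \<Rightarrow> bool" where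
  "word_anticomm w \<longleftrightarrow> (\<forall>x y x' y' f. word_op w x y (\<lambda>v. word_op v x' y' f) = - word_op w x' y' (\<lambda>v. word_op v x y f))"

definition word_cyclic :: "(nat \<times> nat) list \<Rightarrow> bool" where
  "word_cyclic w \<longleftrightarrow> (\<forall>x y z f. word_op w x y (\<lambda>v. word_op v y z f) + word_op w y z (\<lambda>v. word_op v z x f)
     + word_op w z x (\<lambda>v. word_op v x y f) = 0)"

text \<open>No word that the outer operator reads has a letter beyond \<open>m\<close>, so the inner
  operator vanishes on all of them.\<close>

lemma word_op_compose_greater:
  assumes "m < max x' y'" "\<forall>p\<in>set w. snd p < m"
  shows "word_op ((k, m) # w) x y (\<lambda>v. word_op v x' y' f) = 0"
proof -
  have 1: "word_op ((h, m) # v) x' y' f = 0" for h v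
    using assms(1) by (intro word_op_Cons_greater) auto
  have 2: "word_op w x' y' f = 0"
    using assms by (intro word_op_eq_0) auto
  show ?thesis by (simp add: word_op.simps(2)[of "(k, m)" w] 1 2)
qed

text \<open>The generators are sorted by whether they involve \<open>m\<close>. Only two generators
  \<open>e_{a,m}\<close> and \<open>e_{b,m}\<close> need more than anticommutation on
  \<open>w\<close>: their mixed terms cancel by the cyclic relation for \<open>a\<close>,
  \<open>b\<close>, \<open>h\<close>, summed over \<open>h\<close>.\<close>

lemma word_anticomm_Cons:
  assumes A: "word_anticomm w" and R: "word_cyclic w" and m: "\<forall>p\<in>set w. snd p < m"
  shows "word_anticomm ((k, m) # w)"
proof -
  let ?E = "word_op ((k, m) # w)"
  let ?O = "\<lambda>x y x' y' f. ?E x y (\<lambda>v. word_op v x' y' f)"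
  have A': "word_op w x y (\<lambda>v. word_op v x' y' f) = - word_op w x' y' (\<lambda>v. word_op v x y f)" for x y x' y' f
    using A unfolding word_anticomm_def by blast
  have R': "word_op w x y (\<lambda>v. word_op v y z f) + word_op w y z (\<lambda>v. word_op v z x f)
     + word_op w z x (\<lambda>v. word_op v x y f) = 0" for x y z f
    using R unfolding word_cyclic_def by blast
  have w0: "word_op w x m f = 0" for x f
    using m by (intro word_op_eq_0) auto
  have ll: "?O x y x' y' f = - ?O x' y' x y f" if "x < m" "y < m" "x' < m" "y' < m" for x y x' y' f
    using that by (simp add: word_op_Cons_less A'[of x y x' y'])
  have lm: "?O x y a m f = - ?O a m x y f" if a: "1 \<le> a" "a < m" "x < m" "y < m" for x y a f
  proof -
    let ?s = "\<lambda>h v. f ((h, m) # v)"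
    have "?O x y a m f = word_op w x y (\<lambda>v. word_op v a k (?s k)) +
      (if k = a then word_op w x y (\<lambda>v. (-1) ^ length v * f v) -
         (\<Sum>h = 1..<m. word_op w x y (\<lambda>v. word_op v a h (?s h))) else 0)"
      using a by (simp add: word_op_Cons_less word_op_Cons_eq word_op_linear)
    moreover have "?O a m x y f = word_op w a k (\<lambda>v. word_op v x y (?s k)) +
      (if k = a then (-1) ^ length w * word_op w x y f -
         (\<Sum>h = 1..<m. word_op w a h (\<lambda>v. word_op v x y (?s h))) else 0)"
      using a by (simp add: word_op_Cons_less word_op_Cons_eq)
    ultimately show ?thesis
      by (simp add: word_op_parity sum_negf A'[of x y a])
  qed
  have mm: "?O a m b m f = - ?O b m a m f" if a: "1 \<le> a" "a < m" "1 \<le> b" "b < m" for a b f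
  proof -
    let ?s = "\<lambda>h v. f ((h, m) # v)"
    \<comment> \<open>At head \<open>(k, m)\<close> the function \<open>e_{b,m} f\<close> has a part
      that keeps the letter \<open>k\<close> and, for \<open>k = b\<close> only, the additional part
      \<open>?g b\<close>.\<close>
    let ?g = "\<lambda>b v. (-1) ^ length v * f v - (\<Sum>h = 1..<m. word_op v b h (?s h))"
    have 1: "?O a m b m f = word_op w a k (\<lambda>v. word_op v b k (?s k)) +
       (if k = b then word_op w a k (?g b) else 0) -
       (if k = a then (\<Sum>h = 1..<m. word_op w a h (\<lambda>v. word_op v b h (?s h))) + word_op w a b (?g b) else 0)"
      if a: "1 \<le> a" "a < m" "1 \<le> b" "b < m" for a b
    proof -
      have s: "(\<Sum>h = 1..<m. if h = b then word_op w a h (?g b) else 0) = word_op w a b (?g b)"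
        using a by simp
      have "?O a m b m f = word_op w a k (\<lambda>v. word_op v b k (?s k) + (if k = b then ?g b v else 0)) +
         (if k = a then - (\<Sum>h = 1..<m. word_op w a h (\<lambda>v. word_op v b h (?s h) + (if h = b then ?g b v else 0))) else 0)"
        using a by (simp add: word_op_Cons_eq w0)
      also have "\<dots> = word_op w a k (\<lambda>v. word_op v b k (?s k)) +
       (if k = b then word_op w a k (?g b) else 0) -
       (if k = a then (\<Sum>h = 1..<m. word_op w a h (\<lambda>v. word_op v b h (?s h))) +
         (\<Sum>h = 1..<m. if h = b then word_op w a h (?g b) else 0) else 0)"
        by (simp only: word_op_add word_op_if word_op_zero sum.distrib) simp
      finally show ?thesis unfolding s .
    qed
    \<comment> \<open>The parity terms cancel because \<open>e_{a,b} = e_{b,a}\<close>; what remains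
      for each \<open>h\<close> is the cyclic relation for \<open>a\<close>, \<open>b\<close>,
      \<open>h\<close> after one anticommutation.\<close>
    have 2: "word_op w a b (?g b) - (\<Sum>h = 1..<m. word_op w b h (\<lambda>v. word_op v a h (?s h)))
       - word_op w b a (?g a) = 0" for a b
    proof -
      have "word_op w a b (?g b) - (\<Sum>h = 1..<m. word_op w b h (\<lambda>v. word_op v a h (?s h)))
       - word_op w b a (?g a) = - (\<Sum>h = 1..<m. word_op w a b (\<lambda>v. word_op v b h (?s h)) +
          word_op w b h (\<lambda>v. word_op v h a (?s h)) - word_op w b a (\<lambda>v. word_op v h a (?s h)))"
        by (simp add: word_op_diff word_op_sum word_op_commute[of _ b a] sum.distrib sum_subtractf
           word_op_commute[of _ _ a])
      also have "\<dots> = - (\<Sum>h = 1..<m. 0)"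
        using R'[of a b _ "?s _"] A'[of _ a a b "?s _"]
        by (intro arg_cong[of _ _ uminus] sum.cong) (simp_all add: word_op_commute[of _ b a])
      finally show ?thesis by simp
    qed
    have "word_op w a k (\<lambda>v. word_op v b k (?s k)) = - word_op w b k (\<lambda>v. word_op v a k (?s k))"
      by (rule A')
    then show ?thesis
      unfolding 1[OF a] 1[OF a(3,4,1,2)] using 2[of a b] 2[of b a] by (auto simp: algebra_simps neg_eq_iff_add_eq_0)
  qed
  \<comment> \<open>By symmetry both pairs may be taken in increasing order, so that
    \<open>m\<close> can only be the second index.\<close>
  have half: "?O x y x' y' f = - ?O x' y' x y f" if le: "x \<le> y" "x' \<le> y'" for x y x' y' f
  proof -
    consider "x = 0 \<or> x' = 0 \<or> x = y \<or> x' = y'" | "m < y \<or> m < y'" | "1 \<le> x" "1 \<le> x'" "x < y" "x' < y'" "y \<le> m" "y' \<le> m"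
      using le by linarith
    then show ?thesis
    proof cases
      case 1
      then show ?thesis by auto
    next
      case 2
      have "?O a b x y f = 0" "?O x y a b f = 0" if "m < y" for a b x y
        using word_op_compose_greater[OF _ m] that by (simp_all add: word_op_Cons_greater)
      then show ?thesis using 2 by auto
    next
      case 3
      then consider "y < m" "y' < m" | "y < m" "y' = m" | "y = m" "y' < m" | "y = m" "y' = m"
        by linarith
      then show ?thesis
      proof cases
        case 1
        then show ?thesis using 3 by (intro ll) auto
      next
        case 2
        then show ?thesis using 3 lm[of x' x y f] by simp
      next
        case c: 3
        then show ?thesis using 3 lm[of x x' y' f] by simp
      next
        case 4
        then show ?thesis using 3 mm[of x x' f] by simp
      qed
    qed
  qed
  show ?thesis
    unfolding word_anticomm_def
  proof (intro allI)
    fix x y x' y' f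
    show "?O x y x' y' f = - ?O x' y' x y f"
      by (metis (no_types, lifting) word_op_commute half nat_le_linear ext)
  qed
qed

text \<open>Rotating the triple leaves the sum unchanged, so the new case is \<open>m\<close> in
  third place. A repeated index turns the relation into the vanishing of a square, and an index
  beyond \<open>m\<close> makes all three terms zero.\<close>

lemma word_cyclic_Cons:
  assumes A: "word_anticomm w" and R: "word_cyclic w" and m: "\<forall>p\<in>set w. snd p < m"
  shows "word_cyclic ((k, m) # w)"
proof -
  let ?E = "word_op ((k, m) # w)"
  let ?O = "\<lambda>x y x' y' f. ?E x y (\<lambda>v. word_op v x' y' f)"
  let ?R = "\<lambda>x y z f. ?O x y y z f + ?O y z z x f + ?O z x x y f"
  have "word_anticomm ((k, m) # w)" by (rule word_anticomm_Cons[OF assms])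
  then have AC: "?O x y x' y' f = - ?O x' y' x y f" for x y x' y' f
    unfolding word_anticomm_def by blast
  have A': "word_op w x y (\<lambda>v. word_op v x' y' f) = - word_op w x' y' (\<lambda>v. word_op v x y f)" for x y x' y' f
    using A unfolding word_anticomm_def by blast
  have R': "word_op w x y (\<lambda>v. word_op v y z f) + word_op w y z (\<lambda>v. word_op v z x f)
     + word_op w z x (\<lambda>v. word_op v x y f) = 0" for x y z f
    using R unfolding word_cyclic_def by blast
  have w0: "word_op w x m f = 0" for x f
    using m by (intro word_op_eq_0) auto
  have O0: "?O x y x' y' f = 0" if "m < max x y \<or> m < max x' y'" for x y x' y' f
    using that word_op_compose_greater[OF _ m] word_op_Cons_greater[of m x y] by (auto simp: less_max_iff_disj)
  have eq: "?R x x z f = 0" for x z f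
    using AC[of x z x z f] by (simp add: word_op_commute[of _ z x])
  have top: "?R x y m f = 0" if a: "1 \<le> x" "x < m" "1 \<le> y" "y < m" "x \<noteq> y" for x y f
  proof -
    let ?s = "\<lambda>h v. f ((h, m) # v)"
    let ?g = "\<lambda>b v. (-1) ^ length v * f v - (\<Sum>h = 1..<m. word_op v b h (?s h))"
    have 1: "?O x y y m f = word_op w x y (\<lambda>v. word_op v y k (?s k)) +
       (if k = y then word_op w x y (?g y) else 0)"
      using a by (simp add: word_op_Cons_less word_op_Cons_eq word_op_add)
    have s: "(\<Sum>h = 1..<m. if h = x then word_op w y h (?g x) else 0) = word_op w y x (?g x)"
      using a by simp
    have "?O y m m x f = word_op w y k (\<lambda>v. word_op v x k (?s k) + (if k = x then ?g x v else 0)) +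
         (if k = y then - (\<Sum>h = 1..<m. word_op w y h (\<lambda>v. word_op v x h (?s h) + (if h = x then ?g x v else 0))) else 0)"
      using a by (simp add: word_op_Cons_eq word_op_commute[of _ m] w0)
    also have "\<dots> = word_op w y k (\<lambda>v. word_op v x k (?s k)) +
       (if k = x then word_op w y k (?g x) else 0) -
       (if k = y then (\<Sum>h = 1..<m. word_op w y h (\<lambda>v. word_op v x h (?s h))) +
         (\<Sum>h = 1..<m. if h = x then word_op w y h (?g x) else 0) else 0)"
      by (simp only: word_op_add word_op_if word_op_zero sum.distrib) simp
    finally have 2: "?O y m m x f = word_op w y k (\<lambda>v. word_op v x k (?s k)) +
       (if k = x then word_op w y k (?g x) else 0) -
       (if k = y then (\<Sum>h = 1..<m. word_op w y h (\<lambda>v. word_op v x h (?s h))) + word_op w y x (?g x) else 0)"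
      unfolding s .
    have 3: "?O m x x y f = word_op w x k (\<lambda>v. word_op v x y (?s k)) +
       (if k = x then (-1) ^ length w * word_op w x y f - (\<Sum>h = 1..<m. word_op w x h (\<lambda>v. word_op v x y (?s h))) else 0)"
      using a by (simp add: word_op_Cons_less word_op_Cons_eq word_op_commute[of _ m])
    \<comment> \<open>This and the next two facts are the contributions special to the head letter
      \<open>k = x\<close>, those special to \<open>k = y\<close>, and the part common to every
      \<open>k\<close>.\<close>
    have 4: "word_op w y x (?g x) + (-1) ^ length w * word_op w x y f
        - (\<Sum>h = 1..<m. word_op w x h (\<lambda>v. word_op v x y (?s h))) = 0"
      by (simp add: word_op_diff word_op_sum word_op_parity word_op_commute[of _ y x] A'[of x y x] sum_negf)
    have 5: "word_op w x y (?g y) - (\<Sum>h = 1..<m. word_op w y h (\<lambda>v. word_op v x h (?s h)))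
        - word_op w y x (?g x) = 0"
    proof -
      have "word_op w x y (?g y) - (\<Sum>h = 1..<m. word_op w y h (\<lambda>v. word_op v x h (?s h)))
        - word_op w y x (?g x) = - (\<Sum>h = 1..<m. word_op w x y (\<lambda>v. word_op v y h (?s h)) +
          word_op w y h (\<lambda>v. word_op v h x (?s h)) - word_op w x y (\<lambda>v. word_op v h x (?s h)))"
        by (simp add: word_op_diff word_op_sum word_op_commute[of _ y x] sum.distrib sum_subtractf
           word_op_commute[of _ _ x])
      also have "\<dots> = - (\<Sum>h = 1..<m. 0)"
        using R'[of x y _ "?s _"] A'[of _ x x y "?s _"]
        by (intro arg_cong[of _ _ uminus] sum.cong) simp_all
      finally show ?thesis by simp
    qed
    have 6: "word_op w x y (\<lambda>v. word_op v y k (?s k)) + word_op w y k (\<lambda>v. word_op v x k (?s k)) +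
       word_op w x k (\<lambda>v. word_op v x y (?s k)) = 0"
      using R'[of x y k "?s k"] by (simp add: word_op_commute[of _ k x])
    show ?thesis
      unfolding 1 2 3 using 4 5 6 a(5) by (auto simp: algebra_simps)
  qed
  show ?thesis
    unfolding word_cyclic_def
  proof (intro allI)
    fix x y z :: nat and f
    have cyc: "?R x y z f = ?R y z x f" "?R x y z f = ?R z x y f" for x y z :: nat
      by (simp_all only: add_ac)
    consider "x = y" | "y = z" | "z = x" | "x \<noteq> y" "y \<noteq> z" "z \<noteq> x" by blast
    then show "?R x y z f = 0"
    proof cases
      case 1 then show ?thesis using eq by blast
    next
      case 2 then show ?thesis using eq[of y x f] cyc(1)[of x y z] by simp
    next
      case 3 then show ?thesis using eq[of z y f] cyc(2)[of x y z] by simp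
    next
      case ne: 4
      consider "x = 0 \<or> y = 0 \<or> z = 0" | "m < x \<or> m < y \<or> m < z"
        | "1 \<le> x" "1 \<le> y" "1 \<le> z" "x \<le> m" "y \<le> m" "z \<le> m" by linarith
      then show ?thesis
      proof cases
        case 1 then show ?thesis by auto
      next
        case 2
        then have "?O x y y z f = 0" "?O y z z x f = 0" "?O z x x y f = 0"
          by (intro O0; auto simp: less_max_iff_disj)+
        then show ?thesis by simp
      next
        case 3
        then consider "x = m" | "y = m" | "z = m" | "x < m" "y < m" "z < m" by linarith
        then show ?thesis
        proof cases
          case 1
          then show ?thesis using top[of y z f] cyc(1)[of x y z] ne 3 by simp
        next
          case 2
          then show ?thesis using top[of z x f] cyc(2)[of x y z] ne 3 by simp
        next
          case c: 3
          then show ?thesis using top[of x y f] ne 3 by simp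
        next
          case 4 then show ?thesis by (simp only: word_op_Cons_less R')
        qed
      qed
    qed
  qed
qed

lemma word_relations:
  assumes "sorted_wrt (\<lambda>p q. snd q < snd p) w"
  shows "word_anticomm w \<and> word_cyclic w"
  using assms
proof (induction w)
  case Nil
  then show ?case by (simp add: word_anticomm_def word_cyclic_def)
next
  case (Cons p w)
  then show ?case
    using word_anticomm_Cons[of w "snd p" "fst p"] word_cyclic_Cons[of w "snd p" "fst p"]
    unfolding prod.collapse sorted_wrt.simps by blast
qed

section \<open>The action of the exterior algebra\<close>

definition os_op :: "nat \<Rightarrow> nat \<Rightarrow> nat \<times> nat \<Rightarrow> wfun \<Rightarrow> wfun" where
  "os_op l n p f = (\<lambda>w. if os_word l n w then word_op w (fst p) (snd p) f else 0)"

lemma os_op_add: "os_op l n p (\<lambda>v. f v + g v) = (\<lambda>w. os_op l n p f w + os_op l n p g w)"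
  by (simp add: os_op_def fun_eq_iff word_op_add)

lemma os_op_scale: "os_op l n p (\<lambda>v. c * f v) = (\<lambda>w. c * os_op l n p f w)"
  by (simp add: os_op_def fun_eq_iff word_op_scale)

lemma os_op_zero [simp]: "os_op l n p (\<lambda>v. 0) = (\<lambda>w. 0)"
  by (simp add: os_op_def fun_eq_iff)

text \<open>The inner cut-off is invisible, because only admissible words are read from an
  admissible word.\<close>

lemma os_op_os_op:
  "os_op l n p (os_op l n q f) w =
     (if os_word l n w then word_op w (fst p) (snd p) (\<lambda>v. word_op v (fst q) (snd q) f) else 0)"
proof -
  have "word_op w (fst p) (snd p) (\<lambda>v. if os_word l n v then word_op v (fst q) (snd q) f else 0) =
     word_op w (fst p) (snd p) (\<lambda>v. word_op v (fst q) (snd q) f)" if "os_word l n w"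
    by (rule word_op_cong[OF _ that]) simp
  then show ?thesis by (simp add: os_op_def)
qed

lemma os_op_anticommute: "os_op l n p (os_op l n q f) = (\<lambda>w. - os_op l n q (os_op l n p f) w)"
proof
  fix w
  show "os_op l n p (os_op l n q f) w = - os_op l n q (os_op l n p f) w"
  proof (cases "os_word l n w")
    case True
    then have "word_anticomm w" using word_relations unfolding os_word_def by blast
    then show ?thesis unfolding os_op_os_op if_P[OF True] word_anticomm_def by blast
  qed (simp add: os_op_os_op)
qed

lemma os_op_square: "os_op l n p (os_op l n p f) = (\<lambda>w. 0)"
proof
  fix w
  have "os_op l n p (os_op l n p f) w = - os_op l n p (os_op l n p f) w"
    using fun_cong[OF os_op_anticommute[of l n p p f]] .
  then show "os_op l n p (os_op l n p f) w = 0" by simp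
qed

text \<open>Up to sign this is the cyclic relation with \<open>e_{k,i} = e_{i,k}\<close>, after two
  of its products are reordered by anticommutation.\<close>

lemma os_op_relation:
  "os_op l n (i, j) (os_op l n (i, k) f) w - os_op l n (i, j) (os_op l n (j, k) f) w
     + os_op l n (i, k) (os_op l n (j, k) f) w = 0"
proof (cases "os_word l n w")
  case True
  then have "word_cyclic w" "word_anticomm w"
    using word_relations unfolding os_word_def by blast+
  then have "word_op w i j (\<lambda>v. word_op v j k f) + word_op w j k (\<lambda>v. word_op v k i f)
     + word_op w k i (\<lambda>v. word_op v i j f) = 0"
     "word_op w j k (\<lambda>v. word_op v k i f) = - word_op w k i (\<lambda>v. word_op v j k f)"
     "word_op w k i (\<lambda>v. word_op v i j f) = - word_op w i j (\<lambda>v. word_op v k i f)"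
    unfolding word_cyclic_def word_anticomm_def by blast+
  then show ?thesis
    using True by (simp add: os_op_os_op word_op_commute[of _ k i] algebra_simps)
qed (simp add: os_op_os_op)

text \<open>All letters of an admissible word have second index above \<open>l\<close>, so the
  operator is pushed down to the empty word. Through this the second family of Orlik-Solomon
  relations becomes a special case of \<open>os_op_relation\<close>.\<close>

lemma word_op_low:
  assumes "os_word l n w" "x \<le> l" "y \<le> l"
  shows "word_op w x y f = 0"
  using assms
proof (induction w arbitrary: f)
  case (Cons p w)
  then have "os_word l n w" "l < snd p"
    by (auto simp: os_word_def index_set_def)
  then show ?case
    using Cons word_op_Cons_less[of x "snd p" y "fst p" w f] by simp
qed simp

lemma os_op_low: "j \<le> l \<Longrightarrow> i \<le> l \<Longrightarrow> os_op l n (i, j) f = (\<lambda>w. 0)"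
  by (simp add: os_op_def word_op_low fun_eq_iff)

section \<open>Ordered products of operators and their signs\<close>

primrec set_op :: "nat \<Rightarrow> nat \<Rightarrow> (nat \<times> nat) list \<Rightarrow> (nat \<times> nat) set \<Rightarrow> wfun \<Rightarrow> wfun" where
  "set_op l n [] K f = f"
| "set_op l n (p # xs) K f = (if p \<in> K then os_op l n p (set_op l n xs K f) else set_op l n xs K f)"

lemma set_op_add: "set_op l n xs K (\<lambda>v. f v + g v) = (\<lambda>w. set_op l n xs K f w + set_op l n xs K g w)"
  by (induction xs) (simp_all add: os_op_add)

lemma set_op_scale: "set_op l n xs K (\<lambda>v. c * f v) = (\<lambda>w. c * set_op l n xs K f w)"
  by (induction xs) (simp_all add: os_op_scale)

lemma set_op_zero [simp]: "set_op l n xs K (\<lambda>v. 0) = (\<lambda>w. 0)"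
  by (induction xs) simp_all

lemma set_op_sum:
  "set_op l n xs K (\<lambda>v. \<Sum>h\<in>H. f h v) = (\<lambda>w. \<Sum>h\<in>H. set_op l n xs K (f h) w)"
  by (induction H rule: infinite_finite_induct) (simp_all add: set_op_add)

lemma set_op_cong: "K \<inter> set xs = L \<inter> set xs \<Longrightarrow> set_op l n xs K f = set_op l n xs L f"
proof (induction xs)
  case (Cons p xs)
  then have "K \<inter> set xs = L \<inter> set xs" "p \<in> K \<longleftrightarrow> p \<in> L" by auto
  then show ?case using Cons.IH by simp
qed simp

lemma set_op_os_op:
  "distinct xs \<Longrightarrow> set_op l n xs K (os_op l n p f) =
     (\<lambda>w. (-1) ^ card (K \<inter> set xs) * os_op l n p (set_op l n xs K f) w)"
proof (induction xs)
  case (Cons q xs)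
  then have "card (K \<inter> set (q # xs)) = (if q \<in> K then Suc (card (K \<inter> set xs)) else card (K \<inter> set xs))"
    by (simp add: Int_insert_right)
  moreover have "set_op l n xs K (os_op l n p f) =
      (\<lambda>w. (-1) ^ card (K \<inter> set xs) * os_op l n p (set_op l n xs K f) w)"
    using Cons by simp
  ultimately show ?case
    by (simp add: os_op_scale os_op_anticommute[of l n q p])
qed simp

lemma gen_less_irrefl: "\<not> gen_less p p"
  by (cases p) (simp add: gen_less_def)

lemma gen_less_asym: "gen_less p q \<Longrightarrow> \<not> gen_less q p"
  by (cases p; cases q) (auto simp: gen_less_def)

lemma gen_less_sorted_distinct: "sorted_wrt gen_less xs \<Longrightarrow> distinct xs"
  by (induction xs) (use gen_less_irrefl in auto)

lemma shuffle_sign_first: "(\<And>q. q \<in> L \<Longrightarrow> gen_less p q) \<Longrightarrow> shuffle_sign {p} L = 1"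
proof -
  assume "\<And>q. q \<in> L \<Longrightarrow> gen_less p q"
  then have "{(a, b). a \<in> {p} \<and> b \<in> L \<and> gen_less b a} = {}"
    using gen_less_asym by blast
  then show ?thesis unfolding shuffle_sign_def by (simp only: card.empty power_0)
qed

lemma shuffle_sign_last: "(\<And>q. q \<in> K \<Longrightarrow> gen_less p q) \<Longrightarrow> shuffle_sign K {p} = (-1) ^ card K"
proof -
  assume "\<And>q. q \<in> K \<Longrightarrow> gen_less p q"
  then have "{(a, b). a \<in> K \<and> b \<in> {p} \<and> gen_less b a} = (\<lambda>a. (a, p)) ` K"
    by auto
  then show ?thesis
    unfolding shuffle_sign_def by (simp add: card_image inj_on_def)
qed

text \<open>The head \<open>p\<close> is the least generator and its operator stands outermost. It
  causes no inversion when it comes from \<open>K\<close> alone, has to pass all of \<open>K\<close>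
  when it comes from \<open>L\<close> alone, and yields a vanishing square when it comes from
  both.\<close>

lemma set_op_set_op:
  assumes "sorted_wrt gen_less xs" "K \<subseteq> set xs" "L \<subseteq> set xs"
  shows "set_op l n xs K (set_op l n xs L f) =
    (\<lambda>w. if K \<inter> L = {} then shuffle_sign K L * set_op l n xs (K \<union> L) f w else 0)"
  using assms
proof (induction xs arbitrary: K L)
  case (Cons p xs)
  define K' L' where "K' = K - {p}" and "L' = L - {p}"
  have sub: "K' \<subseteq> set xs" "L' \<subseteq> set xs" using Cons.prems by (auto simp: K'_def L'_def)
  have lt: "gen_less p q" if "q \<in> set xs" for q using Cons.prems that by simp
  then have pxs: "p \<notin> set xs" "p \<notin> K'" "p \<notin> L'" using gen_less_irrefl sub by blast+
  have fin: "finite K'" "finite L'" using sub finite_subset by blast+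
  have d: "distinct xs" using Cons.prems gen_less_sorted_distinct by auto
  have eq: "set_op l n xs K g = set_op l n xs K' g" "set_op l n xs L g = set_op l n xs L' g"
    "set_op l n xs (K \<union> L) g = set_op l n xs (K' \<union> L') g" for g
    using pxs by (auto simp: K'_def L'_def intro!: set_op_cong)
  have IH: "set_op l n xs K' (set_op l n xs L' f) =
    (\<lambda>w. if K' \<inter> L' = {} then shuffle_sign K' L' * set_op l n xs (K' \<union> L') f w else 0)"
    by (rule Cons.IH) (use Cons.prems sub in auto)
  have cK: "K' \<inter> set xs = K'" using sub by blast
  have IHop: "os_op l n p (set_op l n xs K' (set_op l n xs L' f)) =
    (\<lambda>w. if K' \<inter> L' = {} then shuffle_sign K' L' * os_op l n p (set_op l n xs (K' \<union> L') f) w else 0)"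
    unfolding IH by (cases "K' \<inter> L' = {}") (simp_all add: os_op_scale)
  consider "p \<in> K" "p \<in> L" | "p \<in> K" "p \<notin> L" | "p \<notin> K" "p \<in> L" | "p \<notin> K" "p \<notin> L" by blast
  then show ?case
  proof cases
    case 1
    then have "K \<inter> L \<noteq> {}" by blast
    then show ?thesis
      using 1 by (simp add: eq set_op_os_op[OF d] os_op_scale os_op_square)
  next
    case 2
    have K: "K = {p} \<union> K'" and L: "L = L'" using 2 by (auto simp: K'_def L'_def)
    have "shuffle_sign K L = shuffle_sign K' L'"
      unfolding K L using fin pxs sub lt
      by (subst shuffle_sign_union_left) (auto simp: shuffle_sign_first subset_eq)
    moreover have "K \<inter> L = K' \<inter> L'" using K L pxs by blast
    ultimately show ?thesis using 2 by (simp add: eq IHop cong: if_cong)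
  next
    case 3
    have K: "K = K'" and L: "L = {p} \<union> L'" using 3 by (auto simp: K'_def L'_def)
    have "shuffle_sign K L = (-1) ^ card K' * shuffle_sign K' L'"
      unfolding K L using fin pxs sub lt
      by (subst shuffle_sign_union_right) (auto simp: shuffle_sign_last subset_eq)
    moreover have "K \<inter> L = K' \<inter> L'" using K L pxs by blast
    moreover have "K \<inter> set xs = K'" using K cK by simp
    ultimately show ?thesis using 3 by (simp add: eq set_op_os_op[OF d] IHop fun_eq_iff cong: if_cong)
  next
    case 4
    have "K = K'" "L = L'" using 4 by (auto simp: K'_def L'_def)
    then show ?thesis using 4 IH by (simp cong: if_cong)
  qed
qed simp

lemma ex_gen_less_sorted_list: "\<exists>xs. sorted_wrt gen_less xs \<and> set xs = index_set l n"
proof (induction n)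
  case 0
  then show ?case by (intro exI[of _ "[]"]) (auto simp: index_set_def)
next
  case (Suc n)
  then obtain xs where xs: "sorted_wrt gen_less xs" "set xs = index_set l n" by blast
  let ?ys = "map (\<lambda>i. (i, Suc n)) (if l \<le> n then [1..<Suc n] else [])"
  have "sorted_wrt gen_less ?ys"
    by (simp add: sorted_wrt_map gen_less_def del: upt_Suc)
  moreover have "gen_less p q" if "p \<in> set xs" "q \<in> set ?ys" for p q
    using that unfolding xs(2) gen_less_def index_set_def by (auto split: if_splits simp del: upt_Suc)
  ultimately have "sorted_wrt gen_less (xs @ ?ys)"
    using xs(1) by (simp add: sorted_wrt_append del: upt_Suc)
  moreover have "set (xs @ ?ys) = index_set l (Suc n)"
    unfolding set_append xs(2) index_set_def by (auto simp del: upt_Suc)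
  ultimately show ?case by blast
qed

definition gen_list :: "nat \<Rightarrow> nat \<Rightarrow> (nat \<times> nat) list" where
  "gen_list l n = (SOME xs. sorted_wrt gen_less xs \<and> set xs = index_set l n)"

lemma gen_list: "sorted_wrt gen_less (gen_list l n)" "set (gen_list l n) = index_set l n"
  using someI_ex[OF ex_gen_less_sorted_list[of l n]] by (simp_all add: gen_list_def)

definition ext_act :: "nat \<Rightarrow> nat \<Rightarrow> ((nat \<times> nat) set \<Rightarrow> complex) \<Rightarrow> wfun \<Rightarrow> wfun" where
  "ext_act l n x f = (\<lambda>w. \<Sum>K\<in>Pow (index_set l n). x K * set_op l n (gen_list l n) K f w)"

lemma ext_act_add: "ext_act l n (\<lambda>K. x K + y K) f = (\<lambda>w. ext_act l n x f w + ext_act l n y f w)"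
  by (simp add: ext_act_def sum.distrib algebra_simps)

lemma ext_act_scale: "ext_act l n (\<lambda>K. c * x K) f = (\<lambda>w. c * ext_act l n x f w)"
  by (simp add: ext_act_def sum_distrib_left algebra_simps)

lemma ext_act_monom:
  "K \<subseteq> index_set l n \<Longrightarrow> ext_act l n (ext_monom K) f = set_op l n (gen_list l n) K f"
proof -
  assume K: "K \<subseteq> index_set l n"
  have "ext_act l n (ext_monom K) f w =
      (\<Sum>K'\<in>Pow (index_set l n). if K' = K then set_op l n (gen_list l n) K f w else 0)" for w
    unfolding ext_act_def by (rule sum.cong) (auto simp: ext_monom_def)
  then show ?thesis using K by (auto simp: finite_index_set)
qed

lemma ext_act_one: "ext_act l n (ext_monom {}) f = f"
proof -
  have "set_op l n xs {} f = f" for xs by (induction xs) simp_all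
  then show ?thesis by (simp add: ext_act_monom)
qed

lemma ext_act_gen: "p \<in> index_set l n \<Longrightarrow> ext_act l n (ext_gen p) f = os_op l n p f"
proof -
  assume p: "p \<in> index_set l n"
  have "set_op l n xs {p} f = (if p \<in> set xs then os_op l n p f else f)" if "distinct xs" for xs
    using that by (induction xs) auto
  then show ?thesis
    using p gen_list[of l n] gen_less_sorted_distinct by (simp add: ext_gen_def ext_act_monom)
qed

lemma ext_act_wedge: "ext_act l n (wedge x y) f = ext_act l n x (ext_act l n y f)"
proof
  fix w
  let ?S = "index_set l n" and ?A = "set_op l n (gen_list l n)"
  have d: "L - K = L" if "L \<subseteq> ?S - K" for K L using that by blast
  have "ext_act l n x (ext_act l n y f) w = (\<Sum>K\<in>Pow ?S. \<Sum>L\<in>Pow ?S. x K * y L * ?A K (?A L f) w)"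
    by (simp add: ext_act_def set_op_sum set_op_scale sum_distrib_left mult.assoc)
  also have "\<dots> = (\<Sum>K\<in>Pow ?S. \<Sum>L\<in>Pow ?S. if K \<inter> L = {} then x K * y L * shuffle_sign K L * ?A (K \<union> L) f w else 0)"
    by (intro sum.cong refl) (simp add: set_op_set_op gen_list)
  also have "\<dots> = (\<Sum>K\<in>Pow ?S. \<Sum>L\<in>Pow (?S - K). x K * y L * shuffle_sign K L * ?A (K \<union> L) f w)"
    by (intro sum.cong refl sum.mono_neutral_cong_right) (auto simp: finite_index_set)
  also have "\<dots> = (\<Sum>(K, L)\<in>Sigma (Pow ?S) (\<lambda>K. Pow (?S - K)). x K * y L * shuffle_sign K L * ?A (K \<union> L) f w)"
    by (rule sum.Sigma) (auto simp: finite_index_set)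
  \<comment> \<open>Disjoint pairs \<open>K\<close>, \<open>L\<close> correspond to a set
    \<open>M = K \<union> L\<close> with a subset \<open>K\<close>, which is the form of the sum in
    \<open>wedge\<close>.\<close>
  also have "(\<Sum>(K, L)\<in>Sigma (Pow ?S) (\<lambda>K. Pow (?S - K)). x K * y L * shuffle_sign K L * ?A (K \<union> L) f w) = 
     (\<Sum>(M, K)\<in>Sigma (Pow ?S) Pow. shuffle_sign K (M - K) * x K * y (M - K) * ?A M f w)"
    by (rule sum.reindex_bij_witness[where i = "\<lambda>(M, K). (K, M - K)" and j = "\<lambda>(K, L). (K \<union> L, K)"])
      (auto simp: Un_Diff d mult_ac Un_absorb1)
  also have "\<dots> = (\<Sum>M\<in>Pow ?S. \<Sum>K\<in>Pow M. shuffle_sign K (M - K) * x K * y (M - K) * ?A M f w)"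
    by (rule sum.Sigma[symmetric]) (auto simp: finite_index_set finite_subset[OF _ finite_index_set])
  also have "\<dots> = ext_act l n (wedge x y) f w"
    by (simp add: ext_act_def wedge_def sum_distrib_right)
  finally show "ext_act l n (wedge x y) f w = ext_act l n x (ext_act l n y f) w" by simp
qed

lemma ext_gen_carrier: "p \<in> index_set l n \<Longrightarrow> ext_gen p \<in> carrier (exterior_algebra (index_set l n))"
  by (auto simp: exterior_algebra_def ext_gen_def ext_monom_def)

lemma wedge_carrier:
  assumes "x \<in> carrier (exterior_algebra (index_set l n))" "y \<in> carrier (exterior_algebra (index_set l n))"
  shows "wedge x y \<in> carrier (exterior_algebra (index_set l n))"
  using monoid.m_closed[OF ring.is_monoid[OF ring_exterior_algebra[OF finite_index_set]] assms]
  by (simp add: exterior_algebra_def)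

lemma os_relations_carrier: "os_relations l n \<subseteq> carrier (exterior_algebra (index_set l n))"
proof -
  have lin: "(\<lambda>K. x K - y K + z K) \<in> carrier (exterior_algebra S)"
    if "x \<in> carrier (exterior_algebra S)" "y \<in> carrier (exterior_algebra S)" "z \<in> carrier (exterior_algebra S)"
    for x y z S
    using that unfolding exterior_algebra_def by simp (metis add_0 diff_zero)
  show ?thesis
    unfolding os_relations_def by (auto intro!: lin wedge_carrier ext_gen_carrier) (simp_all add: index_set_def)
qed

lemma ideal_os_ideal: "ideal (os_ideal l n) (exterior_algebra (index_set l n))"
  unfolding os_ideal_def
  by (rule ring.genideal_ideal[OF ring_exterior_algebra[OF finite_index_set] os_relations_carrier])

text \<open>The elements that annihilate every function form a two-sided ideal; it contains the
  defining relations, hence the ideal that they generate.\<close>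

lemma ext_act_os_ideal:
  assumes "x \<in> os_ideal l n"
  shows "ext_act l n x f = (\<lambda>w. 0)"
proof -
  let ?E = "exterior_algebra (index_set l n)"
  interpret E: ring ?E by (rule ring_exterior_algebra[OF finite_index_set])
  let ?Z = "{x \<in> carrier ?E. \<forall>f. ext_act l n x f = (\<lambda>w. 0)}"
  have ops: "x \<otimes>\<^bsub>?E\<^esub> y = wedge x y" "x \<oplus>\<^bsub>?E\<^esub> y = (\<lambda>K. x K + y K)" "\<zero>\<^bsub>?E\<^esub> = (\<lambda>_. 0)" for x y
    by (simp_all add: exterior_algebra_def)
  have zero: "ext_act l n z (\<lambda>w. 0) = (\<lambda>w. 0)" for z by (simp add: ext_act_def)
  have add: "ext_act l n (x \<oplus>\<^bsub>?E\<^esub> y) f = (\<lambda>w. ext_act l n x f w + ext_act l n y f w)" for x y f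
    by (simp add: ops ext_act_add)
  have "ideal ?Z ?E"
  proof (rule idealI[OF E.ring_axioms])
    show "subgroup ?Z (add_monoid ?E)"
    proof (rule E.add.subgroupI)
      show "?Z \<noteq> {}" using E.zero_closed by (auto simp: ops ext_act_def)
      fix x assume x: "x \<in> ?Z"
      have "ext_act l n (\<ominus>\<^bsub>?E\<^esub> x) f = (\<lambda>w. 0)" for f
        using add[of "\<ominus>\<^bsub>?E\<^esub> x" x f] E.l_neg[of x] x by (simp add: ops(3)) (simp add: ext_act_def fun_eq_iff)
      then show "\<ominus>\<^bsub>?E\<^esub> x \<in> ?Z" using x by auto
    qed (auto simp: add)
  qed (auto simp: zero ops(1) ext_act_wedge wedge_carrier)
  moreover have "os_relations l n \<subseteq> ?Z"
  proof
    fix x assume x: "x \<in> os_relations l n"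
    have "ext_act l n x f = (\<lambda>w. 0)" for f
    proof -
      have rel: "ext_act l n (\<lambda>K. wedge (ext_gen (i, j)) (ext_gen (i, k)) K - wedge (ext_gen (i, j)) (ext_gen (j, k)) K
          + wedge (ext_gen (i, k)) (ext_gen (j, k)) K) f = (\<lambda>w. 0)"
        if "(i, j) \<in> index_set l n" "(i, k) \<in> index_set l n" "(j, k) \<in> index_set l n" for i j k
        using os_op_relation[of l n i j k f] ext_act_add[of l n "\<lambda>K. wedge (ext_gen (i, j)) (ext_gen (i, k)) K -
            wedge (ext_gen (i, j)) (ext_gen (j, k)) K" "wedge (ext_gen (i, k)) (ext_gen (j, k))" f]
          ext_act_add[of l n "wedge (ext_gen (i, j)) (ext_gen (i, k))" "\<lambda>K. -1 * wedge (ext_gen (i, j)) (ext_gen (j, k)) K" f]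
          ext_act_scale[of l n "-1" "wedge (ext_gen (i, j)) (ext_gen (j, k))" f]
        by (simp add: ext_act_wedge ext_act_gen that)
      \<comment> \<open>Here \<open>e_{i,j}\<close> acts as zero, and the three-term relation
        collapses to this product.\<close>
      have low: "os_op l n (i, k) (os_op l n (j, k) f) = (\<lambda>w. 0)" if "i \<le> l" "j \<le> l" for i j k
        using os_op_relation[of l n i j k f] that by (simp add: os_op_low fun_eq_iff)
      from x show ?thesis
        unfolding os_relations_def
      proof (elim UnE CollectE exE conjE; hypsubst)
        fix i j k assume "1 \<le> i" "i < j" "j < k" "k \<le> n" "l + 1 \<le> j"
        then show "ext_act l n (\<lambda>K. wedge (ext_gen (i, j)) (ext_gen (i, k)) K - wedge (ext_gen (i, j)) (ext_gen (j, k)) K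
          + wedge (ext_gen (i, k)) (ext_gen (j, k)) K) f = (\<lambda>w. 0)"
          by (intro rel) (auto simp: index_set_def)
      next
        fix i j k assume "1 \<le> i" "i < j" "j \<le> l" "l < k" "k \<le> n"
        then show "ext_act l n (wedge (ext_gen (i, k)) (ext_gen (j, k))) f = (\<lambda>w. 0)"
          by (simp add: ext_act_wedge ext_act_gen low index_set_def)
      qed
    qed
    then show "x \<in> ?Z" using x os_relations_carrier by blast
  qed
  ultimately have "os_ideal l n \<subseteq> ?Z"
    unfolding os_ideal_def by (rule E.genideal_minimal)
  then show ?thesis using assms by blast
qed

lemma ext_act_os_class:
  assumes "x \<in> carrier (exterior_algebra (index_set l n))" "os_class l n x = os_class l n y"
  shows "ext_act l n x f = ext_act l n y f"
proof -
  let ?E = "exterior_algebra (index_set l n)"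
  interpret ideal "os_ideal l n" ?E by (rule ideal_os_ideal)
  have "x \<in> os_class l n y"
    using a_rcos_self[OF assms(1)] assms(2) by (simp add: os_class_def)
  then obtain h where h: "h \<in> os_ideal l n" and "x = h \<oplus>\<^bsub>?E\<^esub> y"
    unfolding os_class_def a_r_coset_def' by blast
  then have "x = (\<lambda>K. h K + y K)" by (simp add: exterior_algebra_def)
  then show ?thesis using ext_act_os_ideal[OF h] by (simp add: ext_act_add)
qed

section \<open>Linearization of the Fox Jacobians\<close>

text \<open>With the constant function \<open>1\<close> this is the augmentation of the group ring;
  with an additive function it is a derivation along the augmentation. Every linearization below
  combines the two.\<close>

definition lin_ext :: "('a \<Rightarrow> complex) \<Rightarrow> ('a \<Rightarrow>\<^sub>0 int) \<Rightarrow> complex" where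
  "lin_ext f x = (\<Sum>g\<in>Poly_Mapping.keys x. of_int (Poly_Mapping.lookup x g) * f g)"

lemma lin_ext_superset:
  "finite S \<Longrightarrow> Poly_Mapping.keys x \<subseteq> S \<Longrightarrow> lin_ext f x = (\<Sum>g\<in>S. of_int (Poly_Mapping.lookup x g) * f g)"
  unfolding lin_ext_def by (rule sum.mono_neutral_left) (auto simp: in_keys_iff)

lemma lin_ext_add: "lin_ext f (x + y) = lin_ext f x + lin_ext f y"
  using keys_add[of x y]
  by (simp add: lin_ext_superset[of "Poly_Mapping.keys x \<union> Poly_Mapping.keys y"] lookup_add sum.distrib algebra_simps)

lemma lin_ext_zero [simp]: "lin_ext f 0 = 0"
  by (simp add: lin_ext_def)

lemma lin_ext_uminus: "lin_ext f (- x) = - lin_ext f x"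
  using lin_ext_add[of f x "- x"] by (simp add: eq_neg_iff_add_eq_0 add.commute)

lemma lin_ext_diff: "lin_ext f (x - y) = lin_ext f x - lin_ext f y"
  using lin_ext_add[of f x "- y"] by (simp add: lin_ext_uminus)

lemma lin_ext_frag_of [simp]: "lin_ext f (frag_of g) = f g"
  by (simp add: lin_ext_def)

lemma lin_ext_one [simp]: "lin_ext f 1 = f (0 :: 'a::monoid_add)"
  by (simp only: frag_of_zero[symmetric] lin_ext_frag_of)

lemma lin_ext_frag_extend: "lin_ext f (frag_extend b x) = lin_ext (\<lambda>g. lin_ext f (b g)) x"
  by (rule frag_induction[of x UNIV]) (simp_all add: frag_extend_diff lin_ext_diff)

lemma lin_ext_frag_of_mult: "lin_ext f (frag_of g * x) = lin_ext (\<lambda>h. f (g + h)) x"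
  by (rule frag_induction[of x UNIV])
    (simp_all add: right_diff_distrib lin_ext_diff frag_of_add[symmetric] del: mult_single)

lemma lin_ext_fun_add: "lin_ext (\<lambda>g. f g + h g) x = lin_ext f x + lin_ext h x"
  by (simp add: lin_ext_def sum.distrib algebra_simps)

lemma lin_ext_fun_scale: "lin_ext (\<lambda>g. c * f g) x = c * lin_ext f x"
  by (simp add: lin_ext_def sum_distrib_left algebra_simps)

lemma lin_ext_cong: "(\<And>g. g \<in> Poly_Mapping.keys x \<Longrightarrow> f g = h g) \<Longrightarrow> lin_ext f x = lin_ext h x"
  by (simp add: lin_ext_def)

text \<open>The logarithm of \<open>nu\<close>: an additive function on the group, linear in the
  direction \<open>lam\<close>.\<close>

definition chi :: "nat \<Rightarrow> nat \<Rightarrow> (nat \<times> nat \<Rightarrow> complex) \<Rightarrow> pure_braid \<Rightarrow> complex" where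
  "chi l n lam g = (\<Sum>p\<in>index_set l n. lam p * of_int (exp_sum (fst p) (strand g (snd p))))"

lemma chi_add: "chi l n lam (g + h) = chi l n lam g + chi l n lam h"
  by (simp add: chi_def strand_add exp_sum_conj_act sum.distrib algebra_simps)

lemma chi_zero [simp]: "chi l n lam 0 = 0"
  by (simp add: chi_def)

lemma chi_pgen: "(i, j) \<in> index_set l n \<Longrightarrow> chi l n lam (pgen i j) = lam (i, j)"
proof -
  assume ij: "(i, j) \<in> index_set l n"
  have "chi l n lam (pgen i j) = (\<Sum>p\<in>index_set l n. if p = (i, j) then lam p else 0)"
    unfolding chi_def
    by (rule sum.cong) (use ij in \<open>auto simp: strand_pgen index_set_def split: if_splits\<close>)
  then show ?thesis using ij by (simp add: finite_index_set)
qed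

lemma nu_exp: "nu l n (\<lambda>p. exp (s * lam p)) g = exp (s * chi l n lam g)"
proof -
  have "nu l n (\<lambda>p. exp (s * lam p)) g = (\<Prod>p\<in>index_set l n. exp (s * (lam p * of_int (exp_sum (fst p) (strand g (snd p))))))"
    unfolding nu_def by (rule prod.cong) (auto simp: exp_power_int mult_ac)
  also have "\<dots> = exp (s * chi l n lam g)"
    unfolding chi_def sum_distrib_left by (rule exp_sum[OF finite_index_set, symmetric])
  finally show ?thesis .
qed

lemma ring_eval_has_derivative:
  "((\<lambda>s. ring_eval l n (\<lambda>p. exp (s * lam p)) x) has_field_derivative lin_ext (chi l n lam) x) (at 0)"
  unfolding ring_eval_def lin_ext_def nu_exp
  by (auto intro!: derivative_eq_intros simp: mult.commute)

section \<open>Fox derivatives under additive functions\<close>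

lemma additive_zero:
  fixes T :: "'a free_group \<Rightarrow> complex"
  assumes "\<And>u v. T (u + v) = T u + T v"
  shows "T 0 = 0"
  using assms[of 0 0] by simp

lemma additive_uminus:
  fixes T :: "'a free_group \<Rightarrow> complex"
  assumes "\<And>u v. T (u + v) = T u + T v"
  shows "T (- u) = - T u"
  using assms[of u "- u"] additive_zero[of T, OF assms] by (simp add: eq_neg_iff_add_eq_0 add.commute)

lemma additive_eqI:
  fixes T S :: "'a free_group \<Rightarrow> complex"
  assumes "\<And>u v. T (u + v) = T u + T v" "\<And>u v. S (u + v) = S u + S v" "\<And>i. T (fgen i) = S (fgen i)"
  shows "T u = S u"
  by (induction u rule: free_group_induct)
    (simp_all add: assms additive_zero additive_uminus del: add_uminus_conv_diff)

text \<open>Each generator goes to a conjugate of itself, so the action on the abelianization is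
  trivial.\<close>

lemma additive_braid_aut:
  fixes T :: "nat free_group \<Rightarrow> complex"
  assumes T: "\<And>u v. T (u + v) = T u + T v"
  shows "T (fg_app (braid_aut r s) u) = T u"
  by (rule additive_eqI[where T = "\<lambda>u. T (fg_app (braid_aut r s) u)"])
    (simp_all only: T fg_app_add braid_aut_fgen additive_uminus[OF T], simp)

lemma additive_strand_act:
  fixes T :: "nat free_group \<Rightarrow> complex"
  assumes T: "\<And>u v. T (u + v) = T u + T v"
  shows "T (fg_app (strand_act s y) u) = T u"
proof (induction y arbitrary: u rule: free_group_induct)
  case (inv x w)
  have "T (fg_app (- braid_aut x s) u) = T u"
    by (metis additive_braid_aut[OF T] fg_app_uminus_right)
  then show ?case by (simp add: inv)
qed (simp_all add: additive_braid_aut[OF T])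

lemma additive_conj_act:
  fixes T :: "nat free_group \<Rightarrow> complex"
  assumes T: "\<And>u v. T (u + v) = T u + T v"
  shows "T (fg_app (conj_act j f) u) = T u"
  by (induction j arbitrary: u) (simp_all add: additive_strand_act[OF T])

text \<open>Augmentation turns the product rule of Fox derivatives into additivity.\<close>

lemma lin_ext_one_fox: "lin_ext (\<lambda>_. 1) (fox k u) = of_int (exp_sum k u)"
  by (rule additive_eqI) (simp_all add: fox_add lin_ext_add lin_ext_frag_of_mult)

context
  fixes d :: "nat free_group \<Rightarrow> complex"
  assumes d_add: "\<And>u v. d (u + v) = d u + d v"
begin

text \<open>The quadratic term comes from the left factor in the summand \<open>u * fox k v\<close>
  of the product rule: there \<open>d u\<close> meets the augmentation of
  \<open>fox k v\<close>.\<close>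

lemma lin_ext_fox_add:
  "lin_ext d (fox k (u + v)) = lin_ext d (fox k u) + d u * of_int (exp_sum k v) + lin_ext d (fox k v)"
  using lin_ext_fun_scale[of "d u" "\<lambda>_. 1" "fox k v"]
  by (simp add: fox_add lin_ext_add lin_ext_frag_of_mult d_add lin_ext_fun_add lin_ext_one_fox)

lemma lin_ext_fox_fgen [simp]: "lin_ext d (fox k (fgen i)) = 0"
  using additive_zero[of d, OF d_add] by (simp)

text \<open>
  For braid automorphisms \<open>\<phi>\<close>, which act trivially on the abelianization, this is additive in \<open>u\<close>
  and in \<open>\<phi>\<close>, although the linearized Fox derivative itself is not additive.
\<close>

definition fox_defect :: "nat \<Rightarrow> nat fg_aut \<Rightarrow> nat free_group \<Rightarrow> complex" where
  "fox_defect k \<phi> u = lin_ext d (fox k (fg_app \<phi> u)) - lin_ext d (fox k u)"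

text \<open>The quadratic term of the product rule is the same before and after the automorphism,
  since \<open>d\<close> and \<open>exp_sum\<close> are invariant under it; it cancels in the
  difference.\<close>

lemma fox_defect_strand_act_add:
  "fox_defect k (strand_act s y) (u + v) = fox_defect k (strand_act s y) u + fox_defect k (strand_act s y) v"
  by (simp add: fox_defect_def lin_ext_fox_add additive_strand_act d_add exp_sum_strand_act)

lemma fox_defect_plus:
  "fox_defect k (\<phi> + \<psi>) u = fox_defect k \<phi> u + fox_defect k \<psi> (fg_app \<phi> u)"
  by (simp add: fox_defect_def)

lemma fox_defect_zero [simp]: "fox_defect k 0 u = 0"
  by (simp add: fox_defect_def)

text \<open>Additivity in the automorphism follows from additivity in the word:
  \<open>fox_defect_plus\<close> evaluates its second summand at an image, and an additive function
  does not see the first automorphism.\<close>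

lemma fox_defect_strand_act:
  assumes "y \<in> strand_group s"
  shows "fox_defect k (strand_act s y) u = (\<Sum>r = 1..<s. of_int (exp_sum r y) * fox_defect k (braid_aut r s) u)"
  using assms
proof (induction y arbitrary: u rule: strand_group.induct)
  case sg_zero
  then show ?case by simp
next
  case (sg_gen i w)
  have "fox_defect k (strand_act s (fgen i + w)) u =
      fox_defect k (braid_aut i s) u + fox_defect k (strand_act s w) u"
    unfolding strand_act_simps fox_defect_plus
    using additive_braid_aut[of "fox_defect k (strand_act s w)", OF fox_defect_strand_act_add] by simp
  moreover have "fox_defect k (braid_aut i s) u =
      (\<Sum>r = 1..<s. of_int (exp_sum r (fgen i)) * fox_defect k (braid_aut r s) u)"
    using sg_gen(1,2) by (simp add: if_distrib[of "\<lambda>x. of_int x * _"] cong: if_cong)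
  ultimately show ?case by (simp add: sg_gen.IH sum.distrib algebra_simps)
next
  case (sg_inv i w)
  have add: "fox_defect k (- braid_aut i s) (u + v) =
      fox_defect k (- braid_aut i s) u + fox_defect k (- braid_aut i s) v" for u v
    using fox_defect_strand_act_add[of k s "- fgen i"] by simp
  have "fox_defect k (- braid_aut i s) u = - fox_defect k (braid_aut i s) u"
    using fox_defect_plus[of k "braid_aut i s" "- braid_aut i s" u]
      additive_braid_aut[of "fox_defect k (- braid_aut i s)", OF add]
    by (simp add: eq_neg_iff_add_eq_0 add.commute)
  moreover have "fox_defect k (strand_act s (- fgen i + w)) u =
      fox_defect k (- braid_aut i s) u + fox_defect k (strand_act s w) u"
    unfolding strand_act_simps fox_defect_plus
    using additive_strand_act[of "fox_defect k (strand_act s w)" s "- fgen i", OF fox_defect_strand_act_add] by simp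
  moreover have "fox_defect k (braid_aut i s) u =
      (\<Sum>r = 1..<s. of_int (exp_sum r (fgen i)) * fox_defect k (braid_aut r s) u)"
    using sg_inv(1,2) by (simp add: if_distrib[of "\<lambda>x. of_int x * _"] cong: if_cong)
  ultimately show ?case by (simp add: sg_inv.IH sum_subtractf algebra_simps)
qed

lemma fox_defect_conj_act:
  assumes "\<And>s. f s \<in> strand_group s"
  shows "fox_defect k (conj_act m f) u =
    (\<Sum>s<m. \<Sum>r = 1..<s. of_int (exp_sum r (f s)) * fox_defect k (braid_aut r s) u)"
proof (induction m)
  case (Suc m)
  have "fox_defect k (strand_act m (f m)) (fg_app (conj_act m f) u) = fox_defect k (strand_act m (f m)) u"
    by (rule additive_conj_act) (rule fox_defect_strand_act_add)
  then show ?case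
    by (simp add: fox_defect_plus Suc.IH fox_defect_strand_act assms)
qed simp

text \<open>For a conjugate \<open>z x z^-1\<close> the defect is
  \<open>d z * exp_sum k x - d x * exp_sum k z\<close>. If \<open>r < i < s\<close>, then
  \<open>z\<close> is a commutator and both terms vanish.\<close>

lemma fox_defect_braid_aut:
  assumes "r < s"
  shows "fox_defect k (braid_aut r s) (fgen i) =
    (if i = r \<or> i = s then (if k = i then d (fgen r) + d (fgen s) else 0) -
       d (fgen i) * ((if k = r then 1 else 0) + (if k = s then 1 else 0)) else 0)"
proof -
  let ?z = "braid_conj r s i"
  \<comment> \<open>The product rule for the trivial word \<open>z z^-1\<close> eliminates the Fox
    derivatives of \<open>z\<close> and of its inverse.\<close>
  have "lin_ext d (fox k (?z + - ?z)) = 0" by simp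
  then have 1: "lin_ext d (fox k ?z) + lin_ext d (fox k (- ?z)) = d ?z * of_int (exp_sum k ?z)"
    by (simp only: lin_ext_fox_add) (simp add: algebra_simps)
  have "fox_defect k (braid_aut r s) (fgen i) = d ?z * of_int (exp_sum k (fgen i)) - d (fgen i) * of_int (exp_sum k ?z)"
    unfolding fox_defect_def braid_aut_fgen using 1
    by (simp only: lin_ext_fox_add d_add lin_ext_fox_fgen) (simp add: algebra_simps)
  also have "\<dots> = (if i = r \<or> i = s then (if k = i then d (fgen r) + d (fgen s) else 0) -
       d (fgen i) * ((if k = r then 1 else 0) + (if k = s then 1 else 0)) else 0)"
    using additive_uminus[of d, OF d_add] additive_zero[of d, OF d_add]
    by (simp add: braid_conj_def d_add del: add_uminus_conv_diff)
  finally show ?thesis .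
qed

end

section \<open>Linearization of the boundary maps\<close>

lemma sum_index_set:
  "(\<Sum>p\<in>index_set l n. F p) = (\<Sum>s\<in>{l<..n}. \<Sum>r = 1..<s. F (r, s))"
proof -
  have "(\<Sum>p\<in>index_set l n. F p) = (\<Sum>(s, r)\<in>Sigma {l<..n} (\<lambda>s. {1..<s}). F (r, s))"
    by (rule sum.reindex_bij_witness[where i = "\<lambda>(s, r). (r, s)" and j = "\<lambda>(r, s). (s, r)"])
      (auto simp: index_set_def)
  then show ?thesis by (simp add: sum.Sigma)
qed

text \<open>The modified direction \<open>\<lambda>'\<close>; its second summand is the linearized Jacobian of \<open>\<gamma>\<^bsub>r,s\<^esub>\<close>.\<close>

definition rho_pull :: "nat \<Rightarrow> nat \<Rightarrow> nat \<Rightarrow> (nat \<times> nat \<Rightarrow> complex) \<Rightarrow> nat \<times> nat \<Rightarrow> complex" where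
  "rho_pull m k h lam = (\<lambda>(r, s). if s < m then (if k = h then lam (r, s) else 0) +
     (if k = r \<or> k = s then (if h = k then lam (r, m) + lam (s, m) else 0) -
        lam (k, m) * ((if h = r then 1 else 0) + (if h = s then 1 else 0)) else 0) else 0)"

text \<open>The derivative of \<open>g'\<close> times its Jacobian is the character of
  \<open>g'\<close> times the augmented Jacobian, which is the identity matrix, plus the linearized
  Jacobian. Both are linear in the exponent sums of \<open>g\<close>, so the result is again a
  character, in the direction \<open>rho_pull m k h lam\<close>.\<close>

lemma lin_ext_rho:
  assumes g: "g \<in> P_ker l n" and m: "l < m" "m \<le> n" and k: "1 \<le> k" "k < m"
  shows "lin_ext (chi l n lam) (rho m g k h) = chi l n (rho_pull m k h lam) g"
proof -
  define g' where "g' = forget (m - 1) g"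
  define d where "d w = chi l n lam (strand_incl m w)" for w
  define W where "W r s = (if k = r \<or> k = s then (if h = k then lam (r, m) + lam (s, m) else 0) -
        lam (k, m) * ((if h = r then 1 else 0) + (if h = s then 1 else 0)) else 0)" for r s
  let ?u = "fg_app (conj_act m (strand g')) (fgen k)"
  have d_add: "d (u + v) = d u + d v" for u v
    by (simp add: d_def strand_incl_def chi_add)
  have d_gen: "d (fgen i) = lam (i, m)" if "1 \<le> i" "i < m" for i
    using that m by (simp add: d_def strand_incl_def chi_pgen index_set_def)
  have g'_top: "strand g' m = 0"
    using m by (auto simp: g'_def strand_forget)
  have low: "strand g s = 0" if "s \<le> l" for s
    using g that by (auto simp: mem_P_ker_iff)
  \<comment> \<open>Since \<open>g'\<close> has trivial component at \<open>m\<close>, conjugating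
    the generator amounts to applying the action of \<open>g'\<close>.\<close>
  have u: "strand (- g' + pgen k m + g') m = ?u"
    using k by (simp add: strand_add strand_uminus g'_top strand_pgen del: add_uminus_conv_diff)
  have exp_u: "exp_sum h ?u = (if k = h then 1 else 0)"
    by (simp add: exp_sum_conj_act)
  have "lin_ext (chi l n lam) (rho m g k h) =
      lin_ext (\<lambda>w. chi l n lam g' + d w) (fox h ?u)"
    unfolding rho_def fox_jacobian_def g'_def[symmetric] u
    by (simp add: lin_ext_frag_of_mult lin_ext_frag_extend chi_add d_def)
  also have "\<dots> = chi l n lam g' * of_int (exp_sum h ?u) + lin_ext d (fox h ?u)"
    using lin_ext_fun_scale[of "chi l n lam g'" "\<lambda>_. 1" "fox h ?u"]
    by (simp add: lin_ext_fun_add lin_ext_one_fox)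
  \<comment> \<open>The subtracted term of the defect is zero, because the Fox derivatives of a
    generator are constants \<open>0\<close> or \<open>1\<close>.\<close>
  also have "lin_ext d (fox h ?u) = fox_defect d h (conj_act m (strand g')) (fgen k)"
    by (simp add: fox_defect_def[OF d_add] lin_ext_fox_fgen[OF d_add] additive_zero[of d, OF d_add])
  also have "\<dots> = (\<Sum>s<m. \<Sum>r = 1..<s. of_int (exp_sum r (strand g' s)) * fox_defect d h (braid_aut r s) (fgen k))"
    by (rule fox_defect_conj_act[OF d_add]) (auto simp: strand_in_strand_group)
  also have "\<dots> = (\<Sum>s<m. \<Sum>r = 1..<s. of_int (exp_sum r (strand g s)) * W r s)"
    using k by (intro sum.cong refl) (auto simp: fox_defect_braid_aut[OF d_add] d_gen g'_def strand_forget W_def)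
  also have "\<dots> = (\<Sum>s\<in>{l<..<m}. \<Sum>r = 1..<s. of_int (exp_sum r (strand g s)) * W r s)"
    by (rule sum.mono_neutral_right) (auto simp: low)
  also have "chi l n lam g' = (\<Sum>s\<in>{l<..<m}. \<Sum>r = 1..<s. of_int (exp_sum r (strand g s)) * lam (r, s))"
    unfolding chi_def sum_index_set
    by (rule sum.mono_neutral_cong_right) (use m in \<open>auto simp: g'_def strand_forget mult.commute\<close>)
  also have "(\<Sum>s\<in>{l<..<m}. \<Sum>r = 1..<s. of_int (exp_sum r (strand g s)) * lam (r, s)) * of_int (exp_sum h ?u) +
      (\<Sum>s\<in>{l<..<m}. \<Sum>r = 1..<s. of_int (exp_sum r (strand g s)) * W r s) =
      (\<Sum>s\<in>{l<..<m}. \<Sum>r = 1..<s. of_int (exp_sum r (strand g s)) * rho_pull m k h lam (r, s))"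
    unfolding exp_u sum_distrib_right sum.distrib[symmetric]
    by (intro sum.cong refl) (simp add: rho_pull_def W_def algebra_simps)
  also have "\<dots> = chi l n (rho_pull m k h lam) g"
    unfolding chi_def sum_index_set
    by (rule sum.mono_neutral_cong_left) (use m in \<open>auto simp: rho_pull_def mult.commute\<close>)
  finally show ?thesis .
qed

lemma lin_ext_rho_ext:
  assumes "Poly_Mapping.keys x \<subseteq> P_ker l n" "l < m" "m \<le> n" "1 \<le> k" "k < m"
  shows "lin_ext (chi l n lam) (rho_ext m x k h) = lin_ext (chi l n (rho_pull m k h lam)) x"
  unfolding rho_ext_def lin_ext_frag_extend
  by (rule lin_ext_cong, rule lin_ext_rho) (use assms in auto)

lemma keys_boundary_coeff:
  assumes "set J \<subseteq> {l + 1..n}"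
  shows "Poly_Mapping.keys (boundary_coeff (I, J) (I', J')) \<subseteq> P_ker l n"
proof -
  have "Poly_Mapping.keys (Delta (drop p J) K K') \<subseteq> P_ker l n" if "p < length J" for p K K'
    using that assms by (intro keys_Delta) (auto dest: in_set_dropD)
  then show ?thesis
    unfolding boundary_coeff_def prod.case
    by (intro order_trans[OF keys_sum] UN_least) auto
qed

text \<open>Apart from the summand that removes \<open>m\<close> itself, every block
  \<open>Delta\<close> still ends in \<open>m\<close> and is therefore, by its own recursion, minus
  \<open>rho_ext m\<close> of the block for the shorter list.\<close>

lemma boundary_coeff_snoc:
  assumes "length I = length J" "length I' = length J" "length J' = length J"
  shows "boundary_coeff (I @ [k], J @ [m]) (I', J') =
    (if I' = I \<and> J' = J then frag_of (pgen k m) - 1 else 0) +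
    (if J' \<noteq> [] \<and> last J' = m
     then - rho_ext m (boundary_coeff (I, J) (butlast I', butlast J')) k (last I') else 0)"
proof -
  let ?c = "J' \<noteq> [] \<and> last J' = m"
  have "boundary_coeff (I @ [k], J @ [m]) (I', J') =
    (\<Sum>p<length J. if J' = take p J @ drop (Suc p) J @ [m] \<and> take p I' = take p I
       then Delta (drop p J @ [m]) (drop p I @ [k]) (drop p I') else 0) +
    (if J' = J \<and> I' = I then Delta [m] [k] [] else 0)"
    using assms by (simp add: boundary_coeff_def cong: sum.cong_simp conj_cong if_cong)
  also have "Delta [m] [k] [] = frag_of (pgen k m) - 1"
    by (simp add: Delta.simps)
  also have "(\<Sum>p<length J. if J' = take p J @ drop (Suc p) J @ [m] \<and> take p I' = take p I
       then Delta (drop p J @ [m]) (drop p I @ [k]) (drop p I') else 0) =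
     (\<Sum>p<length J. if ?c then - rho_ext m (if butlast J' = take p J @ drop (Suc p) J \<and>
           take p (butlast I') = take p I
         then Delta (drop p J) (drop p I) (drop p (butlast I')) else 0) k (last I') else 0)"
  proof (rule sum.cong[OF refl])
    fix p assume "p \<in> {..<length J}"
    then have p: "p < length J" by simp
    have 1: "J' = take p J @ drop (Suc p) J @ [m] \<longleftrightarrow> ?c \<and> butlast J' = take p J @ drop (Suc p) J"
      by (metis append_assoc append_butlast_last_id butlast_snoc last_snoc snoc_eq_iff_butlast)
    have 2: "take p (butlast I') = take p I'"
      using p assms by (simp add: butlast_conv_take)
    have "Delta (drop p J @ [m]) (drop p I @ [k]) (drop p I') =
       - rho_ext m (Delta (drop p J) (drop p I) (butlast (drop p I'))) k (last (drop p I'))"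
      using p by (subst Delta.simps) simp
    also have "butlast (drop p I') = drop p (butlast I')"
      by (rule butlast_drop)
    also have "last (drop p I') = last I'"
      using p assms by simp
    finally have 3: "Delta (drop p J @ [m]) (drop p I @ [k]) (drop p I') =
       - rho_ext m (Delta (drop p J) (drop p I) (drop p (butlast I'))) k (last I')" .
    show "(if J' = take p J @ drop (Suc p) J @ [m] \<and> take p I' = take p I
       then Delta (drop p J @ [m]) (drop p I @ [k]) (drop p I') else 0) =
      (if ?c then - rho_ext m (if butlast J' = take p J @ drop (Suc p) J \<and>
           take p (butlast I') = take p I
         then Delta (drop p J) (drop p I) (drop p (butlast I')) else 0) k (last I') else 0)"
      unfolding 1 2 3 by (auto simp: rho_ext_def)
  qed
  also have "\<dots> = (if ?c then - rho_ext m (boundary_coeff (I, J) (butlast I', butlast J')) k (last I') else 0)"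
    by (simp add: boundary_coeff_def rho_ext_def frag_extend_sum sum_negf)
  finally show ?thesis by (simp add: add.commute conj_commute)
qed

text \<open>Left multiplication by \<open>os_omega l n lam\<close> in the word model, read at the
  word \<open>w\<close>.\<close>

definition word_lam :: "nat \<Rightarrow> nat \<Rightarrow> (nat \<times> nat) list \<Rightarrow> (nat \<times> nat \<Rightarrow> complex) \<Rightarrow> wfun \<Rightarrow> complex" where
  "word_lam l n w lam f = (\<Sum>p\<in>index_set l n. lam p * word_op w (fst p) (snd p) f)"

text \<open>A pair that contains \<open>k\<close> is determined by its other member.\<close>

lemma sum_pairs_containing:
  fixes g :: "nat \<Rightarrow> 'a::comm_monoid_add"
  assumes "1 \<le> k" "k < m"
  shows "(\<Sum>s = 1..<m. \<Sum>r = 1..<s. (if k = r then g s else 0) + (if k = s then g r else 0)) =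
    (\<Sum>x\<in>{1..<m} - {k}. g x)"
proof -
  have "(\<Sum>s = 1..<m. \<Sum>r = 1..<s. (if k = r then g s else 0) + (if k = s then g r else 0)) =
     (\<Sum>s = 1..<m. if k < s then g s else 0) + (\<Sum>s = 1..<m. if k = s then (\<Sum>r = 1..<k. g r) else 0)"
    unfolding sum.distrib using assms
    by (intro arg_cong2[of _ _ _ _ "(+)"] sum.cong refl) auto
  also have "(\<Sum>s = 1..<m. if k < s then g s else 0) = (\<Sum>s\<in>{k<..<m}. g s)"
    by (rule sum.mono_neutral_cong_right) (use assms in auto)
  also have "(\<Sum>s = 1..<m. if k = s then (\<Sum>r = 1..<k. g r) else 0) = (\<Sum>r = 1..<k. g r)"
    using assms by simp
  also have "(\<Sum>s\<in>{k<..<m}. g s) + (\<Sum>r = 1..<k. g r) = (\<Sum>x\<in>{k<..<m} \<union> {1..<k}. g x)"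
    by (rule sum.union_disjoint[symmetric]) auto
  also have "{k<..<m} \<union> {1..<k} = {1..<m} - {k}"
    using assms by auto
  finally show ?thesis .
qed

text \<open>This is the recursion of \<open>boundary_coeff_snoc\<close> after differentiation. The
  extra terms of \<open>rho_pull\<close>, at the pairs containing \<open>k\<close>, account for the
  generators \<open>e_{x,m}\<close>, which act on the rest of the word through generators of smaller
  index.\<close>

lemma word_lam_Cons:
  assumes w: "os_word l n ((k, m) # w)"
  shows "word_lam l n ((k, m) # w) lam f = lam (k, m) * ((-1) ^ length w * f w) +
    (\<Sum>h = 1..<m. word_lam l n w (rho_pull m k h lam) (\<lambda>v. f ((h, m) # v)))"
proof -
  let ?T = "\<lambda>h x y. word_op w x y (\<lambda>v. f ((h, m) # v))"
  have km: "1 \<le> k" "k < m" "l < m" "m \<le> n" and w': "os_word l n w"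
    using w by (auto simp: os_word_def index_set_def)
  let ?L = "\<Sum>s\<in>{l<..<m}. \<Sum>r = 1..<s. lam (r, s) * ?T k r s"
  have "word_lam l n ((k, m) # w) lam f =
     (\<Sum>s\<in>{l<..<m} \<union> {m}. \<Sum>r = 1..<s. lam (r, s) * word_op ((k, m) # w) r s f)"
    unfolding word_lam_def sum_index_set
    by (rule sum.mono_neutral_cong_right) (use km in \<open>auto simp: word_op_Cons_greater intro!: sum.neutral\<close>)
  also have "\<dots> = ?L + (\<Sum>r = 1..<m. lam (r, m) * word_op ((k, m) # w) r m f)"
    by (subst sum.union_disjoint) (auto simp: word_op_Cons_less intro!: sum.cong)
  also have "(\<Sum>r = 1..<m. lam (r, m) * word_op ((k, m) # w) r m f) =
     (\<Sum>r = 1..<m. lam (r, m) * ?T k r k) +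
     (\<Sum>r = 1..<m. if k = r then lam (k, m) * ((-1) ^ length w * f w - (\<Sum>h = 1..<m. ?T h k h)) else 0)"
    unfolding sum.distrib[symmetric]
    by (rule sum.cong) (auto simp: word_op_Cons_eq algebra_simps)
  also have "(\<Sum>r = 1..<m. if k = r then lam (k, m) * ((-1) ^ length w * f w - (\<Sum>h = 1..<m. ?T h k h)) else 0) =
     lam (k, m) * ((-1) ^ length w * f w) - lam (k, m) * (\<Sum>h = 1..<m. ?T h k h)"
    using km by (simp add: algebra_simps)
  finally have lhs: "word_lam l n ((k, m) # w) lam f = ?L + ((\<Sum>r = 1..<m. lam (r, m) * ?T k r k) +
     (lam (k, m) * ((-1) ^ length w * f w) - lam (k, m) * (\<Sum>h = 1..<m. ?T h k h)))" .
  have "word_lam l n w (rho_pull m k h lam) (\<lambda>v. f ((h, m) # v)) =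
      (if h = k then ?L + (\<Sum>x = 1..<m. lam (x, m) * ?T k x k) else 0) - lam (k, m) * ?T h k h"
    if h: "1 \<le> h" "h < m" for h
  proof -
    \<comment> \<open>Contribution of the pair of \<open>k\<close> and \<open>x\<close> to row
      \<open>k\<close>: \<open>lam (x, m)\<close> in column \<open>k\<close> and
      \<open>- lam (k, m)\<close> in column \<open>x\<close>. For \<open>h = k\<close> the two
      occurrences of \<open>lam (k, m)\<close> in \<open>rho_pull\<close> cancel.\<close>
    define g where "g x = ((if h = k then lam (x, m) else 0) - (if h = x then lam (k, m) else 0)) * ?T h x k" for x
    have "word_lam l n w (rho_pull m k h lam) (\<lambda>v. f ((h, m) # v)) =
       (\<Sum>s\<in>{l<..<m}. \<Sum>r = 1..<s. rho_pull m k h lam (r, s) * ?T h r s)"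
      unfolding word_lam_def sum_index_set
      by (rule sum.mono_neutral_cong_right) (use km in \<open>auto simp: rho_pull_def\<close>)
    also have "\<dots> = (\<Sum>s\<in>{l<..<m}. \<Sum>r = 1..<s. (if h = k then lam (r, s) * ?T k r s else 0) +
         ((if k = r then g s else 0) + (if k = s then g r else 0)))"
    proof (intro sum.cong refl)
      fix s r assume "s \<in> {l<..<m}" "r \<in> {1..<s}"
      then have rs: "r < s" "s < m" by auto
      then consider "r = k" "s \<noteq> k" | "s = k" "r \<noteq> k" | "r \<noteq> k" "s \<noteq> k" by blast
      then show "rho_pull m k h lam (r, s) * ?T h r s = (if h = k then lam (r, s) * ?T k r s else 0) +
         ((if k = r then g s else 0) + (if k = s then g r else 0))"
        using rs
        by cases (cases "h = k"; simp add: rho_pull_def g_def word_op_commute[of w s k] algebra_simps)+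
    qed
    also have "\<dots> = (\<Sum>s\<in>{l<..<m}. \<Sum>r = 1..<s. if h = k then lam (r, s) * ?T k r s else 0) +
         (\<Sum>s\<in>{l<..<m}. \<Sum>r = 1..<s. (if k = r then g s else 0) + (if k = s then g r else 0))"
      by (simp only: sum.distrib)
    also have "(\<Sum>s\<in>{l<..<m}. \<Sum>r = 1..<s. if h = k then lam (r, s) * ?T k r s else 0) = (if h = k then ?L else 0)"
      by simp
    \<comment> \<open>The range may start at \<open>1\<close>, because for
      \<open>r < s \<le> l\<close> the operator vanishes on admissible words.\<close>
    also have "(\<Sum>s\<in>{l<..<m}. \<Sum>r = 1..<s. (if k = r then g s else 0) + (if k = s then g r else 0)) =
       (\<Sum>s = 1..<m. \<Sum>r = 1..<s. (if k = r then g s else 0) + (if k = s then g r else 0))"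
      by (rule sum.mono_neutral_left) (auto simp: g_def word_op_low[OF w'] intro!: sum.neutral)
    also have "\<dots> = (\<Sum>x\<in>{1..<m} - {k}. g x)"
      by (rule sum_pairs_containing[OF km(1,2)])
    also have "\<dots> = (\<Sum>x = 1..<m. g x)"
      by (rule sum.mono_neutral_left) (auto simp: g_def)
    also have "\<dots> = (if h = k then (\<Sum>x = 1..<m. lam (x, m) * ?T k x k) else 0) -
        (\<Sum>x = 1..<m. if h = x then lam (k, m) * ?T h h k else 0)"
    proof -
      have "g x = (if h = k then lam (x, m) * ?T k x k else 0) - (if h = x then lam (k, m) * ?T h h k else 0)" for x
        by (auto simp: g_def algebra_simps)
      then show ?thesis by (simp add: sum_subtractf)
    qed
    also have "(\<Sum>x = 1..<m. if h = x then lam (k, m) * ?T h h k else 0) = lam (k, m) * ?T h k h"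
      using h by (simp add: word_op_commute[of _ k])
    finally show ?thesis by simp
  qed
  then have "(\<Sum>h = 1..<m. word_lam l n w (rho_pull m k h lam) (\<lambda>v. f ((h, m) # v))) =
     (\<Sum>h = 1..<m. if h = k then ?L + (\<Sum>x = 1..<m. lam (x, m) * ?T k x k) else 0) -
     (\<Sum>h = 1..<m. lam (k, m) * ?T h k h)"
    by (simp add: sum_subtractf)
  also have "\<dots> = ?L + (\<Sum>x = 1..<m. lam (x, m) * ?T k x k) - lam (k, m) * (\<Sum>h = 1..<m. ?T h k h)"
    using km by (simp add: sum_distrib_left)
  finally show ?thesis unfolding lhs by simp
qed

section \<open>Words as indices of the resolution\<close>

definition basis_word :: "nat list \<times> nat list \<Rightarrow> (nat \<times> nat) list" where
  "basis_word b = rev (zip (fst b) (snd b))"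

lemma basis_word_snoc:
  "length I = length J \<Longrightarrow> basis_word (I @ [k], J @ [m]) = (k, m) # basis_word (I, J)"
  by (simp add: basis_word_def)

lemma length_basis: "(I, J) \<in> basis l n q \<Longrightarrow> length I = q \<and> length J = q"
  by (simp add: basis_def)

lemma bij_betw_basis_word: "bij_betw basis_word (basis l n q) {w. os_word l n w \<and> length w = q}"
proof (rule bij_betw_byWitness[where f' = "\<lambda>w. (map fst (rev w), map snd (rev w))"])
  show "\<forall>b\<in>basis l n q. (map fst (rev (basis_word b)), map snd (rev (basis_word b))) = b"
    by (auto simp: basis_word_def basis_def)
  show "\<forall>w\<in>{w. os_word l n w \<and> length w = q}. basis_word (map fst (rev w), map snd (rev w)) = w"
    by (simp add: basis_word_def zip_map_fst_snd)
  show "basis_word ` basis l n q \<subseteq> {w. os_word l n w \<and> length w = q}"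
  proof clarify
    fix I J assume b: "(I, J) \<in> basis l n q"
    then have "sorted_wrt (<) (map snd (zip I J))" by (simp add: basis_def)
    then have "sorted_wrt (\<lambda>p q. snd q < snd p) (rev (zip I J))"
      by (simp add: sorted_wrt_map sorted_wrt_rev)
    moreover have "set (zip I J) \<subseteq> index_set l n"
    proof -
      have "J ! p \<in> {l + 1..n}" if "p < q" for p
        using b that by (auto simp: basis_def dest: subsetD[OF _ nth_mem])
      then show ?thesis
        using b by (fastforce simp: basis_def index_set_def set_zip)
    qed
    ultimately show "os_word l n (basis_word (I, J)) \<and> length (basis_word (I, J)) = q"
      using b by (simp add: os_word_def basis_word_def basis_def)
  qed
  show "(\<lambda>w. (map fst (rev w), map snd (rev w))) ` {w. os_word l n w \<and> length w = q} \<subseteq> basis l n q"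
  proof clarify
    fix w assume w: "os_word l n w" "q = length w"
    have "sorted_wrt (\<lambda>p q. snd p < snd q) (rev w)"
      using w by (simp add: os_word_def sorted_wrt_rev)
    then have "sorted_wrt (<) (map snd (rev w))" by (simp add: sorted_wrt_map)
    moreover have "fst (rev w ! p) \<ge> 1 \<and> fst (rev w ! p) < snd (rev w ! p)" if "p < length w" for p
    proof -
      have "rev w ! p \<in> index_set l n"
        using that w nth_mem[of p "rev w"] by (auto simp: os_word_def)
      then show ?thesis by (auto simp: index_set_def)
    qed
    moreover have "snd ` set w \<subseteq> {l + 1..n}"
      using w by (fastforce simp: os_word_def index_set_def)
    ultimately show "(map fst (rev w), map snd (rev w)) \<in> basis l n (length w)"
      by (simp add: basis_def)
  qed
qed

lemma basis_SucE:
  assumes "(I, J) \<in> basis l n (Suc q)"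
  obtains I0 k J0 m where "I = I0 @ [k]" "J = J0 @ [m]" "(I0, J0) \<in> basis l n q"
    "1 \<le> k" "k < m" "l < m" "m \<le> n"
proof -
  have len: "length I = Suc q" "length J = Suc q" using assms by (auto simp: basis_def)
  then obtain I0 k J0 m where e: "I = I0 @ [k]" "J = J0 @ [m]"
    by (metis length_Suc_conv_rev)
  have nth: "\<And>p. p < Suc q \<Longrightarrow> 1 \<le> I ! p \<and> I ! p < J ! p"
    using assms by (auto simp: basis_def)
  have "1 \<le> I0 ! p \<and> I0 ! p < J0 ! p" if "p < q" for p
    using nth[of p] that len e by (simp add: nth_append)
  then have "(I0, J0) \<in> basis l n q"
    using assms len e by (auto simp: basis_def sorted_wrt_append)
  moreover have "1 \<le> k" "k < m" using nth[of q] len e by (auto simp: nth_append)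
  moreover have "l < m" "m \<le> n" using assms e by (auto simp: basis_def)
  ultimately show ?thesis using that e by blast
qed

text \<open>Both sides satisfy the same recursion in the last element of \<open>J\<close>. The
  direction stays arbitrary in the induction, since the step passes from \<open>lam\<close> to
  \<open>rho_pull m k h lam\<close>; the factor \<open>(-1) ^ q\<close> of the coboundary absorbs
  the minus sign in the recursion of \<open>Delta\<close>.\<close>

lemma boundary_coeff_word:
  assumes "(I, J) \<in> basis l n (Suc q)" "(I', J') \<in> basis l n q"
  shows "(-1) ^ q * lin_ext (chi l n lam) (boundary_coeff (I, J) (I', J')) =
    word_lam l n (basis_word (I, J)) lam (\<lambda>v. if v = basis_word (I', J') then 1 else 0)"
  using assms
proof (induction q arbitrary: lam I J I' J')
  case (0 lam I J I' J')
  then obtain k m where e: "I = [k]" "J = [m]" and k: "1 \<le> k" "k < m" "l < m" "m \<le> n"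
    by (elim basis_SucE) (auto simp: basis_def)
  have e': "I' = []" "J' = []" using 0 by (auto simp: basis_def)
  have "os_word l n [(k, m)]" using k by (simp add: os_word_def index_set_def)
  then have "word_lam l n (basis_word (I, J)) lam (\<lambda>v. if v = basis_word (I', J') then 1 else 0) = lam (k, m)"
    by (simp add: e e' basis_word_def word_lam_Cons) (simp add: word_lam_def)
  moreover have "(k, m) \<in> index_set l n" using k by (simp add: index_set_def)
  ultimately show ?case
    using boundary_coeff_snoc[of "[]" "[]" "[]" "[]" k m]
    by (simp add: e e' lin_ext_diff chi_pgen)
next
  case (Suc q lam I J I' J')
  obtain I0 k J0 m where e: "I = I0 @ [k]" "J = J0 @ [m]" and b0: "(I0, J0) \<in> basis l n (Suc q)"
    and k: "1 \<le> k" "k < m" "l < m" "m \<le> n"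
    using Suc.prems(1) by (rule basis_SucE)
  obtain I1 h J1 m' where e': "I' = I1 @ [h]" "J' = J1 @ [m']" and b1: "(I1, J1) \<in> basis l n q"
    and h: "1 \<le> h" "h < m'"
    using Suc.prems(2) by (rule basis_SucE)
  note len = length_basis[OF b0] length_basis[OF b1]
  have km: "(k, m) \<in> index_set l n" using k by (simp add: index_set_def)
  have J0: "set J0 \<subseteq> {l + 1..n}" using b0 by (simp add: basis_def)
  have word: "os_word l n ((k, m) # basis_word (I0, J0))" and len0: "length (basis_word (I0, J0)) = Suc q"
    using bij_betwE[OF bij_betw_basis_word] Suc.prems(1) b0 len by (force simp: e basis_word_snoc)+
  have eq: "basis_word (I0, J0) = basis_word (I', J') \<longleftrightarrow> I' = I0 \<and> J' = J0"
    using bij_betw_imp_inj_on[OF bij_betw_basis_word[of l n "Suc q"]] b0 Suc.prems(2)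
    by (auto dest: inj_onD)
  have w': "basis_word (I', J') = (h, m') # basis_word (I1, J1)"
    using len by (simp add: e' basis_word_snoc)
  have lhs: "lin_ext (chi l n lam) (boundary_coeff (I, J) (I', J')) =
     (if I' = I0 \<and> J' = J0 then lam (k, m) else 0) -
     (if m' = m then lin_ext (chi l n (rho_pull m k h lam)) (boundary_coeff (I0, J0) (I1, J1)) else 0)"
  proof -
    have "boundary_coeff (I, J) (I', J') =
      (if I' = I0 \<and> J' = J0 then frag_of (pgen k m) - 1 else 0) +
      (if m' = m then - rho_ext m (boundary_coeff (I0, J0) (I1, J1)) k h else 0)"
      using boundary_coeff_snoc[of I0 J0 I' J' k m] len by (simp add: e e')
    then show ?thesis
      by (simp add: lin_ext_add lin_ext_diff lin_ext_uminus chi_pgen km if_distrib[of "lin_ext _"]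
          lin_ext_rho_ext[OF keys_boundary_coeff[OF J0] k(3,4,1,2)])
  qed
  have "(\<Sum>h' = 1..<m. word_lam l n (basis_word (I0, J0)) (rho_pull m k h' lam)
       (\<lambda>v. if (h', m) # v = basis_word (I', J') then 1 else 0)) =
     (\<Sum>h' = 1..<m. if h' = h then if m' = m then word_lam l n (basis_word (I0, J0)) (rho_pull m k h lam)
       (\<lambda>v. if v = basis_word (I1, J1) then 1 else 0) else 0 else 0)"
    by (intro sum.cong refl) (auto simp: w' word_lam_def)
  also have "\<dots> = (if m' = m then word_lam l n (basis_word (I0, J0)) (rho_pull m k h lam)
       (\<lambda>v. if v = basis_word (I1, J1) then 1 else 0) else 0)"
    using h by auto
  also have "\<dots> = (if m' = m then (-1) ^ q * lin_ext (chi l n (rho_pull m k h lam)) (boundary_coeff (I0, J0) (I1, J1)) else 0)"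
    using Suc.IH[OF b0 b1] by simp
  finally have rhs: "(\<Sum>h' = 1..<m. word_lam l n (basis_word (I0, J0)) (rho_pull m k h' lam)
       (\<lambda>v. if (h', m) # v = basis_word (I', J') then 1 else 0)) = \<dots>" .
  have w: "basis_word (I, J) = (k, m) # basis_word (I0, J0)" using len by (simp add: e basis_word_snoc)
  show ?case
    unfolding lhs w word_lam_Cons[OF word] rhs eq len0 by (simp add: algebra_simps)
qed

section \<open>The linearized cochain complex\<close>

text \<open>Only the values of \<open>f\<close> at admissible words of length \<open>q\<close>
  enter; this lets one function on all words represent a cochain in every degree.\<close>

definition word_cochain :: "nat \<Rightarrow> nat \<Rightarrow> nat \<Rightarrow> wfun \<Rightarrow> chain \<Rightarrow> complex" where
  "word_cochain l n q f = (\<lambda>x. if x \<in> chain_space l n q then \<Sum>b\<in>basis l n q. x b * f (basis_word b) else 0)"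

lemma chain_space_add: "x \<in> chain_space l n q \<Longrightarrow> y \<in> chain_space l n q \<Longrightarrow> (\<lambda>b. x b + y b) \<in> chain_space l n q"
  by (simp add: chain_space_def)

lemma chain_space_scale: "x \<in> chain_space l n q \<Longrightarrow> (\<lambda>b. c * x b) \<in> chain_space l n q"
  by (simp add: chain_space_def)

lemma chain_space_unit: "b \<in> basis l n q \<Longrightarrow> (\<lambda>b'. if b' = b then 1 else 0) \<in> chain_space l n q"
  by (auto simp: chain_space_def)

lemma boundary_chain_space: "boundary l n (Suc q) t x \<in> chain_space l n q"
  by (simp add: boundary_def chain_space_def)

lemma word_cochain_space: "word_cochain l n q f \<in> cochain_space l n q"
  by (auto simp: cochain_space_def word_cochain_def chain_space_add chain_space_scale
      algebra_simps sum.distrib sum_distrib_left)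

lemma word_cochain_unit:
  "b \<in> basis l n q \<Longrightarrow> word_cochain l n q f (\<lambda>b'. if b' = b then 1 else 0) = f (basis_word b)"
  by (simp add: word_cochain_def chain_space_unit finite_basis if_distrib[of "\<lambda>x. x * _"] cong: if_cong)

lemma word_cochain_add: "word_cochain l n q (\<lambda>w. f w + g w) = (\<lambda>x. word_cochain l n q f x + word_cochain l n q g x)"
  by (auto simp: word_cochain_def algebra_simps sum.distrib)

lemma word_cochain_scale: "word_cochain l n q (\<lambda>w. c * f w) = (\<lambda>x. c * word_cochain l n q f x)"
  by (auto simp: word_cochain_def algebra_simps sum_distrib_left)

lemma word_cochain_eq_iff:
  "word_cochain l n q f = word_cochain l n q g \<longleftrightarrow> (\<forall>w. os_word l n w \<and> length w = q \<longrightarrow> f w = g w)"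
proof -
  have w: "basis_word ` basis l n q = {w. os_word l n w \<and> length w = q}"
    by (rule bij_betw_imp_surj_on[OF bij_betw_basis_word])
  have "word_cochain l n q f = word_cochain l n q g \<longleftrightarrow> (\<forall>b\<in>basis l n q. f (basis_word b) = g (basis_word b))"
  proof
    assume "word_cochain l n q f = word_cochain l n q g"
    then show "\<forall>b\<in>basis l n q. f (basis_word b) = g (basis_word b)"
      using word_cochain_unit by metis
  qed (simp add: word_cochain_def fun_eq_iff)
  also have "\<dots> \<longleftrightarrow> (\<forall>w\<in>basis_word ` basis l n q. f w = g w)" by blast
  finally show ?thesis unfolding w by blast
qed

lemma ex_word_cochain:
  assumes "u \<in> cochain_space l n q"
  shows "\<exists>f. u = word_cochain l n q f"
proof
  let ?e = "\<lambda>b b'. if b' = b then 1 else 0 :: complex"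
  let ?f = "\<lambda>w. u (?e (inv_into (basis l n q) basis_word w))"
  show "u = word_cochain l n q ?f"
  proof
    fix x
    show "u x = word_cochain l n q ?f x"
    proof (cases "x \<in> chain_space l n q")
      case True
      have "x b' = (\<Sum>b\<in>basis l n q. x b * ?e b b')" for b'
      proof -
        have "(\<Sum>b\<in>basis l n q. x b * ?e b b') = (\<Sum>b\<in>basis l n q. if b' = b then x b else 0)"
          by (rule sum.cong) auto
        moreover have "x b' = 0" if "b' \<notin> basis l n q"
          using True that unfolding chain_space_def by blast
        ultimately show ?thesis by (simp add: finite_basis)
      qed
      then have "u x = u (\<lambda>b'. \<Sum>b\<in>basis l n q. x b * ?e b b')"
        by (intro arg_cong[of _ _ u] ext)
      also have "\<dots> = (\<Sum>b\<in>basis l n q. x b * u (?e b))"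
        by (rule cochain_sum[OF assms finite_basis chain_space_unit])
      also have "\<dots> = word_cochain l n q ?f x"
        using True bij_betw_imp_inj_on[OF bij_betw_basis_word[of l n q]]
        by (simp add: word_cochain_def)
      finally show ?thesis .
    next
      case False
      then show ?thesis using assms by (simp add: cochain_space_def word_cochain_def)
    qed
  qed
qed

text \<open>The function \<open>f\<close> is expanded in indicators of words. The expansion agrees
  with \<open>f\<close> on admissible words of length \<open>q\<close>, and these are the only ones
  that \<open>word_op\<close> reads at \<open>basis_word b\<close>.\<close>

lemma word_lam_basis:
  assumes "b \<in> basis l n (Suc q)"
  shows "(\<Sum>b'\<in>basis l n q. f (basis_word b') * ((-1) ^ q * lin_ext (chi l n lam) (boundary_coeff b b'))) =
     word_lam l n (basis_word b) lam f"
proof -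
  let ?w = "basis_word b" and ?e = "\<lambda>b' v. if v = basis_word b' then 1 else 0"
  have w: "os_word l n ?w" "length ?w = Suc q"
    using bij_betwE[OF bij_betw_basis_word] assms by blast+
  have "(\<Sum>b'\<in>basis l n q. f (basis_word b') * ((-1) ^ q * lin_ext (chi l n lam) (boundary_coeff b b'))) =
     (\<Sum>b'\<in>basis l n q. f (basis_word b') * word_lam l n ?w lam (?e b'))"
    by (rule sum.cong[OF refl], cases b) (use assms boundary_coeff_word in auto)
  also have "\<dots> = word_lam l n ?w lam (\<lambda>v. \<Sum>b'\<in>basis l n q. f (basis_word b') * ?e b' v)"
    unfolding word_lam_def word_op_sum word_op_scale sum_distrib_left
    by (subst sum.swap) (simp add: mult_ac)
  also have "\<dots> = word_lam l n ?w lam f"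
    unfolding word_lam_def
  proof (intro sum.cong refl arg_cong2[of _ _ _ _ "(*)"] word_op_cong[OF _ w(1)])
    fix v assume v: "os_word l n v" "Suc (length v) = length ?w"
    then have "v \<in> basis_word ` basis l n q"
      unfolding bij_betw_imp_surj_on[OF bij_betw_basis_word] using w(2) by simp
    then obtain b0 where b0: "b0 \<in> basis l n q" "v = basis_word b0" by blast
    have "(\<Sum>b'\<in>basis l n q. f (basis_word b') * ?e b' v) = (\<Sum>b'\<in>basis l n q. if b' = b0 then f v else 0)"
      using b0 inj_onD[OF bij_betw_imp_inj_on[OF bij_betw_basis_word[of l n q]]]
      by (intro sum.cong) auto
    then show "(\<Sum>b'\<in>basis l n q. f (basis_word b') * ?e b' v) = f v"
      using b0 by (simp add: finite_basis)
  qed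
  finally show ?thesis .
qed

lemma coboundary_deriv_word_cochain:
  "coboundary_deriv l n q lam (word_cochain l n q f) = word_cochain l n (Suc q) (\<lambda>w. word_lam l n w lam f)"
proof
  fix x
  show "coboundary_deriv l n q lam (word_cochain l n q f) x = word_cochain l n (Suc q) (\<lambda>w. word_lam l n w lam f) x"
  proof (cases "x \<in> chain_space l n (Suc q)")
    case True
    have "coboundary l n q t (word_cochain l n q f) x =
       (-1) ^ q * (\<Sum>b'\<in>basis l n q. (\<Sum>b\<in>basis l n (Suc q). x b * ring_eval l n t (boundary_coeff b b')) * f (basis_word b'))"
      for t
      using True by (simp add: coboundary_def word_cochain_def boundary_chain_space) (simp add: boundary_def)
    then have "coboundary_deriv l n q lam (word_cochain l n q f) x =
       deriv (\<lambda>s. (-1) ^ q * (\<Sum>b'\<in>basis l n q. (\<Sum>b\<in>basis l n (Suc q).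
          x b * ring_eval l n (\<lambda>p. exp (s * lam p)) (boundary_coeff b b')) * f (basis_word b'))) 0"
      unfolding coboundary_deriv_def by simp
    also have "\<dots> = (-1) ^ q * (\<Sum>b'\<in>basis l n q. (\<Sum>b\<in>basis l n (Suc q).
          x b * lin_ext (chi l n lam) (boundary_coeff b b')) * f (basis_word b'))"
      by (intro DERIV_imp_deriv DERIV_cmult DERIV_sum DERIV_cmult_right ring_eval_has_derivative)
    also have "\<dots> = (\<Sum>b\<in>basis l n (Suc q). x b * (\<Sum>b'\<in>basis l n q. f (basis_word b') *
          ((-1) ^ q * lin_ext (chi l n lam) (boundary_coeff b b'))))"
      unfolding sum_distrib_left sum_distrib_right by (subst sum.swap) (simp add: mult_ac)
    also have "\<dots> = word_cochain l n (Suc q) (\<lambda>w. word_lam l n w lam f) x"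
      using True by (simp add: word_cochain_def word_lam_basis)
    finally show ?thesis .
  next
    case False
    then show ?thesis by (simp add: coboundary_deriv_def coboundary_def word_cochain_def)
  qed
qed

text \<open>The square of omega is a double sum whose terms change sign when the two generators are
  exchanged.\<close>

lemma word_lam_word_lam:
  assumes "os_word l n w"
  shows "word_lam l n w lam (\<lambda>v. word_lam l n v lam f) = 0"
proof -
  let ?S = "index_set l n"
  let ?t = "\<lambda>p q. lam p * lam q * word_op w (fst p) (snd p) (\<lambda>v. word_op v (fst q) (snd q) f)"
  have "word_anticomm w" using assms word_relations unfolding os_word_def by blast
  have anti: "?t p q = - ?t q p" for p q
  proof -
    have "word_op w (fst p) (snd p) (\<lambda>v. word_op v (fst q) (snd q) f) =
        - word_op w (fst q) (snd q) (\<lambda>v. word_op v (fst p) (snd p) f)"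
      using \<open>word_anticomm w\<close> unfolding word_anticomm_def by blast
    then show ?thesis by simp
  qed
  have "word_lam l n w lam (\<lambda>v. word_lam l n v lam f) = (\<Sum>p\<in>?S. \<Sum>q\<in>?S. ?t p q)"
    unfolding word_lam_def word_op_sum word_op_scale sum_distrib_left by (simp add: mult_ac)
  moreover have "(\<Sum>p\<in>?S. \<Sum>q\<in>?S. ?t p q) = - (\<Sum>p\<in>?S. \<Sum>q\<in>?S. ?t p q)"
  proof -
    have "(\<Sum>p\<in>?S. \<Sum>q\<in>?S. ?t p q) = (\<Sum>p\<in>?S. \<Sum>q\<in>?S. - ?t q p)"
      by (intro sum.cong refl anti)
    also have "\<dots> = - (\<Sum>q\<in>?S. \<Sum>p\<in>?S. ?t q p)"
      by (subst sum.swap) (simp add: sum_negf)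
    finally show ?thesis .
  qed
  ultimately show ?thesis by simp
qed

lemma word_lam_add: "word_lam l n w lam (\<lambda>v. f v + g v) = word_lam l n w lam f + word_lam l n w lam g"
  by (simp add: word_lam_def word_op_add sum.distrib algebra_simps)

lemma word_lam_scale: "word_lam l n w lam (\<lambda>v. c * f v) = c * word_lam l n w lam f"
  by (simp add: word_lam_def word_op_scale sum_distrib_left algebra_simps)

lemma cochain_linear_coboundary_deriv: "cochain_linear l n q (Suc q) (coboundary_deriv l n q lam)"
  unfolding cochain_linear_def
proof (intro conjI ballI allI)
  fix u v c assume "u \<in> cochain_space l n q"
  then obtain f where u: "u = word_cochain l n q f" using ex_word_cochain by blast
  show "coboundary_deriv l n q lam u \<in> cochain_space l n (Suc q)"
    unfolding u coboundary_deriv_word_cochain by (rule word_cochain_space)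
  show "coboundary_deriv l n q lam (\<lambda>x. c * u x) = (\<lambda>x. c * coboundary_deriv l n q lam u x)"
    unfolding u word_cochain_scale[symmetric] coboundary_deriv_word_cochain word_lam_scale ..
  assume "v \<in> cochain_space l n q"
  then obtain g where v: "v = word_cochain l n q g" using ex_word_cochain by blast
  show "coboundary_deriv l n q lam (\<lambda>x. u x + v x) = (\<lambda>x. coboundary_deriv l n q lam u x + coboundary_deriv l n q lam v x)"
    unfolding u v word_cochain_add[symmetric] coboundary_deriv_word_cochain word_lam_add ..
qed

lemma coboundary_deriv_square:
  assumes "u \<in> cochain_space l n q"
  shows "coboundary_deriv l n (Suc q) lam (coboundary_deriv l n q lam u) = (\<lambda>_. 0)"
proof -
  obtain f where u: "u = word_cochain l n q f" using ex_word_cochain[OF assms] by blast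
  have "word_cochain l n (Suc (Suc q)) (\<lambda>w. word_lam l n w lam (\<lambda>v. word_lam l n v lam f)) =
     word_cochain l n (Suc (Suc q)) (\<lambda>w. 0)"
    unfolding word_cochain_eq_iff using word_lam_word_lam by blast
  also have "\<dots> = (\<lambda>_. 0)" by (simp add: word_cochain_def fun_eq_iff)
  finally show ?thesis unfolding u coboundary_deriv_word_cochain .
qed

section \<open>A basis of the Orlik-Solomon algebra\<close>

lemma exterior_carrier_iff: "x \<in> carrier (exterior_algebra S) \<longleftrightarrow> (\<forall>K. \<not> K \<subseteq> S \<longrightarrow> x K = 0)"
  by (auto simp: exterior_algebra_def)

lemma exterior_ops:
  "x \<otimes>\<^bsub>exterior_algebra S\<^esub> y = wedge x y" "x \<oplus>\<^bsub>exterior_algebra S\<^esub> y = (\<lambda>K. x K + y K)"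
  "\<one>\<^bsub>exterior_algebra S\<^esub> = ext_monom {}" "\<zero>\<^bsub>exterior_algebra S\<^esub> = (\<lambda>_. 0)"
  by (simp_all add: exterior_algebra_def)

lemma wedge_scale: "wedge (\<lambda>K. c * x K) y = (\<lambda>K. c * wedge x y K)" "wedge x (\<lambda>K. c * y K) = (\<lambda>K. c * wedge x y K)"
  by (simp_all add: wedge_def fun_eq_iff sum_distrib_left mult_ac)

lemma wedge_ext_monom_gen:
  assumes "finite L" "\<And>q. q \<in> L \<Longrightarrow> gen_less q p"
  shows "wedge (ext_monom L) (ext_gen p) = ext_monom (insert p L)"
proof
  fix K
  have p: "p \<notin> L" using assms(2) gen_less_irrefl by blast
  have s: "shuffle_sign L {p} = 1"
  proof -
    have "{(a, b). a \<in> L \<and> b \<in> {p} \<and> gen_less b a} = {}"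
      using assms(2) gen_less_asym by blast
    then show ?thesis unfolding shuffle_sign_def by (simp only: card.empty power_0)
  qed
  show "wedge (ext_monom L) (ext_gen p) K = ext_monom (insert p L) K"
  proof (cases "K = insert p L")
    case True
    have "wedge (ext_monom L) (ext_gen p) K = (\<Sum>M\<in>Pow K. if M = L then shuffle_sign L {p} else 0)"
      unfolding wedge_def
      by (rule sum.cong) (use True p in \<open>auto simp: ext_monom_def ext_gen_def\<close>)
    then show ?thesis using True assms(1) s by (auto simp: ext_monom_def)
  next
    case False
    then have "ext_monom L M = 0 \<or> ext_gen p (K - M) = 0" if "M \<subseteq> K" for M
      using that by (auto simp: ext_monom_def ext_gen_def)
    then show ?thesis
      using False unfolding wedge_def by (subst sum.neutral) (auto simp: ext_monom_def)
  qed
qed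

context
  fixes l n :: nat
begin

abbreviation "os_E \<equiv> exterior_algebra (index_set l n)"
abbreviation "os_A \<equiv> os_algebra l n"

lemma os_class_hom: "os_class l n \<in> ring_hom os_E os_A"
  using ideal.rcos_ring_hom[OF ideal_os_ideal[of l n]]
  by (simp add: os_algebra_def os_class_def[abs_def])

lemma os_class_closed: "x \<in> carrier os_E \<Longrightarrow> os_class l n x \<in> carrier os_A"
  by (rule ring_hom_closed[OF os_class_hom])

lemma os_class_wedge:
  "x \<in> carrier os_E \<Longrightarrow> y \<in> carrier os_E \<Longrightarrow> os_class l n x \<otimes>\<^bsub>os_A\<^esub> os_class l n y = os_class l n (wedge x y)"
  using ring_hom_mult[OF os_class_hom] by (simp add: exterior_ops)

lemma os_class_add:
  "x \<in> carrier os_E \<Longrightarrow> y \<in> carrier os_E \<Longrightarrow> os_class l n x \<oplus>\<^bsub>os_A\<^esub> os_class l n y = os_class l n (\<lambda>K. x K + y K)"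
  using ring_hom_add[OF os_class_hom] by (simp add: exterior_ops)

lemma os_class_one: "\<one>\<^bsub>os_A\<^esub> = os_class l n (ext_monom {})"
  using ring_hom_one[OF os_class_hom] by (simp add: exterior_ops)

lemma os_class_zero: "\<zero>\<^bsub>os_A\<^esub> = os_class l n (\<lambda>_. 0)"
  using ring_hom_zero[OF os_class_hom ring_exterior_algebra[OF finite_index_set] ring_os_algebra]
  by (simp add: exterior_ops)

lemma os_carrierE:
  assumes "a \<in> carrier os_A"
  obtains x where "x \<in> carrier os_E" "a = os_class l n x"
  using assms that unfolding os_algebra_def FactRing_def A_RCOSETS_def' os_class_def by auto

lemma ext_carrier_add: "x \<in> carrier os_E \<Longrightarrow> y \<in> carrier os_E \<Longrightarrow> (\<lambda>K. x K + y K) \<in> carrier os_E"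
  by (simp add: exterior_carrier_iff)

lemma ext_carrier_scale: "x \<in> carrier os_E \<Longrightarrow> (\<lambda>K. c * x K) \<in> carrier os_E"
  by (simp add: exterior_carrier_iff)

lemma ext_carrier_sum: "(\<And>i. i \<in> I \<Longrightarrow> x i \<in> carrier os_E) \<Longrightarrow> (\<lambda>K. \<Sum>i\<in>I. x i K) \<in> carrier os_E"
  by (simp add: exterior_carrier_iff)

lemma ext_carrier_zero: "(\<lambda>_. 0) \<in> carrier os_E"
  by (simp add: exterior_carrier_iff)

lemma ext_monom_carrier: "K \<subseteq> index_set l n \<Longrightarrow> ext_monom K \<in> carrier os_E"
  by (auto simp: exterior_carrier_iff ext_monom_def)

lemmas ext_carrier = ext_carrier_add ext_carrier_scale ext_carrier_zero wedge_carrier ext_gen_carrier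

lemma os_scale_class:
  assumes "x \<in> carrier os_E"
  shows "os_scale l n c (os_class l n x) = os_class l n (\<lambda>K. c * x K)"
proof -
  have "wedge (\<lambda>K. c * ext_monom {} K) x = (\<lambda>K. c * x K)"
  proof
    fix K
    show "wedge (\<lambda>K. c * ext_monom {} K) x K = c * x K"
    proof (cases "K \<subseteq> index_set l n")
      case True
      then have "finite K" using finite_index_set finite_subset by blast
      then show ?thesis by (simp add: wedge_scale wedge_one)
    next
      case False
      have "wedge (\<lambda>K. c * ext_monom {} K) x \<in> carrier os_E"
        using assms by (intro wedge_carrier ext_carrier_scale ext_monom_carrier) simp_all
      then show ?thesis using False assms by (simp add: exterior_carrier_iff)
    qed
  qed
  then show ?thesis
    using assms by (simp add: os_scale_def os_class_wedge ext_carrier_scale ext_monom_carrier)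
qed

lemma os_scale_closed: "a \<in> carrier os_A \<Longrightarrow> os_scale l n c a \<in> carrier os_A"
  by (elim os_carrierE) (simp add: os_scale_class os_class_closed ext_carrier_scale)

lemma os_scale_mult:
  assumes "a \<in> carrier os_A" "b \<in> carrier os_A"
  shows "os_scale l n c a \<otimes>\<^bsub>os_A\<^esub> b = os_scale l n c (a \<otimes>\<^bsub>os_A\<^esub> b)"
    "a \<otimes>\<^bsub>os_A\<^esub> os_scale l n c b = os_scale l n c (a \<otimes>\<^bsub>os_A\<^esub> b)"
  using assms
  by (auto elim!: os_carrierE simp: os_scale_class os_class_wedge wedge_carrier ext_carrier_scale wedge_scale)

lemma os_scale_add:
  assumes "a \<in> carrier os_A" "b \<in> carrier os_A"
  shows "os_scale l n c (a \<oplus>\<^bsub>os_A\<^esub> b) = os_scale l n c a \<oplus>\<^bsub>os_A\<^esub> os_scale l n c b"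
  using assms
  by (auto elim!: os_carrierE simp: os_scale_class os_class_add ext_carrier_add ext_carrier_scale algebra_simps)

lemma os_scale_scale: "a \<in> carrier os_A \<Longrightarrow> os_scale l n c (os_scale l n d a) = os_scale l n (c * d) a"
  by (elim os_carrierE) (simp add: os_scale_class ext_carrier_scale mult.assoc)

lemma os_scale_one: "a \<in> carrier os_A \<Longrightarrow> os_scale l n 1 a = a"
  by (elim os_carrierE) (simp add: os_scale_class)

lemma os_gen_closed: "p \<in> index_set l n \<Longrightarrow> os_gen l n p \<in> carrier os_A"
  by (simp add: os_gen_def os_class_closed ext_gen_carrier)

lemma os_gen_anticommute:
  assumes "p \<in> index_set l n" "q \<in> index_set l n"
  shows "os_gen l n p \<otimes>\<^bsub>os_A\<^esub> os_gen l n q = os_scale l n (-1) (os_gen l n q \<otimes>\<^bsub>os_A\<^esub> os_gen l n p)"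
  using assms wedge_ext_gen(2)[of p q]
  by (simp add: os_gen_def os_class_wedge os_scale_class ext_carrier)

lemma os_gen_square: "p \<in> index_set l n \<Longrightarrow> os_gen l n p \<otimes>\<^bsub>os_A\<^esub> os_gen l n p = \<zero>\<^bsub>os_A\<^esub>"
  by (simp add: os_gen_def os_class_wedge ext_carrier wedge_ext_gen(1) os_class_zero)

lemma os_class_relation:
  assumes "r \<in> os_relations l n"
  shows "os_class l n r = \<zero>\<^bsub>os_A\<^esub>"
proof -
  interpret ideal "os_ideal l n" os_E by (rule ideal_os_ideal)
  have "r \<in> os_ideal l n"
    using assms genideal_self[OF os_relations_carrier] unfolding os_ideal_def by blast
  then show ?thesis
    by (simp add: os_class_def os_algebra_def FactRing_def a_rcos_const)
qed

lemma os_gen_mult_low: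
  assumes "(h, m) \<in> index_set l n" "(k, m) \<in> index_set l n" "h \<le> l" "k \<le> l"
  shows "os_gen l n (h, m) \<otimes>\<^bsub>os_A\<^esub> os_gen l n (k, m) = \<zero>\<^bsub>os_A\<^esub>"
proof -
  interpret ring os_A by (rule ring_os_algebra)
  have lt: "os_gen l n (i, m) \<otimes>\<^bsub>os_A\<^esub> os_gen l n (j, m) = \<zero>\<^bsub>os_A\<^esub>"
    if "(i, m) \<in> index_set l n" "(j, m) \<in> index_set l n" "i < j" "j \<le> l" for i j
  proof -
    have "wedge (ext_gen (i, m)) (ext_gen (j, m)) \<in> os_relations l n"
      using that unfolding os_relations_def index_set_def by blast
    from os_class_relation[OF this] show ?thesis
      using that by (simp add: os_gen_def os_class_wedge ext_carrier)
  qed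
  have z: "os_scale l n c \<zero>\<^bsub>os_A\<^esub> = \<zero>\<^bsub>os_A\<^esub>" for c
    by (simp add: os_class_zero os_scale_class ext_carrier)
  consider "h = k" | "h < k" | "k < h" by linarith
  then show ?thesis
    using assms lt os_gen_square os_gen_anticommute[OF assms(1,2)] z by cases auto
qed

text \<open>The three-term relation is solved for the product of two generators with the same top
  index; each new product has only one factor with index \<open>m\<close>. Exchanging
  \<open>h\<close> and \<open>k\<close> keeps the shape, because the sign from anticommuting the
  factors cancels that of the difference.\<close>

lemma os_gen_mult_high:
  assumes "(h, m) \<in> index_set l n" "(k, m) \<in> index_set l n" "h \<noteq> k" "l < max h k"
  defines "u \<equiv> os_gen l n (min h k, max h k)"
  shows "os_gen l n (h, m) \<otimes>\<^bsub>os_A\<^esub> os_gen l n (k, m) =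
    u \<otimes>\<^bsub>os_A\<^esub> os_gen l n (k, m) \<oplus>\<^bsub>os_A\<^esub> os_scale l n (-1) (u \<otimes>\<^bsub>os_A\<^esub> os_gen l n (h, m))"
proof -
  interpret ring os_A by (rule ring_os_algebra)
  let ?g = "os_gen l n"
  have lt: "?g (i, m) \<otimes>\<^bsub>os_A\<^esub> ?g (j, m) =
    ?g (i, j) \<otimes>\<^bsub>os_A\<^esub> ?g (j, m) \<oplus>\<^bsub>os_A\<^esub> os_scale l n (-1) (?g (i, j) \<otimes>\<^bsub>os_A\<^esub> ?g (i, m))"
    if ij: "(i, m) \<in> index_set l n" "(j, m) \<in> index_set l n" "i < j" "l < j" for i j
  proof -
    let ?W1 = "wedge (ext_gen (i, j)) (ext_gen (i, m))" and ?W2 = "wedge (ext_gen (i, j)) (ext_gen (j, m))"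
      and ?W3 = "wedge (ext_gen (i, m)) (ext_gen (j, m))"
    have idx: "(i, j) \<in> index_set l n" using ij by (auto simp: index_set_def)
    have "1 \<le> i \<and> i < j \<and> j < m \<and> m \<le> n \<and> l + 1 \<le> j"
      using ij by (auto simp: index_set_def)
    then have "(\<lambda>K. ?W1 K - ?W2 K + ?W3 K) \<in> os_relations l n"
      unfolding os_relations_def by blast
    note r = os_class_relation[OF this] subsetD[OF os_relations_carrier this]
    have W: "?W1 \<in> carrier os_E" "?W2 \<in> carrier os_E" "?W3 \<in> carrier os_E"
      using ij idx by (simp_all add: ext_carrier)
    have s: "(\<lambda>K. ?W2 K + -1 * ?W1 K) \<in> carrier os_E"
      using W by (intro ext_carrier_add ext_carrier_scale)
    have "os_class l n ?W3 = os_class l n (\<lambda>K. (?W1 K - ?W2 K + ?W3 K) + (?W2 K + -1 * ?W1 K))"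
      by simp
    also have "\<dots> = os_class l n (\<lambda>K. ?W2 K + -1 * ?W1 K)"
      unfolding os_class_add[OF r(2) s, symmetric] r(1) using os_class_closed[OF s] by (rule l_zero)
    also have "\<dots> = os_class l n ?W2 \<oplus>\<^bsub>os_A\<^esub> os_scale l n (-1) (os_class l n ?W1)"
      using W by (simp only: os_scale_class os_class_add ext_carrier_scale)
    finally show ?thesis
      using ij idx by (simp add: os_gen_def os_class_wedge ext_carrier)
  qed
  show ?thesis
  proof (cases "h < k")
    case True
    then show ?thesis using assms lt[of h k] by (simp add: u_def max_def min_def)
  next
    case False
    then have kh: "k < h" "l < h" using assms(3,4) by auto
    then have idx: "(k, h) \<in> index_set l n" using assms by (auto simp: index_set_def)
    have "?g (h, m) \<otimes>\<^bsub>os_A\<^esub> ?g (k, m) = os_scale l n (-1) (?g (k, h) \<otimes>\<^bsub>os_A\<^esub> ?g (h, m) \<oplus>\<^bsub>os_A\<^esub>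
        os_scale l n (-1) (?g (k, h) \<otimes>\<^bsub>os_A\<^esub> ?g (k, m)))"
      unfolding os_gen_anticommute[OF assms(1,2)] lt[OF assms(2,1) kh] ..
    also have "\<dots> = ?g (k, h) \<otimes>\<^bsub>os_A\<^esub> ?g (k, m) \<oplus>\<^bsub>os_A\<^esub> os_scale l n (-1) (?g (k, h) \<otimes>\<^bsub>os_A\<^esub> ?g (h, m))"
      using assms idx by (simp add: os_scale_add os_scale_closed os_gen_closed os_scale_scale os_scale_one a_comm)
    finally show ?thesis using kh by (simp add: u_def max_def min_def)
  qed
qed

section \<open>Sorted words span the algebra\<close>

primrec ext_word :: "(nat \<times> nat) list \<Rightarrow> (nat \<times> nat) set \<Rightarrow> complex" where
  "ext_word [] = ext_monom {}"
| "ext_word (p # w) = wedge (ext_word w) (ext_gen p)"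

text \<open>The head of a word is its last factor, so an admissible word gives an
  \<open>a_{I,J}\<close> with its indices \<open>J\<close> in increasing order.\<close>

definition os_word_class :: "(nat \<times> nat) list \<Rightarrow> ((nat \<times> nat) set \<Rightarrow> complex) set" where
  "os_word_class w = os_class l n (ext_word w)"

lemma ext_word_carrier: "set w \<subseteq> index_set l n \<Longrightarrow> ext_word w \<in> carrier os_E"
  by (induction w) (simp_all add: ext_monom_carrier ext_carrier)

lemma os_word_class_closed: "set w \<subseteq> index_set l n \<Longrightarrow> os_word_class w \<in> carrier os_A"
  by (simp add: os_word_class_def os_class_closed ext_word_carrier)

lemma os_word_class_Cons:
  "set (p # w) \<subseteq> index_set l n \<Longrightarrow> os_word_class (p # w) = os_word_class w \<otimes>\<^bsub>os_A\<^esub> os_gen l n p"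
  by (simp add: os_word_class_def os_gen_def os_class_wedge ext_word_carrier ext_carrier)

text \<open>The bound \<open>M\<close> on second indices leaves room for a further factor of larger
  index on the right.\<close>

inductive_set os_span :: "nat \<Rightarrow> nat \<Rightarrow> ((nat \<times> nat) set \<Rightarrow> complex) set set" for q M where
  span_zero: "\<zero>\<^bsub>os_A\<^esub> \<in> os_span q M"
| span_add: "a \<in> os_span q M \<Longrightarrow> b \<in> os_span q M \<Longrightarrow> a \<oplus>\<^bsub>os_A\<^esub> b \<in> os_span q M"
| span_scale: "a \<in> os_span q M \<Longrightarrow> os_scale l n c a \<in> os_span q M"
| span_word: "os_word l n w \<Longrightarrow> length w = q \<Longrightarrow> \<forall>p\<in>set w. snd p \<le> M \<Longrightarrow> os_word_class w \<in> os_span q M"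

lemma os_span_closed: "a \<in> os_span q M \<Longrightarrow> a \<in> carrier os_A"
proof -
  interpret ring os_A by (rule ring_os_algebra)
  show "a \<in> os_span q M \<Longrightarrow> a \<in> carrier os_A"
    by (induction rule: os_span.induct) (auto simp: os_scale_closed os_word_def intro: os_word_class_closed)
qed

lemma os_span_mono: "a \<in> os_span q M \<Longrightarrow> M \<le> M' \<Longrightarrow> a \<in> os_span q M'"
  by (induction rule: os_span.induct) (force intro: os_span.intros)+

lemma os_span_mult:
  assumes "a \<in> os_span q M" "g \<in> carrier os_A"
    and "\<And>w. os_word l n w \<Longrightarrow> length w = q \<Longrightarrow> \<forall>p\<in>set w. snd p \<le> M \<Longrightarrow> os_word_class w \<otimes>\<^bsub>os_A\<^esub> g \<in> os_span q' M'"
  shows "a \<otimes>\<^bsub>os_A\<^esub> g \<in> os_span q' M'"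
proof -
  interpret ring os_A by (rule ring_os_algebra)
  show ?thesis
    using assms(1)
    by (induction rule: os_span.induct)
      (simp_all add: assms(2,3) os_span_closed l_distr os_scale_mult os_span.intros)
qed

lemma os_span_mult_gen_above:
  assumes "a \<in> os_span q M" "(k, m) \<in> index_set l n" "M < m"
  shows "a \<otimes>\<^bsub>os_A\<^esub> os_gen l n (k, m) \<in> os_span (Suc q) m"
proof (rule os_span_mult[OF assms(1) os_gen_closed[OF assms(2)]])
  fix w assume w: "os_word l n w" "length w = q" "\<forall>p\<in>set w. snd p \<le> M"
  then have "os_word l n ((k, m) # w)" "\<forall>p\<in>set ((k, m) # w). snd p \<le> m"
    using assms(2,3) by (fastforce simp: os_word_def)+
  then show "os_word_class w \<otimes>\<^bsub>os_A\<^esub> os_gen l n (k, m) \<in> os_span (Suc q) m"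
    using span_word[of "(k, m) # w" "Suc q" m] w(2) by (simp add: os_word_class_Cons os_word_def)
qed

text \<open>A new factor whose index does not exceed that of the head is moved past it or rewritten,
  unless the product vanishes. This leaves the tail times a generator of smaller index; by induction
  the result stays below the index of the head, so a factor with that index can be put back.\<close>

lemma os_word_class_mult_gen:
  assumes "os_word l n w" "\<forall>p\<in>set w. snd p \<le> M" "(k, m) \<in> index_set l n" "m \<le> M"
  shows "os_word_class w \<otimes>\<^bsub>os_A\<^esub> os_gen l n (k, m) \<in> os_span (Suc (length w)) M"
  using assms
proof (induction w arbitrary: k m M)
  case Nil
  have "os_word l n [(k, m)]" using Nil by (simp add: os_word_def)
  then show ?case
    using span_word[of "[(k, m)]" 1 M] Nil os_word_class_Cons[of "(k, m)" "[]"] by simp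
next
  case (Cons p w)
  interpret ring os_A by (rule ring_os_algebra)
  let ?g = "os_gen l n"
  obtain h m0 where p: "p = (h, m0)" by (cases p)
  have w: "os_word l n w" and lt: "\<forall>q\<in>set w. snd q < m0" and idx: "(h, m0) \<in> index_set l n"
    and m0: "m0 \<le> M" "0 < m0"
    using Cons.prems by (auto simp: os_word_def p index_set_def)
  have le: "\<forall>q\<in>set w. snd q \<le> m0 - 1" using lt by fastforce
  have sub: "set w \<subseteq> index_set l n" using w by (simp add: os_word_def)
  note cl = os_gen_closed[OF idx] os_gen_closed[OF Cons.prems(3)] os_word_class_closed[OF sub]
  \<comment> \<open>The induction hypothesis is used with the bound \<open>m0 - 1\<close>, which
    makes \<open>(i', m0)\<close> the strictly largest letter again.\<close>
  have step: "(os_word_class w \<otimes>\<^bsub>os_A\<^esub> ?g (i, j)) \<otimes>\<^bsub>os_A\<^esub> ?g (i', m0) \<in> os_span (Suc (Suc (length w))) M"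
    if "(i, j) \<in> index_set l n" "j < m0" "(i', m0) \<in> index_set l n" for i j i'
  proof -
    have "os_word_class w \<otimes>\<^bsub>os_A\<^esub> ?g (i, j) \<in> os_span (Suc (length w)) (m0 - 1)"
      by (rule Cons.IH[OF w le that(1)]) (use that in simp)
    from os_span_mult_gen_above[OF this that(3)] show ?thesis
      using m0 by (auto intro: os_span_mono)
  qed
  have eq: "os_word_class (p # w) \<otimes>\<^bsub>os_A\<^esub> ?g (k, m) = os_word_class w \<otimes>\<^bsub>os_A\<^esub> (?g (h, m0) \<otimes>\<^bsub>os_A\<^esub> ?g (k, m))"
    using sub idx cl by (simp add: os_word_class_Cons p m_assoc)
  consider "m0 < m" | "m < m0" | "m = m0" "h = k \<or> (h \<le> l \<and> k \<le> l)" | "m = m0" "h \<noteq> k" "l < max h k"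
    by linarith
  then show ?case
  proof cases
    case 1
    then have "os_word l n ((k, m) # p # w)" "\<forall>q\<in>set ((k, m) # p # w). snd q \<le> M"
      using Cons.prems lt p by (fastforce simp: os_word_def)+
    then show ?thesis
      using span_word[of "(k, m) # p # w" _ M] by (simp add: os_word_class_Cons os_word_def)
  next
    case 2
    have "os_word_class (p # w) \<otimes>\<^bsub>os_A\<^esub> ?g (k, m) =
        os_scale l n (-1) ((os_word_class w \<otimes>\<^bsub>os_A\<^esub> ?g (k, m)) \<otimes>\<^bsub>os_A\<^esub> ?g (h, m0))"
      unfolding eq os_gen_anticommute[OF idx Cons.prems(3)] using cl by (simp add: os_scale_mult m_assoc)
    then show ?thesis using step[OF Cons.prems(3) 2 idx] by (simp add: span_scale)
  next
    case 3
    then have "?g (h, m0) \<otimes>\<^bsub>os_A\<^esub> ?g (k, m) = \<zero>\<^bsub>os_A\<^esub>"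
      using idx Cons.prems(3) os_gen_square os_gen_mult_low by blast
    then show ?thesis unfolding eq using cl by (simp add: span_zero)
  next
    case 4
    let ?u = "?g (min h k, max h k)"
    have u: "(min h k, max h k) \<in> index_set l n" "max h k < m0"
      using 4 idx Cons.prems(3) by (auto simp: index_set_def)
    have "os_word_class (p # w) \<otimes>\<^bsub>os_A\<^esub> ?g (k, m) =
        (os_word_class w \<otimes>\<^bsub>os_A\<^esub> ?u) \<otimes>\<^bsub>os_A\<^esub> ?g (k, m) \<oplus>\<^bsub>os_A\<^esub>
        os_scale l n (-1) ((os_word_class w \<otimes>\<^bsub>os_A\<^esub> ?u) \<otimes>\<^bsub>os_A\<^esub> ?g (h, m0))"
      unfolding eq using os_gen_mult_high[OF idx, of k] 4 Cons.prems(3) cl os_gen_closed[OF u(1)]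
      by (simp add: r_distr os_scale_mult os_scale_closed m_assoc)
    then show ?thesis
      using step[OF u idx] step[OF u, of k] 4 Cons.prems(3) by (simp add: span_scale span_add)
  qed
qed

lemma os_class_monom_span:
  assumes "sorted_wrt gen_less xs" "set xs \<subseteq> index_set l n"
  shows "os_class l n (ext_monom (set xs)) \<in> os_span (length xs) n"
  using assms
proof (induction xs rule: rev_induct)
  case Nil
  have "os_word l n []" by (simp add: os_word_def)
  then show ?case using span_word[of "[]" 0 n] by (simp add: os_word_class_def)
next
  case (snoc p xs)
  then have IH: "os_class l n (ext_monom (set xs)) \<in> os_span (length xs) n"
    by (simp add: sorted_wrt_append)
  obtain k m where p: "p = (k, m)" by (cases p)
  have idx: "(k, m) \<in> index_set l n" "m \<le> n"
    using snoc.prems p by (auto simp: index_set_def)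
  have "ext_monom (set (xs @ [p])) = wedge (ext_monom (set xs)) (ext_gen p)"
    using snoc.prems by (subst wedge_ext_monom_gen) (auto simp: sorted_wrt_append)
  then have "os_class l n (ext_monom (set (xs @ [p]))) =
      os_class l n (ext_monom (set xs)) \<otimes>\<^bsub>os_A\<^esub> os_gen l n p"
    using snoc.prems by (simp add: os_class_wedge os_gen_def ext_monom_carrier ext_carrier)
  also have "\<dots> \<in> os_span (Suc (length xs)) n"
  proof (rule os_span_mult[OF IH])
    show "os_gen l n p \<in> carrier os_A" using idx by (simp add: p os_gen_closed)
    fix w assume w: "os_word l n w" "length w = length xs" "\<forall>p\<in>set w. snd p \<le> n"
    show "os_word_class w \<otimes>\<^bsub>os_A\<^esub> os_gen l n p \<in> os_span (Suc (length xs)) n"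
      using os_word_class_mult_gen[OF w(1,3) idx] w(2) by (simp add: p)
  qed
  finally show ?case by simp
qed

lemma os_graded_subset_span: "os_graded l n q \<subseteq> os_span q n"
proof
  fix a assume "a \<in> os_graded l n q"
  then obtain x where a: "a = os_class l n x" and x: "x \<in> carrier os_E" "\<forall>K. x K \<noteq> 0 \<longrightarrow> card K = q"
    by (auto simp: os_graded_def)
  let ?F = "{K. K \<subseteq> index_set l n \<and> card K = q}"
  have mon: "os_class l n (ext_monom K) \<in> os_span q n" if "K \<in> ?F" for K
  proof -
    let ?xs = "filter (\<lambda>p. p \<in> K) (gen_list l n)"
    have s: "sorted_wrt gen_less ?xs" "set ?xs = K"
      using gen_list[of l n] that by (auto intro: sorted_wrt_filter)
    moreover have "length ?xs = q"
      using distinct_card[OF gen_less_sorted_distinct[OF s(1)]] s(2) that by simp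
    ultimately show ?thesis using os_class_monom_span[of ?xs] that by simp
  qed
  have "os_class l n (\<lambda>K'. \<Sum>K\<in>F. x K * ext_monom K K') \<in> os_span q n" if "finite F" "F \<subseteq> ?F" for F
    using that
  proof (induction F rule: finite_induct)
    case empty
    then show ?case using span_zero by (simp add: os_class_zero)
  next
    case (insert K F)
    have c: "ext_monom K \<in> carrier os_E" "\<And>L. L \<in> F \<Longrightarrow> (\<lambda>K'. x L * ext_monom L K') \<in> carrier os_E"
      using insert.prems by (auto intro!: ext_carrier_scale ext_monom_carrier)
    have "os_class l n (\<lambda>K'. \<Sum>K\<in>insert K F. x K * ext_monom K K') =
       os_scale l n (x K) (os_class l n (ext_monom K)) \<oplus>\<^bsub>os_A\<^esub> os_class l n (\<lambda>K'. \<Sum>K\<in>F. x K * ext_monom K K')"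
      using insert.hyps c by (simp add: os_scale_class os_class_add ext_carrier_scale ext_carrier_sum)
    then show ?case using insert mon by (auto intro: span_add span_scale)
  qed
  note span = this
  have "finite ?F" using finite_index_set by simp
  have "(\<lambda>K'. \<Sum>K\<in>?F. x K * ext_monom K K') = x"
  proof
    fix K'
    have "(\<Sum>K\<in>?F. x K * ext_monom K K') = (\<Sum>K\<in>?F. if K = K' then x K' else 0)"
      by (rule sum.cong) (auto simp: ext_monom_def)
    also have "\<dots> = x K'"
      using x \<open>finite ?F\<close> by (auto simp: exterior_carrier_iff)
    finally show "(\<Sum>K\<in>?F. x K * ext_monom K K') = x K'" .
  qed
  then show "a \<in> os_span q n" unfolding a using span[OF \<open>finite ?F\<close> subset_refl] by simp
qed

section \<open>The grading\<close>

lemma os_gradedI: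
  "x \<in> carrier os_E \<Longrightarrow> (\<And>K. x K \<noteq> 0 \<Longrightarrow> card K = q) \<Longrightarrow> os_class l n x \<in> os_graded l n q"
  by (auto simp: os_graded_def)

lemma os_gradedE:
  assumes "a \<in> os_graded l n q"
  obtains x where "x \<in> carrier os_E" "\<forall>K. x K \<noteq> 0 \<longrightarrow> card K = q" "a = os_class l n x"
  using assms by (auto simp: os_graded_def)

lemma os_graded_add:
  assumes "a \<in> os_graded l n q" "b \<in> os_graded l n q"
  shows "a \<oplus>\<^bsub>os_A\<^esub> b \<in> os_graded l n q"
proof -
  obtain x where x: "x \<in> carrier os_E" "\<forall>K. x K \<noteq> 0 \<longrightarrow> card K = q" "a = os_class l n x"
    using assms(1) by (rule os_gradedE)
  obtain y where y: "y \<in> carrier os_E" "\<forall>K. y K \<noteq> 0 \<longrightarrow> card K = q" "b = os_class l n y"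
    using assms(2) by (rule os_gradedE)
  have card: "card K = q" if "x K + y K \<noteq> 0" for K
    using x(2) y(2) that by (metis add_0)
  show ?thesis
    unfolding x(3) y(3) os_class_add[OF x(1) y(1)] using ext_carrier_add[OF x(1) y(1)] card
    by (rule os_gradedI)
qed

lemma os_graded_scale: "a \<in> os_graded l n q \<Longrightarrow> os_scale l n c a \<in> os_graded l n q"
  by (elim os_gradedE) (auto simp: os_scale_class ext_carrier_scale intro: os_gradedI)

lemma os_graded_mult:
  assumes "a \<in> os_graded l n q" "b \<in> os_graded l n r"
  shows "a \<otimes>\<^bsub>os_A\<^esub> b \<in> os_graded l n (q + r)"
proof -
  obtain x where x: "x \<in> carrier os_E" "\<forall>K. x K \<noteq> 0 \<longrightarrow> card K = q" "a = os_class l n x"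
    using assms(1) by (rule os_gradedE)
  obtain y where y: "y \<in> carrier os_E" "\<forall>K. y K \<noteq> 0 \<longrightarrow> card K = r" "b = os_class l n y"
    using assms(2) by (rule os_gradedE)
  have w: "wedge x y \<in> carrier os_E" using x(1) y(1) by (rule wedge_carrier)
  have card: "card K = q + r" if K: "wedge x y K \<noteq> 0" for K
  proof -
    have "finite K"
      using w K finite_subset[OF _ finite_index_set] unfolding exterior_carrier_iff by blast
    obtain L where L: "L \<subseteq> K" "x L \<noteq> 0" "y (K - L) \<noteq> 0"
      using K unfolding wedge_def by (elim sum.not_neutral_contains_not_neutral) auto
    then show ?thesis
      using x(2)[rule_format, of L] y(2)[rule_format, of "K - L"] \<open>finite K\<close> card_Diff_subset[of L K] card_mono[of K L]
      by (simp add: finite_subset)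
  qed
  show ?thesis
    unfolding x(3) y(3) os_class_wedge[OF x(1) y(1)] using w card by (rule os_gradedI)
qed

lemma os_gen_graded: "p \<in> index_set l n \<Longrightarrow> os_gen l n p \<in> os_graded l n 1"
  unfolding os_gen_def
  by (rule os_gradedI[OF ext_gen_carrier]) (auto simp: ext_gen_def ext_monom_def split: if_splits)

lemma os_word_class_graded: "set w \<subseteq> index_set l n \<Longrightarrow> os_word_class w \<in> os_graded l n (length w)"
proof (induction w)
  case Nil
  show ?case
    unfolding os_word_class_def ext_word.simps
    by (rule os_gradedI[OF ext_monom_carrier]) (auto simp: ext_monom_def split: if_splits)
next
  case (Cons p w)
  then show ?case
    using os_graded_mult[of "os_word_class w" "length w" "os_gen l n p" 1] os_gen_graded
    by (simp add: os_word_class_Cons)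
qed

section \<open>Coordinates and linear independence\<close>

definition os_fun :: "((nat \<times> nat) set \<Rightarrow> complex) set \<Rightarrow> wfun" where
  "os_fun a = ext_act l n (SOME x. x \<in> carrier os_E \<and> os_class l n x = a) (\<lambda>w. if w = [] then 1 else 0)"

text \<open>Elements of the ideal act as zero, so the chosen representative does not matter.\<close>

lemma os_fun_class:
  assumes "x \<in> carrier os_E"
  shows "os_fun (os_class l n x) = ext_act l n x (\<lambda>w. if w = [] then 1 else 0)"
proof -
  let ?y = "SOME y. y \<in> carrier os_E \<and> os_class l n y = os_class l n x"
  have "?y \<in> carrier os_E \<and> os_class l n ?y = os_class l n x"
    by (rule someI[of _ x]) (use assms in simp)
  then show ?thesis unfolding os_fun_def by (blast intro: ext_act_os_class)
qed

lemma os_fun_add: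
  "a \<in> carrier os_A \<Longrightarrow> b \<in> carrier os_A \<Longrightarrow> os_fun (a \<oplus>\<^bsub>os_A\<^esub> b) = (\<lambda>w. os_fun a w + os_fun b w)"
  by (auto elim!: os_carrierE simp: os_class_add os_fun_class ext_carrier_add ext_act_add)

lemma os_fun_scale: "a \<in> carrier os_A \<Longrightarrow> os_fun (os_scale l n c a) = (\<lambda>w. c * os_fun a w)"
  by (auto elim!: os_carrierE simp: os_scale_class os_fun_class ext_carrier_scale ext_act_scale)

lemma os_fun_zero: "os_fun \<zero>\<^bsub>os_A\<^esub> = (\<lambda>w. 0)"
  by (simp add: os_class_zero os_fun_class ext_carrier) (simp add: ext_act_def)

text \<open>A generator whose index is smaller than all those in \<open>w\<close> becomes the first
  factor, which is the end of the list. The sign of the recursion is met only at the empty word,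
  where it is \<open>1\<close>.\<close>

lemma word_op_indicator:
  assumes "os_word l n (w @ [(x, y)])" "os_word l n v"
  shows "word_op v x y (\<lambda>u. if u = w then 1 else 0) = (if v = w @ [(x, y)] then 1 else 0)"
  using assms
proof (induction v arbitrary: w)
  case (Cons p v)
  obtain k m where p: "p = (k, m)" by (cases p)
  have xy: "1 \<le> x" "x < y" and v: "os_word l n v" "\<forall>q\<in>set v. snd q < m"
    using Cons.prems by (auto simp: os_word_def p index_set_def)
  have w: "\<forall>q\<in>set w. y < snd q" using Cons.prems(1) by (auto simp: os_word_def sorted_wrt_append)
  consider "y < m" | "y = m" | "m < y" by linarith
  then show ?case
  proof cases
    case 1
    show ?thesis
    proof (cases "\<exists>w0. w = p # w0")
      case True
      then obtain w0 where w0: "w = p # w0" by blast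
      have "os_word l n (w0 @ [(x, y)])" using Cons.prems(1) w0 by (simp add: os_word_def)
      from Cons.IH[OF this v(1)] show ?thesis
        using 1 xy by (simp add: p w0 word_op_Cons_less)
    next
      case False
      then have "(\<lambda>u. if p # u = w then 1 else 0 :: complex) = (\<lambda>u. 0)" by (intro ext) auto
      moreover have "p # v \<noteq> w @ [(x, y)]"
        using False 1 by (cases w) (auto simp: p)
      ultimately show ?thesis using 1 xy by (simp add: p word_op_Cons_less)
    qed
  next
    case 2
    have ne: "(h, m) # u \<noteq> w" for h u using w 2 by fastforce
    have "v = w \<longleftrightarrow> v = [] \<and> w = []"
      using v(2) w 2 by (cases w; cases v) auto
    moreover have "p # v = w @ [(x, y)] \<longleftrightarrow> w = [] \<and> v = [] \<and> k = x"
      using ne[of k] 2 by (cases w) (auto simp: p)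
    ultimately show ?thesis
      using xy 2 ne by (auto simp: p word_op_Cons_eq)
  next
    case 3
    have "p # v \<noteq> w @ [(x, y)]" using w 3 by (cases w) (auto simp: p)
    then show ?thesis using 3 by (simp add: p word_op_Cons_greater)
  qed
qed simp

lemma os_op_indicator:
  assumes "os_word l n (w @ [p])"
  shows "os_op l n p (\<lambda>u. if u = w then 1 else 0) = (\<lambda>v. if v = w @ [p] then 1 else 0)"
  using assms word_op_indicator[of w "fst p" "snd p"] by (auto simp: os_op_def)

text \<open>Since \<open>p\<close> is the last factor of \<open>ext_word (p # w)\<close>, it acts
  first and is appended first.\<close>

lemma ext_act_word:
  "os_word l n (u @ w) \<Longrightarrow> ext_act l n (ext_word w) (\<lambda>v. if v = u then 1 else 0) = (\<lambda>v. if v = u @ w then 1 else 0)"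
proof (induction w arbitrary: u)
  case Nil
  then show ?case by (simp add: ext_act_one)
next
  case (Cons p w)
  have "os_word l n (u @ [p])" "p \<in> index_set l n"
    using Cons.prems by (auto simp: os_word_def sorted_wrt_append)
  then show ?case
    using Cons.IH[of "u @ [p]"] Cons.prems by (simp add: ext_act_wedge ext_act_gen os_op_indicator)
qed

lemma os_fun_word:
  assumes "os_word l n w"
  shows "os_fun (os_word_class w) = (\<lambda>v. if v = w then 1 else 0)"
  using assms ext_act_word[of "[]" w]
  by (simp add: os_word_class_def os_fun_class ext_word_carrier os_word_def)

lemma finite_os_words: "finite {w. os_word l n w \<and> length w = q}"
  by (rule bij_betw_finite[THEN iffD1, OF bij_betw_basis_word finite_basis])

text \<open>Both sides are linear in \<open>a\<close>, and the coordinates of a word are its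
  indicator by \<open>os_fun_word\<close>. Hence an element of the span is determined by its
  coordinates.\<close>

lemma os_span_expansion:
  assumes "a \<in> os_span q M"
  shows "a = os_class l n (\<lambda>K. \<Sum>w | os_word l n w \<and> length w = q. os_fun a w * ext_word w K)"
  using assms
proof (induction rule: os_span.induct)
  case span_zero
  show ?case unfolding os_fun_zero by (simp add: os_class_zero)
next
  case (span_add a b)
  have c: "(\<lambda>K. \<Sum>w | os_word l n w \<and> length w = q. os_fun a w * ext_word w K) \<in> carrier os_E" for a
    by (intro ext_carrier_sum ext_carrier_scale ext_word_carrier) (auto simp: os_word_def)
  have "a \<oplus>\<^bsub>os_A\<^esub> b = os_class l n (\<lambda>K. \<Sum>w | os_word l n w \<and> length w = q. os_fun a w * ext_word w K) \<oplus>\<^bsub>os_A\<^esub>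
     os_class l n (\<lambda>K. \<Sum>w | os_word l n w \<and> length w = q. os_fun b w * ext_word w K)"
    using span_add.IH by (rule arg_cong2)
  also have "\<dots> = os_class l n (\<lambda>K. \<Sum>w | os_word l n w \<and> length w = q. os_fun (a \<oplus>\<^bsub>os_A\<^esub> b) w * ext_word w K)"
    using span_add.hyps by (simp add: os_class_add c os_fun_add os_span_closed distrib_right sum.distrib)
  finally show ?case .
next
  case (span_scale a c)
  have c: "(\<lambda>K. \<Sum>w | os_word l n w \<and> length w = q. os_fun a w * ext_word w K) \<in> carrier os_E" for a
    by (intro ext_carrier_sum ext_carrier_scale ext_word_carrier) (auto simp: os_word_def)
  have "os_scale l n c a = os_scale l n c (os_class l n (\<lambda>K. \<Sum>w | os_word l n w \<and> length w = q. os_fun a w * ext_word w K))"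
    using span_scale.IH by (rule arg_cong)
  also have "\<dots> = os_class l n (\<lambda>K. \<Sum>w | os_word l n w \<and> length w = q. os_fun (os_scale l n c a) w * ext_word w K)"
    using span_scale.hyps by (simp add: os_scale_class c os_fun_scale os_span_closed sum_distrib_left mult.assoc)
  finally show ?case .
next
  case (span_word w)
  have "(\<Sum>v | os_word l n v \<and> length v = q. os_fun (os_word_class w) v * ext_word v K) =
      (\<Sum>v | os_word l n v \<and> length v = q. if v = w then ext_word w K else 0)" for K
    by (rule sum.cong) (auto simp: os_fun_word[OF span_word(1)])
  then show ?case using span_word by (simp add: finite_os_words os_word_class_def)
qed

lemma os_graded_eqI:
  assumes "a \<in> os_graded l n q" "b \<in> os_graded l n q"
    and "\<And>w. os_word l n w \<Longrightarrow> length w = q \<Longrightarrow> os_fun a w = os_fun b w"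
  shows "a = b"
proof -
  have "a = os_class l n (\<lambda>K. \<Sum>w | os_word l n w \<and> length w = q. os_fun a w * ext_word w K)"
    by (rule os_span_expansion[OF subsetD[OF os_graded_subset_span assms(1)]])
  also have "\<dots> = os_class l n (\<lambda>K. \<Sum>w | os_word l n w \<and> length w = q. os_fun b w * ext_word w K)"
    using assms(3) by (intro arg_cong[of _ _ "os_class l n"] ext sum.cong) auto
  also have "\<dots> = b"
    by (rule os_span_expansion[OF subsetD[OF os_graded_subset_span assms(2)], symmetric])
  finally show ?thesis .
qed

lemma ex_os_graded:
  "\<exists>a\<in>os_graded l n q. \<forall>w. os_word l n w \<longrightarrow> length w = q \<longrightarrow> os_fun a w = f w"
proof -
  have "\<exists>a\<in>os_graded l n q. os_fun a = (\<lambda>v. if v \<in> W then f v else 0)"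
    if "finite W" "W \<subseteq> {w. os_word l n w \<and> length w = q}" for W
    using that
  proof (induction W rule: finite_induct)
    case empty
    have "\<zero>\<^bsub>os_A\<^esub> \<in> os_graded l n q"
      unfolding os_class_zero by (rule os_gradedI) (simp_all add: ext_carrier)
    then show ?case using os_fun_zero by auto
  next
    case (insert w W)
    then obtain a where a: "a \<in> os_graded l n q" "os_fun a = (\<lambda>v. if v \<in> W then f v else 0)" by blast
    have w: "os_word l n w" "length w = q" "set w \<subseteq> index_set l n"
      using insert.prems by (auto simp: os_word_def)
    let ?b = "os_scale l n (f w) (os_word_class w) \<oplus>\<^bsub>os_A\<^esub> a"
    have "?b \<in> os_graded l n q"
      using os_word_class_graded[OF w(3)] w(2) a(1) by (intro os_graded_add os_graded_scale) simp_all
    moreover have "a \<in> carrier os_A"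
      using a(1) os_class_closed by (elim os_gradedE) simp
    then have "os_fun ?b = (\<lambda>v. if v \<in> insert w W then f v else 0)"
      using insert.hyps by (auto simp: os_fun_add os_fun_scale os_scale_closed os_word_class_closed w(3) os_fun_word[OF w(1)] a(2))
    ultimately show ?case by blast
  qed
  from this[OF finite_os_words subset_refl] obtain a where a: "a \<in> os_graded l n q"
    "os_fun a = (\<lambda>v. if v \<in> {w. os_word l n w \<and> length w = q} then f v else 0)" by blast
  then show ?thesis by (intro bexI[of _ a]) simp_all
qed

section \<open>Multiplication by omega and the identification with cochains\<close>

lemma os_omega_class:
  "os_omega l n lam = os_class l n (\<lambda>K. \<Sum>p\<in>index_set l n. lam p * ext_gen p K)"
proof -
  interpret ring os_A by (rule ring_os_algebra)
  have "(\<Oplus>\<^bsub>os_A\<^esub>p\<in>S. os_scale l n (lam p) (os_gen l n p)) = os_class l n (\<lambda>K. \<Sum>p\<in>S. lam p * ext_gen p K)"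
    if "finite S" "S \<subseteq> index_set l n" for S
    using that
  proof (induction S rule: finite_induct)
    case empty
    then show ?case by (simp add: os_class_zero)
  next
    case (insert p S)
    have cS: "\<And>q. q \<in> S \<Longrightarrow> os_scale l n (lam q) (os_gen l n q) \<in> carrier os_A"
      using insert.prems by (auto intro: os_scale_closed os_gen_closed)
    have c: "\<And>q. q \<in> insert p S \<Longrightarrow> (\<lambda>K. lam q * ext_gen q K) \<in> carrier os_E" "ext_gen p \<in> carrier os_E"
      using insert.prems by (auto intro!: ext_carrier)
    show ?case
      using insert c cS
      by (subst finsum_insert)
        (auto simp: os_scale_closed os_gen_closed os_gen_def[of l n p] os_scale_class os_class_add ext_carrier_sum os_class_closed)
  qed
  then show ?thesis unfolding os_omega_def using finite_index_set by blast
qed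

lemma os_omega_carrier: "(\<lambda>K. \<Sum>p\<in>index_set l n. lam p * ext_gen p K) \<in> carrier os_E"
  by (intro ext_carrier_sum ext_carrier_scale ext_gen_carrier)

lemma os_omega_graded: "os_omega l n lam \<in> os_graded l n 1"
  unfolding os_omega_class
proof (rule os_gradedI[OF os_omega_carrier])
  fix K assume "(\<Sum>p\<in>index_set l n. lam p * ext_gen p K) \<noteq> 0"
  then obtain p where "ext_gen p K \<noteq> 0"
    by (elim sum.not_neutral_contains_not_neutral) auto
  then show "card K = 1" by (auto simp: ext_gen_def ext_monom_def split: if_splits)
qed

text \<open>Coordinates are obtained by acting on a fixed vector, so multiplication in the algebra
  becomes the action on coordinates.\<close>

lemma os_fun_mu:
  assumes "a \<in> carrier os_A" "os_word l n w"
  shows "os_fun (os_mu l n lam a) w = word_lam l n w lam (os_fun a)"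
proof -
  obtain x where x: "x \<in> carrier os_E" "a = os_class l n x" using assms(1) by (rule os_carrierE)
  have sum: "ext_act l n (\<lambda>K. \<Sum>p\<in>S. lam p * ext_gen p K) f = (\<lambda>w. \<Sum>p\<in>S. lam p * os_op l n p f w)"
    if "finite S" "S \<subseteq> index_set l n" for S f
    using that
    by (induction S rule: finite_induct)
      (simp_all add: ext_act_add ext_act_scale ext_act_gen, simp add: ext_act_def)
  have "os_fun (os_mu l n lam a) = ext_act l n (\<lambda>K. \<Sum>p\<in>index_set l n. lam p * ext_gen p K) (os_fun a)"
    using x os_omega_carrier
    by (simp add: os_mu_def os_omega_class os_class_wedge os_fun_class wedge_carrier ext_act_wedge)
  also have "\<dots> = (\<lambda>w. \<Sum>p\<in>index_set l n. lam p * os_op l n p (os_fun a) w)"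
    by (rule sum[OF finite_index_set subset_refl])
  finally show ?thesis using assms(2) by (simp add: word_lam_def os_op_def)
qed

text \<open>The \<open>foldr\<close> adds factors on the left while words grow by a factor on the
  right; splitting off the last factor of the product reconciles the two and reverses the
  list.\<close>

lemma os_monom_word_class:
  assumes "b \<in> basis l n q"
  shows "os_monom l n b = os_word_class (basis_word b)"
proof -
  interpret ring os_A by (rule ring_os_algebra)
  let ?F = "foldr (\<lambda>p x. os_gen l n p \<otimes>\<^bsub>os_A\<^esub> x)"
  have F: "?F zs y = ?F zs \<one>\<^bsub>os_A\<^esub> \<otimes>\<^bsub>os_A\<^esub> y \<and> ?F zs \<one>\<^bsub>os_A\<^esub> \<in> carrier os_A"
    if "set zs \<subseteq> index_set l n" "y \<in> carrier os_A" for zs y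
    using that by (induction zs) (simp_all add: os_gen_closed m_assoc)
  have "?F zs \<one>\<^bsub>os_A\<^esub> = os_word_class (rev zs)" if "set zs \<subseteq> index_set l n" for zs
    using that
  proof (induction zs rule: rev_induct)
    case Nil
    then show ?case by (simp add: os_word_class_def os_class_one)
  next
    case (snoc p zs)
    then show ?case
      using F[of zs "os_gen l n p"] by (simp add: os_word_class_Cons os_gen_closed)
  qed
  moreover have "os_word l n (basis_word b)"
    using bij_betwE[OF bij_betw_basis_word] assms by blast
  then have "set (zip (fst b) (snd b)) \<subseteq> index_set l n"
    by (simp add: os_word_def basis_word_def)
  ultimately show ?thesis
    by (simp add: os_monom_def basis_word_def case_prod_unfold)
qed

lemma os_graded_closed: "a \<in> os_graded l n q \<Longrightarrow> a \<in> carrier os_A"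
  using os_class_closed by (elim os_gradedE) simp

lemma os_cochain_iso_os_fun: "os_cochain_iso l n q (\<lambda>a. word_cochain l n q (os_fun a))"
proof -
  have "bij_betw (\<lambda>a. word_cochain l n q (os_fun a)) (os_graded l n q) (cochain_space l n q)"
    unfolding bij_betw_def
  proof
    show "inj_on (\<lambda>a. word_cochain l n q (os_fun a)) (os_graded l n q)"
      by (rule inj_onI, rule os_graded_eqI) (auto simp: word_cochain_eq_iff)
    have "u \<in> (\<lambda>a. word_cochain l n q (os_fun a)) ` os_graded l n q" if u: "u \<in> cochain_space l n q" for u
    proof -
      obtain f where f: "u = word_cochain l n q f" using ex_word_cochain[OF u] by blast
      obtain a where a: "a \<in> os_graded l n q" "\<forall>w. os_word l n w \<longrightarrow> length w = q \<longrightarrow> os_fun a w = f w"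
        using ex_os_graded by blast
      have "word_cochain l n q (os_fun a) = u" unfolding f word_cochain_eq_iff using a(2) by blast
      then show ?thesis using a(1) by blast
    qed
    then show "(\<lambda>a. word_cochain l n q (os_fun a)) ` os_graded l n q = cochain_space l n q"
      using word_cochain_space by blast
  qed
  then show ?thesis
    by (auto simp: os_cochain_iso_def os_fun_add os_fun_scale os_graded_closed word_cochain_add word_cochain_scale)
qed

lemma os_monom_dual_basis:
  assumes "b \<in> basis l n q"
  shows "os_monom l n b \<in> os_graded l n q" "word_cochain l n q (os_fun (os_monom l n b)) = dual_basis l n q b"
proof -
  have w: "os_word l n (basis_word b)" "length (basis_word b) = q"
    using bij_betwE[OF bij_betw_basis_word] assms by blast+
  then show "os_monom l n b \<in> os_graded l n q"
    using os_word_class_graded[of "basis_word b"] by (simp add: os_monom_word_class[OF assms] os_word_def)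
  have "(\<Sum>b'\<in>basis l n q. x b' * (if basis_word b' = basis_word b then 1 else 0)) = x b" for x :: chain
  proof -
    have "(\<Sum>b'\<in>basis l n q. x b' * (if basis_word b' = basis_word b then 1 else 0)) =
        (\<Sum>b'\<in>basis l n q. if b' = b then x b else 0)"
      using assms inj_onD[OF bij_betw_imp_inj_on[OF bij_betw_basis_word[of l n q]]]
      by (intro sum.cong) auto
    then show ?thesis using assms by (simp add: finite_basis)
  qed
  then show "word_cochain l n q (os_fun (os_monom l n b)) = dual_basis l n q b"
    by (auto simp: word_cochain_def dual_basis_def os_monom_word_class[OF assms] os_fun_word[OF w(1)])
qed

lemma os_mu_coboundary_deriv:
  assumes "a \<in> os_graded l n q"
  shows "os_mu l n lam a \<in> os_graded l n (Suc q)"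
    "word_cochain l n (Suc q) (os_fun (os_mu l n lam a)) = coboundary_deriv l n q lam (word_cochain l n q (os_fun a))"
proof -
  show "os_mu l n lam a \<in> os_graded l n (Suc q)"
    unfolding os_mu_def using os_graded_mult[OF os_omega_graded assms] by simp
  show "word_cochain l n (Suc q) (os_fun (os_mu l n lam a)) = coboundary_deriv l n q lam (word_cochain l n q (os_fun a))"
    unfolding coboundary_deriv_word_cochain word_cochain_eq_iff
    using os_fun_mu[OF os_graded_closed[OF assms]] by blast
qed

end

theorem theorem3p1:
  fixes l n :: nat
  assumes "1 \<le> l" and "l \<le> n"
  shows
    "(\<forall>lam q. cochain_linear l n q (Suc q) (coboundary_deriv l n q lam)) \<and>
     (\<forall>lam q. \<forall>u\<in>cochain_space l n q.
        coboundary_deriv l n (Suc q) lam (coboundary_deriv l n q lam u) = (\<lambda>_. 0)) \<and>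
     (\<exists>\<Phi>.
        (\<forall>q. os_cochain_iso l n q (\<Phi> q) \<and>
           (\<forall>b\<in>basis l n q. os_monom l n b \<in> os_graded l n q \<and>
              \<Phi> q (os_monom l n b) = dual_basis l n q b)) \<and>
        (\<forall>lam q. \<forall>a\<in>os_graded l n q.
           os_mu l n lam a \<in> os_graded l n (Suc q) \<and>
           \<Phi> (Suc q) (os_mu l n lam a) = coboundary_deriv l n q lam (\<Phi> q a)))"
\<comment> \<open>The witness depends on the degree but not on \<open>lam\<close>, so a single
  identification serves all directions at once.\<close>
proof (intro conjI allI ballI exI[of _ "\<lambda>q a. word_cochain l n q (os_fun l n a)"])
qed (use os_monom_dual_basis os_mu_coboundary_deriv in
  \<open>simp_all add: cochain_linear_coboundary_deriv coboundary_deriv_square os_cochain_iso_os_fun\<close>)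

end
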